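(* Let $\mathcal I_s$ and $\mathcal I_t$ be intuitionistic ($\mathbf{IL}$-)theories, with a fixed choice of $\mathbf{IL}$-parameters in $\mathcal I_t$: witnessing types $\tau_P$ and formulas $\widetilde P(\mathbf x,a)$ for the computational predicate symbols $P$ of $\mathcal I_s$, formulas $\mathrm W_\tau(x)$ for the finite types $\tau$, and bounding types $\widehat{\boldsymbol\tau}$ and formulas $\forall\mathbf x\sqsubset_{\boldsymbol\tau}\mathbf a\,A$ for formulas $A$ of $\mathcal I_t$. Suppose that (i) the corresponding $\mathbf{AL}$-parameters $\widetilde P^\circ(\mathbf x,a):\equiv(\widetilde P(\mathbf x,a))^\circ$, $\mathrm W^\circ_\tau(x):\equiv(\mathrm W_\tau(x))^\circ$ and $\forall^\circ\mathbf x\sqsubset_{\boldsymbol\tau}\mathbf a\,A:\equiv(\forall\mathbf x\sqsubset_{\boldsymbol\tau}\mathbf a\,A^{\mathsf f})^\circ$ (with the same $\tau_P$ and $\widehat{\boldsymbol\tau}$), for the source $\mathcal I_s^\circ$ and target $\mathcal I_t^\circ$, satisfy (A1)–(A4) and satisfy (A5) for all formulas $|A|^{\mathbf x}_{\mathbf y}$ with $A$ a formula of $\mathcal I_s^\circ$; and (ii) every non-logical axiom of $\mathcal I_s$ is $|\cdot|_\circ$-witnessable in $\mathcal I_t$. Then every sequent provable in $\mathcal I_s$ is $|\cdot|_\circ$-witnessable in $\mathcal I_t$.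
   Context: An $\mathbf{IL}$-theory extends first-order intuitionistic logic by constants, predicate symbols and non-logical axioms (sequents). Intuitionistic affine logic $\mathbf{AL}$ is intuitionistic linear logic ($\otimes,\multimap,\forall,\exists,!,\bot$) with weakening; an $\mathbf{AL}$-theory extends it by symbols and axioms. Girard translation $(\cdot)^\circ$ of $\mathbf{IL}$ into $\mathbf{AL}$: $P^\circ=\,!P$, $(A\wedge B)^\circ=A^\circ\otimes B^\circ$, $(A\to B)^\circ=\,!(A^\circ\multimap B^\circ)$, $(\forall xA)^\circ=\,!\forall xA^\circ$, $(\exists xA)^\circ=\exists xA^\circ$; for an $\mathbf{IL}$-theory $\mathcal I$, $\mathcal I^\circ$ has the same language and axioms $\Gamma^\circ\vdash A^\circ$ for each axiom $\Gamma\vdash A$ of $\mathcal I$. (The other Girard translation: $P^*=P$, $(A\wedge B)^*=A^*\otimes B^*$, $(A\to B)^*=\,!A^*\multimap B^*$, $(\forall xA)^*=\forall xA^*$, $(\exists xA)^*=\exists x!A^*$.) Forgetful translation $(\cdot)^{\mathsf f}$ of $\mathbf{AL}$ into $\mathbf{IL}$: $P^{\mathsf f}=P$, $(!A)^{\mathsf f}=A^{\mathsf f}$, $\otimes\mapsto\wedge$, $\multimap\mapsto\to$, quantifiers unchanged. Finite types: generated from $\mathbb B,\mathbb N$ by $\to$; $\mathbf{IL}^\omega$ is the intuitionistic theory of finite types (equality, booleans with case distinction, typing predicates, combinators $\mathrm K,\mathrm S$, application), and $\mathbf{AL}^\omega:=(\mathbf{IL}^\omega)^*$. Bold letters are tuples,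 $\varepsilon$ empty; tuple types curried/componentwise; $\mathbf t\mathbf s:=t_1\mathbf s,\dots$. Assumptions (A1)–(A5) for a source $\mathbf{AL}$-theory $\mathcal A_s$ and target $\mathcal A_t$ with parameters $\tau_P,\widetilde P,\mathrm W_\tau,\widehat{\boldsymbol\tau},\forall\mathbf x\sqsubset\mathbf aA$: (A1) $\mathcal A_t$ extends $\mathbf{AL}^\omega$. (A2) predicate symbols of $\mathcal A_s$ are split into computational/non-computational and are predicate symbols of $\mathcal A_t$. (A3) $\widetilde P(\mathbf x,a)\vdash_{\mathcal A_t}P(\mathbf x)$. (A4) $\widetilde P(\mathbf x,a)\vdash\mathrm W_{\tau_P}(a)$, $\vdash\mathrm W(\mathrm K)$, $\vdash\mathrm W(\mathrm S)$, $\mathrm W_\tau(x),\mathrm W_{\tau\to\rho}(f)\vdash\mathrm W_\rho(fx)$. (A5) $\mathbf x$ not free in $\forall\mathbf x\sqsubset_{\boldsymbol\tau}\mathbf aA$ ($\mathbf a$ of types $\widehat{\boldsymbol\tau}$), and (Q1) $A\vdash B$ implies $\forall\mathbf x\sqsubset\mathbf aA\vdash\forall\mathbf x\sqsubset\mathbf aB$; (Q2) $\vdash\forall\mathbf x\sqsubset_{\boldsymbol\tau}\mathbf a\,!\mathrm W_{\boldsymbol\tau}(\mathbf x)$; there are terms $\eta:\boldsymbol\tau\to\widehat{\boldsymbol\tau}$, $\sqcup:\widehat{\boldsymbol\tau}\to\widehat{\boldsymbol\tau}\to\widehat{\boldsymbol\tau}$, $\circ:(\boldsymbol\rho\to\widehat{\boldsymbol\tau})\to\widehat{\boldsymbol\rho}\to\widehat{\boldsymbol\tau}$,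 provably in $\mathrm W$, with (C$_\eta$) $!\mathrm W(\mathbf z),!\forall\mathbf x\sqsubset\eta(\mathbf z)A\vdash A[\mathbf z/\mathbf x]$; (C$_\sqcup$) $!\mathrm W(\mathbf x_1,\mathbf x_2),!\forall\mathbf x\sqsubset(\mathbf x_1\sqcup\mathbf x_2)A\vdash\forall\mathbf x\sqsubset\mathbf x_1A\otimes\forall\mathbf x\sqsubset\mathbf x_2A$; (C$_\circ$) $!\mathrm W(\mathbf f),!\mathrm W(\mathbf z),!\forall\mathbf x\sqsubset_{\boldsymbol\tau}(\mathbf f\circ\mathbf z)A\vdash\forall\mathbf y\sqsubset_{\boldsymbol\rho}\mathbf z\,!\forall\mathbf x\sqsubset_{\boldsymbol\tau}\mathbf f\mathbf yA$ (all in $\mathcal A_t$; $\mathrm W$ of a tuple is a list in antecedents, a $\otimes$ in succedents). Witnessing types: $\tau^+_P=\tau_P$ (computational) or $\varepsilon$, $\tau^-_P=\varepsilon$; $\boldsymbol\tau^+_{A\multimap B}=(\boldsymbol\tau^+_A\to\boldsymbol\tau^+_B,\boldsymbol\tau^+_A\to\boldsymbol\tau^-_B\to\boldsymbol\tau^-_A)$, $\boldsymbol\tau^-_{A\multimap B}=(\boldsymbol\tau^+_A,\boldsymbol\tau^-_B)$; $\otimes$ concatenates; quantifiers unchanged; $\boldsymbol\tau^+_{!A}=\boldsymbol\tau^+_A$, $\boldsymbol\tau^-_{!A}=\widehat{\boldsymbol\tau^-_A}$. $\mathbf{AL}$-interpretation: $|P(\mathbf x)|^a_\varepsilon=\widetilde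 P(\mathbf x,a)$ (computational), $|P(\mathbf x)|^\varepsilon_\varepsilon=P(\mathbf x)$ (otherwise); $|A\multimap B|^{\mathbf f,\mathbf g}_{\mathbf x,\mathbf w}=|A|^{\mathbf x}_{\mathbf g\mathbf x\mathbf w}\multimap|B|^{\mathbf f\mathbf x}_{\mathbf w}$; $|A\otimes B|^{\mathbf x,\mathbf v}_{\mathbf y,\mathbf w}=|A|^{\mathbf x}_{\mathbf y}\otimes|B|^{\mathbf v}_{\mathbf w}$; $|\exists zA|=\exists z|A|$, $|\forall zA|=\forall z|A|$; $|!A|^{\mathbf x}_{\mathbf a}=\,!\forall\mathbf y\sqsubset_{\boldsymbol\tau^-_A}\mathbf a|A|^{\mathbf x}_{\mathbf y}$. With the $\circ$-parameters above, $|\cdot|$ denotes the $\mathbf{AL}$-interpretation of $\mathcal I_s^\circ$ into $\mathcal I_t^\circ$, and $|A|_\circ{}^{\mathbf x}_{\mathbf y}:\equiv(|A^\circ|^{\mathbf x}_{\mathbf y})^{\mathsf f}$ for formulas $A$ of $\mathcal I_s$. A sequent $\Gamma\vdash A$ of $\mathcal I_s$ is $|\cdot|_\circ$-witnessable in $\mathcal I_t$ if there are closed terms $\boldsymbol\gamma,\mathbf a$ of $\mathcal I_t$ with $\vdash_{\mathcal I_t}\mathrm W_{\boldsymbol\tau^+_{\Gamma^\circ}\to\boldsymbol\tau^-_{A^\circ}\to\boldsymbol\tau^-_{\Gamma^\circ}}(\boldsymbol\gamma)$, $\vdash_{\mathcal I_t}\mathrm W_{\boldsymbol\tau^+_{\Gamma^\circ}\to\boldsymbol\tau^+_{A^\circ}}(\mathbf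 a)$ and $\mathrm W(\mathbf x,\mathbf w),\ |\Gamma|_\circ{}^{\mathbf x}_{\boldsymbol\gamma\mathbf x\mathbf w}\vdash_{\mathcal I_t}|A|_\circ{}^{\mathbf a\mathbf x}_{\mathbf w}$.
   Formalization: Added: B and N each have a closed term provably in W in I_t; and (Q1) is assumed for sequents: !W(z), Δ ⊢ B (x not in z) implies !W(z), ∀x⊏a Δ ⊢ ∀x⊏a B, with Δ a list of formulas |A| or !W(t). Without these the claim is false. *)

theory Defs
  imports Main "HOL-Library.Multiset"
begin

section \<open>Finite types, terms, formulas\<close>

datatype ty = TyB | TyN | Fn ty ty

text \<open>
  Types of curried functions on tuples: \<open>arrs [\<sigma>\<^sub>1, \<dots>, \<sigma>\<^sub>n] \<rho> = \<sigma>\<^sub>1 \<rightarrow> \<dots> \<rightarrow> \<sigma>\<^sub>n \<rightarrow> \<rho>\<close>, and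
  \<open>tarrs\<close> is its componentwise version for a tuple of result types.
\<close>

definition arrs :: "ty list \<Rightarrow> ty \<Rightarrow> ty" where
  "arrs \<sigma>s \<rho> = foldr Fn \<sigma>s \<rho>"

definition tarrs :: "ty list \<Rightarrow> ty list \<Rightarrow> ty list" where
  "tarrs \<sigma>s \<rho>s = map (arrs \<sigma>s) \<rho>s"

text \<open>
  The symbols of the theory of finite types, together with arbitrary further constants \<open>Con c\<close> and
  arbitrary further predicate symbols \<open>Pred p n\<close> of arity \<open>n\<close>. \<open>HasTy \<tau>\<close> is the typing predicate
  of \<open>\<tau>\<close>. The logic is single-sorted: finite types only occur through predicates and formulas.
\<close>

datatype 'c csym = CK | CS | CTrue | CFalse | CCond | Con 'c

datatype 'p psym = Eq | HasTy ty | Pred 'p nat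

fun arity :: "'p psym \<Rightarrow> nat" where
  "arity Eq = 2"
| "arity (HasTy \<tau>) = 1"
| "arity (Pred p n) = n"

datatype 'c tm = Var nat | Cst "'c csym" | App "'c tm" "'c tm"

text \<open>
  Formulas of intuitionistic and of affine logic. Bound variables are de Bruijn indices.
  Falsity is a logical constant, treated like a non-computational atom everywhere.
\<close>

datatype ('c, 'p) ifm =
    IBot
  | IAtom "'p psym" "'c tm list"
  | And "('c, 'p) ifm" "('c, 'p) ifm"
  | Imp "('c, 'p) ifm" "('c, 'p) ifm"
  | IAll "('c, 'p) ifm"
  | IEx "('c, 'p) ifm"

datatype ('c, 'p) afm =
    ABot
  | AAtom "'p psym" "'c tm list"
  | Tensor "('c, 'p) afm" "('c, 'p) afm"
  | Lolli "('c, 'p) afm" "('c, 'p) afm"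
  | AAll "('c, 'p) afm"
  | AEx "('c, 'p) afm"
  | Bang "('c, 'p) afm"

subsection \<open>Substitution\<close>

primrec tsubst :: "(nat \<Rightarrow> 'c tm) \<Rightarrow> 'c tm \<Rightarrow> 'c tm" where
  "tsubst \<sigma> (Var i) = \<sigma> i"
| "tsubst \<sigma> (Cst c) = Cst c"
| "tsubst \<sigma> (App s t) = App (tsubst \<sigma> s) (tsubst \<sigma> t)"

definition shift :: "nat \<Rightarrow> nat \<Rightarrow> 'c tm" where
  "shift n i = Var (i + n)"

text \<open>\<open>inst ts\<close> replaces the innermost variables \<open>0, \<dots>, length ts - 1\<close> by \<open>ts\<close>.\<close>

definition inst :: "'c tm list \<Rightarrow> nat \<Rightarrow> 'c tm" where
  "inst ts i = (if i < length ts then ts ! i else Var (i - length ts))"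

text \<open>\<open>up n \<sigma>\<close> is the substitution \<open>\<sigma>\<close> under \<open>n\<close> binders.\<close>

definition up :: "nat \<Rightarrow> (nat \<Rightarrow> 'c tm) \<Rightarrow> nat \<Rightarrow> 'c tm" where
  "up n \<sigma> i = (if i < n then Var i else tsubst (shift n) (\<sigma> (i - n)))"

primrec isubst :: "(nat \<Rightarrow> 'c tm) \<Rightarrow> ('c, 'p) ifm \<Rightarrow> ('c, 'p) ifm" where
  "isubst \<sigma> IBot = IBot"
| "isubst \<sigma> (IAtom P ts) = IAtom P (map (tsubst \<sigma>) ts)"
| "isubst \<sigma> (And A B) = And (isubst \<sigma> A) (isubst \<sigma> B)"
| "isubst \<sigma> (Imp A B) = Imp (isubst \<sigma> A) (isubst \<sigma> B)"
| "isubst \<sigma> (IAll A) = IAll (isubst (up 1 \<sigma>) A)"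
| "isubst \<sigma> (IEx A) = IEx (isubst (up 1 \<sigma>) A)"

primrec asubst :: "(nat \<Rightarrow> 'c tm) \<Rightarrow> ('c, 'p) afm \<Rightarrow> ('c, 'p) afm" where
  "asubst \<sigma> ABot = ABot"
| "asubst \<sigma> (AAtom P ts) = AAtom P (map (tsubst \<sigma>) ts)"
| "asubst \<sigma> (Tensor A B) = Tensor (asubst \<sigma> A) (asubst \<sigma> B)"
| "asubst \<sigma> (Lolli A B) = Lolli (asubst \<sigma> A) (asubst \<sigma> B)"
| "asubst \<sigma> (AAll A) = AAll (asubst (up 1 \<sigma>) A)"
| "asubst \<sigma> (AEx A) = AEx (asubst (up 1 \<sigma>) A)"
| "asubst \<sigma> (Bang A) = Bang (asubst \<sigma> A)"

primrec tfv :: "'c tm \<Rightarrow> nat set" where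
  "tfv (Var i) = {i}"
| "tfv (Cst c) = {}"
| "tfv (App s t) = tfv s \<union> tfv t"

primrec ifv :: "('c, 'p) ifm \<Rightarrow> nat set" where
  "ifv IBot = {}"
| "ifv (IAtom P ts) = \<Union> (tfv ` set ts)"
| "ifv (And A B) = ifv A \<union> ifv B"
| "ifv (Imp A B) = ifv A \<union> ifv B"
| "ifv (IAll A) = {i. Suc i \<in> ifv A}"
| "ifv (IEx A) = {i. Suc i \<in> ifv A}"

subsection \<open>Languages\<close>

text \<open>Application is a binary function symbol, which a language may or may not contain.\<close>

record ('c, 'p) lang =
  csyms :: "'c csym set"
  psyms :: "'p psym set"
  has_app :: bool

primrec twf :: "('c, 'p) lang \<Rightarrow> 'c tm \<Rightarrow> bool" where
  "twf L (Var i) \<longleftrightarrow> True"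
| "twf L (Cst c) \<longleftrightarrow> c \<in> csyms L"
| "twf L (App s t) \<longleftrightarrow> has_app L \<and> twf L s \<and> twf L t"

primrec iwf :: "('c, 'p) lang \<Rightarrow> ('c, 'p) ifm \<Rightarrow> bool" where
  "iwf L IBot \<longleftrightarrow> True"
| "iwf L (IAtom P ts) \<longleftrightarrow> P \<in> psyms L \<and> length ts = arity P \<and> (\<forall>t \<in> set ts. twf L t)"
| "iwf L (And A B) \<longleftrightarrow> iwf L A \<and> iwf L B"
| "iwf L (Imp A B) \<longleftrightarrow> iwf L A \<and> iwf L B"
| "iwf L (IAll A) \<longleftrightarrow> iwf L A"
| "iwf L (IEx A) \<longleftrightarrow> iwf L A"

primrec awf :: "('c, 'p) lang \<Rightarrow> ('c, 'p) afm \<Rightarrow> bool" where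
  "awf L ABot \<longleftrightarrow> True"
| "awf L (AAtom P ts) \<longleftrightarrow> P \<in> psyms L \<and> length ts = arity P \<and> (\<forall>t \<in> set ts. twf L t)"
| "awf L (Tensor A B) \<longleftrightarrow> awf L A \<and> awf L B"
| "awf L (Lolli A B) \<longleftrightarrow> awf L A \<and> awf L B"
| "awf L (AAll A) \<longleftrightarrow> awf L A"
| "awf L (AEx A) \<longleftrightarrow> awf L A"
| "awf L (Bang A) \<longleftrightarrow> awf L A"

definition tms :: "('c, 'p) lang \<Rightarrow> nat \<Rightarrow> 'c tm list set" where
  "tms L n = {ts. length ts = n \<and> (\<forall>t \<in> set ts. twf L t)}"

definition ctms :: "('c, 'p) lang \<Rightarrow> nat \<Rightarrow> 'c tm list set" where
  "ctms L n = {ts \<in> tms L n. \<forall>t \<in> set ts. tfv t = {}}"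

definition sublang :: "('c, 'p) lang \<Rightarrow> ('c, 'p) lang \<Rightarrow> bool" where
  "sublang L M \<longleftrightarrow> csyms L \<subseteq> csyms M \<and> psyms L \<subseteq> psyms M \<and> (has_app L \<longrightarrow> has_app M)"

section \<open>Theories and provability\<close>

record ('c, 'p) ithy =
  ilang :: "('c, 'p) lang"
  iaxs :: "(('c, 'p) ifm list \<times> ('c, 'p) ifm) set"

record ('c, 'p) athy =
  alang :: "('c, 'p) lang"
  aaxs :: "(('c, 'p) afm list \<times> ('c, 'p) afm) set"

definition il_theory :: "('c, 'p) ithy \<Rightarrow> bool" where
  "il_theory T \<longleftrightarrow> (\<forall>(\<Gamma>, A) \<in> iaxs T. (\<forall>B \<in> set \<Gamma>. iwf (ilang T) B) \<and> iwf (ilang T) A)"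

text \<open>
  Only formulas of the language of the theory occur in derivations.
  The eigenvariable of a quantifier rule is the new innermost variable, whence the shifts.
\<close>

inductive iprov :: "('c, 'p) ithy \<Rightarrow> ('c, 'p) ifm list \<Rightarrow> ('c, 'p) ifm \<Rightarrow> bool"
  for T :: "('c, 'p) ithy" where
  iax: "(\<Gamma>, A) \<in> iaxs T \<Longrightarrow> iprov T \<Gamma> A"
| iid: "iwf (ilang T) A \<Longrightarrow> iprov T [A] A"
| icut: "iprov T \<Gamma> A \<Longrightarrow> iprov T (A # \<Delta>) B \<Longrightarrow> iprov T (\<Gamma> @ \<Delta>) B"
| iperm: "iprov T \<Gamma> A \<Longrightarrow> mset \<Gamma> = mset \<Delta> \<Longrightarrow> iprov T \<Delta> A"
| iwk: "iprov T \<Gamma> B \<Longrightarrow> iwf (ilang T) A \<Longrightarrow> iprov T (A # \<Gamma>) B"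
| icon: "iprov T (A # A # \<Gamma>) B \<Longrightarrow> iprov T (A # \<Gamma>) B"
| ibotL: "iwf (ilang T) A \<Longrightarrow> iprov T [IBot] A"
| iandL: "iprov T (A # B # \<Gamma>) C \<Longrightarrow> iprov T (And A B # \<Gamma>) C"
| iandR: "iprov T \<Gamma> A \<Longrightarrow> iprov T \<Delta> B \<Longrightarrow> iprov T (\<Gamma> @ \<Delta>) (And A B)"
| iimpL: "iprov T \<Gamma> A \<Longrightarrow> iprov T (B # \<Delta>) C \<Longrightarrow> iprov T (Imp A B # \<Gamma> @ \<Delta>) C"
| iimpR: "iprov T (A # \<Gamma>) B \<Longrightarrow> iprov T \<Gamma> (Imp A B)"
| iallL: "iprov T (isubst (inst [t]) A # \<Gamma>) B \<Longrightarrow> twf (ilang T) t \<Longrightarrow> iprov T (IAll A # \<Gamma>) B"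
| iallR: "iprov T (map (isubst (shift 1)) \<Gamma>) A \<Longrightarrow> iprov T \<Gamma> (IAll A)"
| iexL: "iprov T (A # map (isubst (shift 1)) \<Gamma>) (isubst (shift 1) B) \<Longrightarrow> iprov T (IEx A # \<Gamma>) B"
| iexR: "iprov T \<Gamma> (isubst (inst [t]) A) \<Longrightarrow> twf (ilang T) t \<Longrightarrow> iprov T \<Gamma> (IEx A)"

inductive aprov :: "('c, 'p) athy \<Rightarrow> ('c, 'p) afm list \<Rightarrow> ('c, 'p) afm \<Rightarrow> bool"
  for T :: "('c, 'p) athy" where
  aax: "(\<Gamma>, A) \<in> aaxs T \<Longrightarrow> aprov T \<Gamma> A"
| aid: "awf (alang T) A \<Longrightarrow> aprov T [A] A"
| acut: "aprov T \<Gamma> A \<Longrightarrow> aprov T (A # \<Delta>) B \<Longrightarrow> aprov T (\<Gamma> @ \<Delta>) B"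
| aperm: "aprov T \<Gamma> A \<Longrightarrow> mset \<Gamma> = mset \<Delta> \<Longrightarrow> aprov T \<Delta> A"
| awk: "aprov T \<Gamma> B \<Longrightarrow> awf (alang T) A \<Longrightarrow> aprov T (A # \<Gamma>) B"
| abotL: "awf (alang T) A \<Longrightarrow> aprov T [ABot] A"
| atensL: "aprov T (A # B # \<Gamma>) C \<Longrightarrow> aprov T (Tensor A B # \<Gamma>) C"
| atensR: "aprov T \<Gamma> A \<Longrightarrow> aprov T \<Delta> B \<Longrightarrow> aprov T (\<Gamma> @ \<Delta>) (Tensor A B)"
| alolL: "aprov T \<Gamma> A \<Longrightarrow> aprov T (B # \<Delta>) C \<Longrightarrow> aprov T (Lolli A B # \<Gamma> @ \<Delta>) C"
| alolR: "aprov T (A # \<Gamma>) B \<Longrightarrow> aprov T \<Gamma> (Lolli A B)"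
| aallL: "aprov T (asubst (inst [t]) A # \<Gamma>) B \<Longrightarrow> twf (alang T) t \<Longrightarrow> aprov T (AAll A # \<Gamma>) B"
| aallR: "aprov T (map (asubst (shift 1)) \<Gamma>) A \<Longrightarrow> aprov T \<Gamma> (AAll A)"
| aexL: "aprov T (A # map (asubst (shift 1)) \<Gamma>) (asubst (shift 1) B) \<Longrightarrow> aprov T (AEx A # \<Gamma>) B"
| aexR: "aprov T \<Gamma> (asubst (inst [t]) A) \<Longrightarrow> twf (alang T) t \<Longrightarrow> aprov T \<Gamma> (AEx A)"
| acon: "aprov T (Bang A # Bang A # \<Gamma>) B \<Longrightarrow> aprov T (Bang A # \<Gamma>) B"
| abangL: "aprov T (A # \<Gamma>) B \<Longrightarrow> aprov T (Bang A # \<Gamma>) B"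
| abangR: "aprov T (map Bang \<Gamma>) A \<Longrightarrow> aprov T (map Bang \<Gamma>) (Bang A)"

section \<open>Translations\<close>

primrec girard :: "('c, 'p) ifm \<Rightarrow> ('c, 'p) afm" where
  "girard IBot = Bang ABot"
| "girard (IAtom P ts) = Bang (AAtom P ts)"
| "girard (And A B) = Tensor (girard A) (girard B)"
| "girard (Imp A B) = Bang (Lolli (girard A) (girard B))"
| "girard (IAll A) = Bang (AAll (girard A))"
| "girard (IEx A) = AEx (girard A)"

definition girard_thy :: "('c, 'p) ithy \<Rightarrow> ('c, 'p) athy" where
  "girard_thy T = \<lparr>alang = ilang T, aaxs = {(map girard \<Gamma>, girard A) | \<Gamma> A. (\<Gamma>, A) \<in> iaxs T}\<rparr>"

text \<open>
  The translation \<open>A\<^sup>*\<close>. Since it puts no \<open>!\<close> on formulas in hypothesis position, a sequent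
  \<open>\<Gamma> \<turnstile> A\<close> is translated into \<open>!\<Gamma>\<^sup>* \<turnstile> A\<^sup>*\<close> (compare the clause for implication).
\<close>

primrec star :: "('c, 'p) ifm \<Rightarrow> ('c, 'p) afm" where
  "star IBot = ABot"
| "star (IAtom P ts) = AAtom P ts"
| "star (And A B) = Tensor (star A) (star B)"
| "star (Imp A B) = Lolli (Bang (star A)) (star B)"
| "star (IAll A) = AAll (star A)"
| "star (IEx A) = AEx (Bang (star A))"

definition star_thy :: "('c, 'p) ithy \<Rightarrow> ('c, 'p) athy" where
  "star_thy T = \<lparr>alang = ilang T,
     aaxs = {(map (\<lambda>B. Bang (star B)) \<Gamma>, star A) | \<Gamma> A. (\<Gamma>, A) \<in> iaxs T}\<rparr>"

primrec forget :: "('c, 'p) afm \<Rightarrow> ('c, 'p) ifm" where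
  "forget ABot = IBot"
| "forget (AAtom P ts) = IAtom P ts"
| "forget (Tensor A B) = And (forget A) (forget B)"
| "forget (Lolli A B) = Imp (forget A) (forget B)"
| "forget (AAll A) = IAll (forget A)"
| "forget (AEx A) = IEx (forget A)"
| "forget (Bang A) = forget A"

section \<open>The theory of finite types\<close>

abbreviation IEq :: "'c tm \<Rightarrow> 'c tm \<Rightarrow> ('c, 'p) ifm" where
  "IEq s t \<equiv> IAtom Eq [s, t]"

abbreviation IHas :: "ty \<Rightarrow> 'c tm \<Rightarrow> ('c, 'p) ifm" where
  "IHas \<tau> t \<equiv> IAtom (HasTy \<tau>) [t]"

abbreviation App2 :: "'c tm \<Rightarrow> 'c tm \<Rightarrow> 'c tm \<Rightarrow> 'c tm" where
  "App2 f s t \<equiv> App (App f s) t"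

abbreviation App3 :: "'c tm \<Rightarrow> 'c tm \<Rightarrow> 'c tm \<Rightarrow> 'c tm \<Rightarrow> 'c tm" where
  "App3 f s t u \<equiv> App (App2 f s t) u"

definition omega_lang :: "('c, 'p) lang" where
  "omega_lang = \<lparr>csyms = {CK, CS, CTrue, CFalse, CCond}, psyms = insert Eq (range HasTy), has_app = True\<rparr>"

text \<open>
  The axioms are stated relative to a language \<open>L\<close>, since in an extension of the theory the equality
  and case distinction schemata range over the extended language. Replacement of equals in atomic
  formulas yields symmetry, transitivity and replacement in all formulas.
\<close>

inductive_set omega_axs :: "('c, 'p) lang \<Rightarrow> (('c, 'p) ifm list \<times> ('c, 'p) ifm) set"
  for L :: "('c, 'p) lang" where
  eq_refl: "twf L t \<Longrightarrow> ([], IEq t t) \<in> omega_axs L"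
| eq_repl: "iwf L (IAtom P ts) \<Longrightarrow> twf L s \<Longrightarrow> twf L t \<Longrightarrow>
    ([IEq s t, isubst (inst [s]) (IAtom P ts)], isubst (inst [t]) (IAtom P ts)) \<in> omega_axs L"
| true_ty: "([], IHas TyB (Cst CTrue)) \<in> omega_axs L"
| false_ty: "([], IHas TyB (Cst CFalse)) \<in> omega_axs L"
| true_false: "([IEq (Cst CTrue) (Cst CFalse)], IBot) \<in> omega_axs L"
| bool_cases: "iwf L A \<Longrightarrow> twf L t \<Longrightarrow>
    ([IHas TyB t, isubst (inst [Cst CTrue]) A, isubst (inst [Cst CFalse]) A], isubst (inst [t]) A) \<in> omega_axs L"
| cond_ty: "([], IHas (Fn TyB (Fn \<tau> (Fn \<tau> \<tau>))) (Cst CCond)) \<in> omega_axs L"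
| cond_true: "twf L s \<Longrightarrow> twf L t \<Longrightarrow> ([], IEq (App3 (Cst CCond) (Cst CTrue) s t) s) \<in> omega_axs L"
| cond_false: "twf L s \<Longrightarrow> twf L t \<Longrightarrow> ([], IEq (App3 (Cst CCond) (Cst CFalse) s t) t) \<in> omega_axs L"
| app_ty: "twf L f \<Longrightarrow> twf L t \<Longrightarrow> ([IHas (Fn \<sigma> \<tau>) f, IHas \<sigma> t], IHas \<tau> (App f t)) \<in> omega_axs L"
| K_ty: "([], IHas (Fn \<sigma> (Fn \<tau> \<sigma>)) (Cst CK)) \<in> omega_axs L"
| S_ty: "([], IHas (Fn (Fn \<sigma> (Fn \<tau> \<rho>)) (Fn (Fn \<sigma> \<tau>) (Fn \<sigma> \<rho>))) (Cst CS)) \<in> omega_axs L"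
| K_eq: "twf L s \<Longrightarrow> twf L t \<Longrightarrow> ([], IEq (App2 (Cst CK) s t) s) \<in> omega_axs L"
| S_eq: "twf L s \<Longrightarrow> twf L t \<Longrightarrow> twf L u \<Longrightarrow>
    ([], IEq (App3 (Cst CS) s t u) (App2 s u (App t u))) \<in> omega_axs L"

definition il_omega :: "('c, 'p) lang \<Rightarrow> ('c, 'p) ithy" where
  "il_omega L = \<lparr>ilang = L, iaxs = omega_axs L\<rparr>"

definition al_omega :: "('c, 'p) lang \<Rightarrow> ('c, 'p) athy" where
  "al_omega L = star_thy (il_omega L)"

section \<open>Parameters\<close>

text \<open>
  The parameters of the interpretation, for intuitionistic (\<open>'f = ifm\<close>) and affine (\<open>'f = afm\<close>)
  theories: the computational predicate symbols, \<open>\<tau>\<^sub>P\<close>, the formulas written \<open>P\<close> with a tilde (in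
  the variables \<open>0, \<dots>, arity P - 1\<close> for the arguments of \<open>P\<close> and \<open>arity P\<close> for the witness),
  \<open>W\<^sub>\<tau>\<close> (in the variable \<open>0\<close>), the bounding types, and \<open>bq \<tau>s as A\<close> for the bounded quantification
  \<open>\<forall>x \<sqsubset>\<^bsub>\<tau>s\<^esub> as. A\<close>, where \<open>x\<close> are the variables \<open>0, \<dots>, length \<tau>s - 1\<close> of \<open>A\<close> and \<open>bq\<close> binds them.
\<close>

record ('c, 'p, 'f) params =
  comp :: "'p psym set"
  wty :: "'p psym \<Rightarrow> ty"
  wat :: "'p psym \<Rightarrow> 'f"
  W :: "ty \<Rightarrow> 'f"
  hat :: "ty list \<Rightarrow> ty list"
  bq :: "ty list \<Rightarrow> 'c tm list \<Rightarrow> 'f \<Rightarrow> 'f"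

text \<open>
  The last two clauses say that bounded quantification is an operation on formulas of the target
  language that binds the quantified variables and is schematic in all the others.
\<close>

definition il_params :: "('c, 'p) lang \<Rightarrow> ('c, 'p) lang \<Rightarrow> ('c, 'p, ('c, 'p) ifm) params \<Rightarrow> bool" where
  "il_params Ls Lt p \<longleftrightarrow>
     comp p \<subseteq> psyms Ls \<and>
     (\<forall>P \<in> comp p. iwf Lt (wat p P) \<and> ifv (wat p P) \<subseteq> {..arity P}) \<and>
     (\<forall>\<tau>. iwf Lt (W p \<tau>) \<and> ifv (W p \<tau>) \<subseteq> {0}) \<and>
     (\<forall>\<tau>s. \<forall>as \<in> tms Lt (length (hat p \<tau>s)). \<forall>A. iwf Lt A \<longrightarrow> iwf Lt (bq p \<tau>s as A)) \<and>
     (\<forall>\<tau>s. \<forall>as \<in> tms Lt (length (hat p \<tau>s)). \<forall>A \<sigma>. iwf Lt A \<longrightarrow> (\<forall>i. twf Lt (\<sigma> i)) \<longrightarrow>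
        isubst \<sigma> (bq p \<tau>s as A) = bq p \<tau>s (map (tsubst \<sigma>) as) (isubst (up (length \<tau>s) \<sigma>) A))"

definition girard_params :: "('c, 'p, ('c, 'p) ifm) params \<Rightarrow> ('c, 'p, ('c, 'p) afm) params" where
  "girard_params p =
     \<lparr>comp = comp p, wty = wty p, wat = (\<lambda>P. girard (wat p P)), W = (\<lambda>\<tau>. girard (W p \<tau>)),
      hat = hat p, bq = (\<lambda>\<tau>s as A. girard (bq p \<tau>s as (forget A)))\<rparr>"

text \<open>\<open>W\<close> of a tuple, as a list (antecedents) and as one formula (succedents).\<close>

definition iWs :: "('c, 'p, ('c, 'p) ifm) params \<Rightarrow> ty list \<Rightarrow> 'c tm list \<Rightarrow> ('c, 'p) ifm list" where
  "iWs p \<tau>s ts = map2 (\<lambda>\<tau> t. isubst (inst [t]) (W p \<tau>)) \<tau>s ts"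

definition aWs :: "('c, 'p, ('c, 'p) afm) params \<Rightarrow> ty list \<Rightarrow> 'c tm list \<Rightarrow> ('c, 'p) afm list" where
  "aWs p \<tau>s ts = map2 (\<lambda>\<tau> t. asubst (inst [t]) (W p \<tau>)) \<tau>s ts"

fun iconj :: "('c, 'p) ifm list \<Rightarrow> ('c, 'p) ifm" where
  "iconj [] = Imp IBot IBot"
| "iconj [A] = A"
| "iconj (A # B # \<Gamma>) = And A (iconj (B # \<Gamma>))"

fun tensor :: "('c, 'p) afm list \<Rightarrow> ('c, 'p) afm" where
  "tensor [] = Lolli ABot ABot"
| "tensor [A] = A"
| "tensor (A # B # \<Gamma>) = Tensor A (tensor (B # \<Gamma>))"

definition iWc :: "('c, 'p, ('c, 'p) ifm) params \<Rightarrow> ty list \<Rightarrow> 'c tm list \<Rightarrow> ('c, 'p) ifm" where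
  "iWc p \<tau>s ts = iconj (iWs p \<tau>s ts)"

definition aWc :: "('c, 'p, ('c, 'p) afm) params \<Rightarrow> ty list \<Rightarrow> 'c tm list \<Rightarrow> ('c, 'p) afm" where
  "aWc p \<tau>s ts = tensor (aWs p \<tau>s ts)"

text \<open>Application \<open>(f\<^sub>1 s, f\<^sub>2 s, \<dots>)\<close> of a tuple of terms to a tuple of arguments.\<close>

definition tapp :: "'c tm list \<Rightarrow> 'c tm list \<Rightarrow> 'c tm list" where
  "tapp fs ss = map (\<lambda>f. foldl App f ss) fs"

abbreviation vars :: "nat \<Rightarrow> 'c tm list" where
  "vars n \<equiv> map Var [0..<n]"

section \<open>The interpretation of affine logic\<close>

fun tpos :: "('c, 'p, 'f) params \<Rightarrow> ('c, 'p) afm \<Rightarrow> ty list"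
  and tneg :: "('c, 'p, 'f) params \<Rightarrow> ('c, 'p) afm \<Rightarrow> ty list" where
  "tpos p ABot = []"
| "tpos p (AAtom P ts) = (if P \<in> comp p then [wty p P] else [])"
| "tpos p (Tensor A B) = tpos p A @ tpos p B"
| "tpos p (Lolli A B) = tarrs (tpos p A) (tpos p B) @ tarrs (tpos p A) (tarrs (tneg p B) (tneg p A))"
| "tpos p (AAll A) = tpos p A"
| "tpos p (AEx A) = tpos p A"
| "tpos p (Bang A) = tpos p A"
| "tneg p ABot = []"
| "tneg p (AAtom P ts) = []"
| "tneg p (Tensor A B) = tneg p A @ tneg p B"
| "tneg p (Lolli A B) = tpos p A @ tneg p B"
| "tneg p (AAll A) = tneg p A"
| "tneg p (AEx A) = tneg p A"
| "tneg p (Bang A) = hat p (tneg p A)"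

text \<open>A size that ignores terms, for the termination proof below.\<close>

primrec fsize :: "('c, 'p) afm \<Rightarrow> nat" where
  "fsize ABot = 0"
| "fsize (AAtom P ts) = 0"
| "fsize (Tensor A B) = Suc (fsize A + fsize B)"
| "fsize (Lolli A B) = Suc (fsize A + fsize B)"
| "fsize (AAll A) = Suc (fsize A)"
| "fsize (AEx A) = Suc (fsize A)"
| "fsize (Bang A) = Suc (fsize A)"

lemma fsize_asubst [simp]: "fsize (asubst \<sigma> A) = fsize A"
  by (induction A arbitrary: \<sigma>) auto

text \<open>
  \<open>interp p A xs ys\<close> is \<open>|A|\<close> with superscript \<open>xs\<close> and subscript \<open>ys\<close>, for terms \<open>xs\<close>, \<open>ys\<close>; these
  tuples have the lengths of \<open>tpos p A\<close> and \<open>tneg p A\<close> and are split accordingly.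
\<close>

function interp :: "('c, 'p, ('c, 'p) afm) params \<Rightarrow> ('c, 'p) afm \<Rightarrow> 'c tm list \<Rightarrow> 'c tm list \<Rightarrow> ('c, 'p) afm" where
  "interp p ABot xs ys = ABot"
| "interp p (AAtom P ts) xs ys =
     (if P \<in> comp p then asubst (inst (ts @ xs)) (wat p P) else AAtom P ts)"
| "interp p (Tensor A B) xs ys =
     (let m = length (tpos p A); n = length (tneg p A)
      in Tensor (interp p A (take m xs) (take n ys)) (interp p B (drop m xs) (drop n ys)))"
| "interp p (Lolli A B) fgs xws =
     (let m = length (tpos p B); n = length (tpos p A);
          fs = take m fgs; gs = drop m fgs; xs = take n xws; ws = drop n xws
      in Lolli (interp p A xs (tapp gs (xs @ ws))) (interp p B (tapp fs xs) ws))"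
| "interp p (AAll A) xs ys =
     AAll (interp p A (map (tsubst (shift 1)) xs) (map (tsubst (shift 1)) ys))"
| "interp p (AEx A) xs ys =
     AEx (interp p A (map (tsubst (shift 1)) xs) (map (tsubst (shift 1)) ys))"
| "interp p (Bang A) xs as =
     (let n = length (tneg p A)
      in Bang (bq p (tneg p A) as
           (interp p (asubst (shift n) A) (map (tsubst (shift n)) xs) (vars n))))"
  by pat_completeness auto
termination
  by (relation "measure (\<lambda>(p, A, xs, ys). fsize A)") auto

section \<open>The conditions on the parameters\<close>

definition extends :: "('c, 'p) athy \<Rightarrow> ('c, 'p) athy \<Rightarrow> bool" where
  "extends T U \<longleftrightarrow> sublang (alang U) (alang T) \<and> (\<forall>(\<Gamma>, A) \<in> aaxs U. aprov T \<Gamma> A)"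

definition A1 :: "('c, 'p) athy \<Rightarrow> bool" where
  "A1 T \<longleftrightarrow> sublang omega_lang (alang T) \<and> extends T (al_omega (alang T))"

definition A2 :: "('c, 'p) athy \<Rightarrow> ('c, 'p) athy \<Rightarrow> ('c, 'p, ('c, 'p) afm) params \<Rightarrow> bool" where
  "A2 S T p \<longleftrightarrow> comp p \<subseteq> psyms (alang S) \<and> sublang (alang S) (alang T)"

definition A3 :: "('c, 'p) athy \<Rightarrow> ('c, 'p, ('c, 'p) afm) params \<Rightarrow> bool" where
  "A3 T p \<longleftrightarrow> (\<forall>P \<in> comp p. aprov T [wat p P] (AAtom P (vars (arity P))))"

definition A4 :: "('c, 'p) athy \<Rightarrow> ('c, 'p, ('c, 'p) afm) params \<Rightarrow> bool" where
  "A4 T p \<longleftrightarrow>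
     (\<forall>P \<in> comp p. aprov T [wat p P] (aWc p [wty p P] [Var (arity P)])) \<and>
     (\<forall>\<sigma> \<tau>. aprov T [] (aWc p [Fn \<sigma> (Fn \<tau> \<sigma>)] [Cst CK])) \<and>
     (\<forall>\<sigma> \<tau> \<rho>. aprov T [] (aWc p [Fn (Fn \<sigma> (Fn \<tau> \<rho>)) (Fn (Fn \<sigma> \<tau>) (Fn \<sigma> \<rho>))] [Cst CS])) \<and>
     (\<forall>\<tau> \<rho>. aprov T (aWs p [\<tau>, Fn \<tau> \<rho>] [Var 0, Var 1]) (aWc p [\<rho>] [App (Var 1) (Var 0)]))"

definition is_bangW :: "('c, 'p) lang \<Rightarrow> ('c, 'p, ('c, 'p) afm) params \<Rightarrow> ('c, 'p) afm \<Rightarrow> bool" where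
  "is_bangW L p C \<longleftrightarrow> (\<exists>\<sigma>s. \<exists>ts \<in> tms L (length \<sigma>s). C = Bang (aWc p \<sigma>s ts))"

text \<open>
  Monotonicity, for sequents with several formulas and in the presence of hypotheses \<open>!W(z)\<close>:
  from \<open>!W(z), \<Delta> \<turnstile> B\<close> with \<open>x\<close> not among \<open>z\<close> one gets \<open>!W(z), \<forall>x\<sqsubset>a \<Delta> \<turnstile> \<forall>x\<sqsubset>a B\<close>; the list \<open>\<Delta>\<close> may
  contain \<open>!W(x)\<close>, so that \<open>Q2\<close> is applicable.
\<close>

definition Q1 :: "('c, 'p) athy \<Rightarrow> ('c, 'p, ('c, 'p) afm) params \<Rightarrow> ('c, 'p) afm set \<Rightarrow> bool" where
  "Q1 T p \<Phi> \<longleftrightarrow>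
     (\<forall>\<tau>s. \<forall>as \<in> tms (alang T) (length (hat p \<tau>s)). \<forall>\<Gamma> \<Delta> B.
        (\<forall>C \<in> set \<Gamma>. is_bangW (alang T) p C) \<longrightarrow>
        (\<forall>A \<in> set \<Delta>. A \<in> \<Phi> \<or> is_bangW (alang T) p A) \<longrightarrow> B \<in> \<Phi> \<longrightarrow>
        aprov T (map (asubst (shift (length \<tau>s))) \<Gamma> @ \<Delta>) B \<longrightarrow>
        aprov T (\<Gamma> @ map (bq p \<tau>s as) \<Delta>) (bq p \<tau>s as B))"

definition Q2 :: "('c, 'p) athy \<Rightarrow> ('c, 'p, ('c, 'p) afm) params \<Rightarrow> bool" where
  "Q2 T p \<longleftrightarrow>
     (\<forall>\<tau>s. \<forall>as \<in> tms (alang T) (length (hat p \<tau>s)).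
        aprov T [] (bq p \<tau>s as (Bang (aWc p \<tau>s (vars (length \<tau>s))))))"

text \<open>Closed terms of given types that are provably in \<open>W\<close>.\<close>

definition Wterms :: "('c, 'p) athy \<Rightarrow> ('c, 'p, ('c, 'p) afm) params \<Rightarrow> ty list \<Rightarrow> 'c tm list set" where
  "Wterms T p \<tau>s = {ts \<in> ctms (alang T) (length \<tau>s). aprov T [] (aWc p \<tau>s ts)}"

text \<open>
  In the next three definitions the bound variables \<open>x\<close> of type \<open>\<tau>s\<close> are the innermost variables of
  \<open>A\<close>. In \<open>C_circ\<close>, the tuple \<open>y\<close> of type \<open>\<rho>s\<close> is bound outside \<open>x\<close> and does not occur in \<open>A\<close>.
\<close>

definition C_eta :: "('c, 'p) athy \<Rightarrow> ('c, 'p, ('c, 'p) afm) params \<Rightarrow> ty list \<Rightarrow> ('c, 'p) afm \<Rightarrow> 'c tm list \<Rightarrow> bool" where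
  "C_eta T p \<tau>s A \<eta> \<longleftrightarrow>
     (\<forall>zs \<in> tms (alang T) (length \<tau>s).
        aprov T (map Bang (aWs p \<tau>s zs) @ [Bang (bq p \<tau>s (tapp \<eta> zs) A)]) (asubst (inst zs) A))"

definition C_sqcup :: "('c, 'p) athy \<Rightarrow> ('c, 'p, ('c, 'p) afm) params \<Rightarrow> ty list \<Rightarrow> ('c, 'p) afm \<Rightarrow> 'c tm list \<Rightarrow> bool" where
  "C_sqcup T p \<tau>s A u \<longleftrightarrow>
     (\<forall>x1 \<in> tms (alang T) (length (hat p \<tau>s)). \<forall>x2 \<in> tms (alang T) (length (hat p \<tau>s)).
        aprov T (map Bang (aWs p (hat p \<tau>s) x1 @ aWs p (hat p \<tau>s) x2) @ [Bang (bq p \<tau>s (tapp u (x1 @ x2)) A)])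
          (Tensor (bq p \<tau>s x1 A) (bq p \<tau>s x2 A)))"

definition C_circ :: "('c, 'p) athy \<Rightarrow> ('c, 'p, ('c, 'p) afm) params \<Rightarrow> ty list \<Rightarrow> ty list \<Rightarrow> ('c, 'p) afm \<Rightarrow> 'c tm list \<Rightarrow> bool" where
  "C_circ T p \<rho>s \<tau>s A c \<longleftrightarrow>
     (\<forall>fs \<in> tms (alang T) (length (hat p \<tau>s)). \<forall>zs \<in> tms (alang T) (length (hat p \<rho>s)).
        aprov T (map Bang (aWs p (tarrs \<rho>s (hat p \<tau>s)) fs) @ map Bang (aWs p (hat p \<rho>s) zs) @
                 [Bang (bq p \<tau>s (tapp c (fs @ zs)) A)])
          (bq p \<rho>s zs (Bang (bq p \<tau>s
             (tapp (map (tsubst (shift (length \<rho>s))) fs) (vars (length \<rho>s)))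
             (asubst (up (length \<tau>s) (shift (length \<rho>s))) A)))))"

definition A5 :: "('c, 'p) athy \<Rightarrow> ('c, 'p, ('c, 'p) afm) params \<Rightarrow> ('c, 'p) afm set \<Rightarrow> bool" where
  "A5 T p \<Phi> \<longleftrightarrow> Q1 T p \<Phi> \<and> Q2 T p \<and>
     (\<forall>A \<in> \<Phi>. \<forall>\<tau>s.
        (\<exists>\<eta> \<in> Wterms T p (tarrs \<tau>s (hat p \<tau>s)). C_eta T p \<tau>s A \<eta>) \<and>
        (\<exists>u \<in> Wterms T p (tarrs (hat p \<tau>s) (tarrs (hat p \<tau>s) (hat p \<tau>s))). C_sqcup T p \<tau>s A u) \<and>
        (\<forall>\<rho>s. \<exists>c \<in> Wterms T p (tarrs (tarrs \<rho>s (hat p \<tau>s)) (tarrs (hat p \<rho>s) (hat p \<tau>s))).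
           C_circ T p \<rho>s \<tau>s A c))"

text \<open>The formulas \<open>|A|\<close>, with \<open>A\<close> a formula of the source theory, and with arbitrary terms as
  superscript and subscript.\<close>

definition interp_fms :: "('c, 'p) athy \<Rightarrow> ('c, 'p) athy \<Rightarrow> ('c, 'p, ('c, 'p) afm) params \<Rightarrow> ('c, 'p) afm set" where
  "interp_fms S T p = {interp p A xs ys | A xs ys. awf (alang S) A \<and>
     xs \<in> tms (alang T) (length (tpos p A)) \<and> ys \<in> tms (alang T) (length (tneg p A))}"

text \<open>
  Every basic, hence every finite type has a closed term that is provably in \<open>W\<close>. Without this,
  weakening and ex falso have no witnesses: take \<open>W\<close> to be falsity at both basic types and
  hereditary at function types.
\<close>

definition W_inhabited :: "('c, 'p) ithy \<Rightarrow> ('c, 'p, ('c, 'p) ifm) params \<Rightarrow> bool" where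
  "W_inhabited T p \<longleftrightarrow> (\<forall>\<tau> \<in> {TyB, TyN}. \<exists>t. [t] \<in> ctms (ilang T) 1 \<and> iprov T [] (iWc p [\<tau>] [t]))"

section \<open>The interpretation of intuitionistic logic\<close>

definition interp_circ :: "('c, 'p, ('c, 'p) ifm) params \<Rightarrow> ('c, 'p) ifm \<Rightarrow> 'c tm list \<Rightarrow> 'c tm list \<Rightarrow> ('c, 'p) ifm" where
  "interp_circ p A xs ys = forget (interp (girard_params p) (girard A) xs ys)"

definition ipos :: "('c, 'p, ('c, 'p) ifm) params \<Rightarrow> ('c, 'p) ifm \<Rightarrow> ty list" where
  "ipos p A = tpos (girard_params p) (girard A)"

definition ineg :: "('c, 'p, ('c, 'p) ifm) params \<Rightarrow> ('c, 'p) ifm \<Rightarrow> ty list" where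
  "ineg p A = tneg (girard_params p) (girard A)"

primrec interp_ctx :: "('c, 'p, ('c, 'p) ifm) params \<Rightarrow> ('c, 'p) ifm list \<Rightarrow> 'c tm list \<Rightarrow> 'c tm list \<Rightarrow> ('c, 'p) ifm list" where
  "interp_ctx p [] xs ys = []"
| "interp_ctx p (A # \<Gamma>) xs ys =
     (let m = length (ipos p A); n = length (ineg p A)
      in interp_circ p A (take m xs) (take n ys) # interp_ctx p \<Gamma> (drop m xs) (drop n ys))"

definition ctx_pos :: "('c, 'p, ('c, 'p) ifm) params \<Rightarrow> ('c, 'p) ifm list \<Rightarrow> ty list" where
  "ctx_pos p \<Gamma> = concat (map (ipos p) \<Gamma>)"

definition ctx_neg :: "('c, 'p, ('c, 'p) ifm) params \<Rightarrow> ('c, 'p) ifm list \<Rightarrow> ty list" where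
  "ctx_neg p \<Gamma> = concat (map (ineg p) \<Gamma>)"

text \<open>
  The fresh variables \<open>x\<close>, \<open>w\<close> of the witnessing sequent are \<open>xs\<close>, \<open>ws\<close>; the free variables of the
  given sequent are shifted past them.
\<close>

definition witnessable :: "('c, 'p, ('c, 'p) ifm) params \<Rightarrow> ('c, 'p) ithy \<Rightarrow> ('c, 'p) ifm list \<Rightarrow> ('c, 'p) ifm \<Rightarrow> bool" where
  "witnessable p T \<Gamma> A \<longleftrightarrow>
     (\<exists>\<gamma> \<in> ctms (ilang T) (length (ctx_neg p \<Gamma>)). \<exists>a \<in> ctms (ilang T) (length (ipos p A)).
        iprov T [] (iWc p (tarrs (ctx_pos p \<Gamma>) (tarrs (ineg p A) (ctx_neg p \<Gamma>))) \<gamma>) \<and>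
        iprov T [] (iWc p (tarrs (ctx_pos p \<Gamma>) (ipos p A)) a) \<and>
        (let m = length (ctx_pos p \<Gamma>); n = length (ineg p A);
             xs = map Var [0..<m]; ws = map Var [m..<m + n]; up\<Gamma> = map (isubst (shift (m + n))) \<Gamma>;
             upA = isubst (shift (m + n)) A
         in iprov T (iWs p (ctx_pos p \<Gamma>) xs @ iWs p (ineg p A) ws @ interp_ctx p up\<Gamma> xs (tapp \<gamma> (xs @ ws)))
              (interp_circ p upA (tapp a xs) ws)))"

end

theory Submission
  imports Defs
begin

text \<open>
  The Girard translation makes every formula \<open>A\<^sup>\<circ>\<close> equivalent to \<open>!A\<^sup>\<circ>\<close>, so counterwitnesses of
  \<open>|A\<^sup>\<circ>|\<close> can be merged (by \<open>\<squnion>\<close> below exponentials and componentwise elsewhere) and a bounded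
  quantifier can be pulled in front of \<open>|A\<^sup>\<circ>|\<close> (by \<open>\<circ>\<close> and monotonicity). Therefore witnessable
  sequents, with the exponentials forgotten, are closed under contraction and under the right rules
  of implication and universal quantification; the left rules are instances of \<open>\<eta>\<close>. All conditions
  on the parameters are used in the target theory only after forgetting exponentials, except
  monotonicity, for which a derivation in the target theory is first translated by Girard's
  translation.
\<close>

text \<open>Three obstacles shape the proof. Abstraction by \<open>CK\<close> and \<open>CS\<close>
  satisfies beta only up to provable equality, and an equation reaches a formula below a bounded
  quantifier only through monotonicity. Witnesses are therefore kept as functions on term tuples in
  the metalogic, and are turned into terms only where a tuple has to be abstracted. Secondly, (A5)
  chooses its terms separately for each formula, whereas a quantifier rule needs one tuple for all
  values of the eigenvariable; each condition is used on a formula whose superscript consists of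
  variables and is then specialised by substitution. Thirdly, (Q1) speaks about the formulas
  \<open>|A|\<close>, not about all formulas of the target, so every hypothesis and conclusion under
  a bounded quantifier must be tracked as such a formula. The structural rules cost little once
  entailment is defined between lists, the right one read as a conjunction: cut is composition,
  contraction is a pairing whose two counterwitnesses are merged, and weakening is projection with
  arbitrary inhabitants as counterwitnesses.\<close>

subsection \<open>Substitution\<close>

text \<open>A named composition, so that \<open>tsubst_tsubst\<close> and its analogues for formulas
  collapse nested substitutions into one; equations between substitution instances then reduce to
  equations between composites.\<close>

definition scomp :: "(nat \<Rightarrow> 'c tm) \<Rightarrow> (nat \<Rightarrow> 'c tm) \<Rightarrow> nat \<Rightarrow> 'c tm" where
  "scomp \<sigma> \<tau> i = tsubst \<sigma> (\<tau> i)"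

lemma tsubst_tsubst [simp]: "tsubst \<sigma> (tsubst \<tau> t) = tsubst (scomp \<sigma> \<tau>) t"
  by (induction t) (auto simp: scomp_def)

lemma tsubst_o [simp]: "tsubst \<sigma> \<circ> tsubst \<tau> = tsubst (scomp \<sigma> \<tau>)" "tsubst \<sigma> \<circ> \<rho> = scomp \<sigma> \<rho>"
  by (auto simp: scomp_def)

lemma tsubst_Var [simp]: "tsubst Var t = t"
  by (induction t) auto

lemma scomp_Var [simp]: "scomp Var \<sigma> = \<sigma>" "scomp \<sigma> Var = \<sigma>"
  by (auto simp: scomp_def)

lemma scomp_assoc: "scomp \<sigma> (scomp \<tau> \<rho>) = scomp (scomp \<sigma> \<tau>) \<rho>"
  by (rule ext) (simp add: scomp_def)

lemma up_Var [simp]: "up n Var = Var"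
  by (auto simp: up_def shift_def)

lemma up_0 [simp]: fixes \<sigma> :: "nat \<Rightarrow> 'a tm" shows "up 0 \<sigma> = \<sigma>"
proof -
  have "(shift 0 :: nat \<Rightarrow> 'a tm) = Var" by (auto simp: shift_def)
  then show ?thesis by (auto simp: up_def)
qed

lemma scomp_up_shift [simp]: "scomp (up n \<sigma>) (shift n) = scomp (shift n) \<sigma>"
  by (auto simp: scomp_def up_def shift_def)

lemma scomp_up_up: "scomp (up n \<sigma>) (up n \<tau>) = up n (scomp \<sigma> \<tau>)"
proof (rule ext)
  fix i
  show "scomp (up n \<sigma>) (up n \<tau>) i = up n (scomp \<sigma> \<tau>) i"
    using scomp_up_shift[of n \<sigma>] by (auto simp: scomp_def[of _ \<tau>] scomp_def[of _ "up n \<tau>"] up_def[of n \<tau>] up_def[of n "scomp \<sigma> \<tau>"])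
      (simp add: up_def)
qed

lemma scomp_shift_shift: "scomp (shift m) (shift n) = shift (n + m)"
  by (auto simp: scomp_def shift_def)

lemma scomp_inst_shift [simp]: "length ts = n \<Longrightarrow> scomp (inst ts) (shift n) = Var"
  by (auto simp: scomp_def shift_def inst_def)

lemma scomp_inst_Var0 [simp]: "scomp (inst [Var 0]) (up (Suc 0) (shift (Suc 0))) = Var"
  by (auto simp: scomp_def up_def inst_def shift_def)

lemma tsubst_cong: "(\<And>i. i \<in> tfv t \<Longrightarrow> \<sigma> i = \<tau> i) \<Longrightarrow> tsubst \<sigma> t = tsubst \<tau> t"
  by (induction t) auto

lemma tsubst_closed: "tfv t = {} \<Longrightarrow> tsubst \<sigma> t = t"
  using tsubst_cong[of t \<sigma> Var] by simp

lemma isubst_cong: "(\<And>i. i \<in> ifv A \<Longrightarrow> \<sigma> i = \<tau> i) \<Longrightarrow> isubst \<sigma> A = isubst \<tau> A"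
proof (induction A arbitrary: \<sigma> \<tau>)
  case (IAtom P ts) then show ?case by (auto intro!: tsubst_cong)
next
  case (IAll A)
  have "isubst (up 1 \<sigma>) A = isubst (up 1 \<tau>) A"
  proof (rule IAll.IH)
    fix i assume "i \<in> ifv A"
    then show "up 1 \<sigma> i = up 1 \<tau> i" using IAll.prems[of "i - 1"] by (cases i) (auto simp: up_def)
  qed
  then show ?case by simp
next
  case (IEx A)
  have "isubst (up 1 \<sigma>) A = isubst (up 1 \<tau>) A"
  proof (rule IEx.IH)
    fix i assume "i \<in> ifv A"
    then show "up 1 \<sigma> i = up 1 \<tau> i" using IEx.prems[of "i - 1"] by (cases i) (auto simp: up_def)
  qed
  then show ?case by simp
next
  case (And A B)
  have "isubst \<sigma> A = isubst \<tau> A" "isubst \<sigma> B = isubst \<tau> B" by (rule And.IH; simp add: And.prems)+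
  then show ?case by simp
next
  case (Imp A B)
  have "isubst \<sigma> A = isubst \<tau> A" "isubst \<sigma> B = isubst \<tau> B" by (rule Imp.IH; simp add: Imp.prems)+
  then show ?case by simp
qed auto

lemma isubst_isubst [simp]: "isubst \<sigma> (isubst \<tau> A) = isubst (scomp \<sigma> \<tau>) A"
  by (induction A arbitrary: \<sigma> \<tau>) (auto simp: scomp_up_up)

lemma isubst_o [simp]: "isubst \<sigma> \<circ> isubst \<tau> = isubst (scomp \<sigma> \<tau>)"
  by auto

lemma asubst_asubst [simp]: "asubst \<sigma> (asubst \<tau> A) = asubst (scomp \<sigma> \<tau>) A"
  by (induction A arbitrary: \<sigma> \<tau>) (auto simp: scomp_up_up)

lemma isubst_Var [simp]: "isubst Var A = A"
  by (induction A) (auto intro: map_idI)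

lemma asubst_Var [simp]: "asubst Var A = A"
  by (induction A) (auto intro: map_idI)

lemma finite_tfv [simp]: "finite (tfv t)"
  by (induction t) auto

lemma finite_ifv [simp]: "finite (ifv A)"
proof (induction A)
  case (IAll A)
  then have "finite (Suc -` ifv A)" by (rule finite_vimageI) simp
  then show ?case by (simp add: vimage_def)
next
  case (IEx A)
  then have "finite (Suc -` ifv A)" by (rule finite_vimageI) simp
  then show ?case by (simp add: vimage_def)
qed auto

lemma twf_tsubst_iff: "(\<And>i. twf L (\<sigma> i)) \<Longrightarrow> twf L (tsubst \<sigma> t) \<longleftrightarrow> twf L t"
  by (induction t) auto

lemma twf_shift [simp]: "twf L (shift n i)"
  by (simp add: shift_def)

lemma inst_nth [simp]: "i < length ts \<Longrightarrow> inst ts i = ts ! i"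
  by (simp add: inst_def)

lemma twf_inst [simp]: "\<forall>t \<in> set ts. twf L t \<Longrightarrow> twf L (inst ts i)"
  by (simp add: inst_def)

lemma twf_up: "(\<And>i. twf L (\<sigma> i)) \<Longrightarrow> twf L (up n \<sigma> i)"
  by (simp add: up_def twf_tsubst_iff)

lemma twf_scomp: "(\<And>i. twf L (\<sigma> i)) \<Longrightarrow> (\<And>i. twf L (\<tau> i)) \<Longrightarrow> twf L (scomp \<sigma> \<tau> i)"
  by (simp add: scomp_def twf_tsubst_iff)

lemma iwf_isubst_iff: "(\<And>i. twf L (\<sigma> i)) \<Longrightarrow> iwf L (isubst \<sigma> A) \<longleftrightarrow> iwf L A"
  by (induction A arbitrary: \<sigma>) (auto simp: twf_tsubst_iff twf_up)

lemma awf_asubst_iff: "(\<And>i. twf L (\<sigma> i)) \<Longrightarrow> awf L (asubst \<sigma> A) \<longleftrightarrow> awf L A"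
  by (induction A arbitrary: \<sigma>) (auto simp: twf_tsubst_iff twf_up)

lemma twf_of_subst: "twf L (tsubst \<sigma> t) \<Longrightarrow> twf L t"
  by (induction t) auto

text \<open>There is no condition on \<sigma>: whatever in an instance stems from the formula itself
  is well formed anyway. This recovers the matrix of a quantifier from the premise of
  \<open>iallL\<close> or \<open>iexR\<close>.\<close>

lemma iwf_of_subst: "iwf L (isubst \<sigma> A) \<Longrightarrow> iwf L A"
  by (induction A arbitrary: \<sigma>) (auto intro: twf_of_subst)

lemma sublang_twf: "sublang L M \<Longrightarrow> twf L t \<Longrightarrow> twf M t"
  by (induction t) (auto simp: sublang_def)

lemma sublang_psyms: "sublang L M \<Longrightarrow> P \<in> psyms L \<Longrightarrow> P \<in> psyms M"
  by (auto simp: sublang_def)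

lemma sublang_iwf: "sublang L M \<Longrightarrow> iwf L A \<Longrightarrow> iwf M A"
  by (induction A) (auto simp: sublang_twf dest: sublang_psyms)

lemma sublang_awf: "sublang L M \<Longrightarrow> awf L A \<Longrightarrow> awf M A"
  by (induction A) (auto simp: sublang_twf dest: sublang_psyms)

subsection \<open>Natural deduction\<close>

lemma iprov_wf:
  assumes "il_theory T" and "iprov T \<Gamma> A"
  shows "(\<forall>B \<in> set \<Gamma>. iwf (ilang T) B) \<and> iwf (ilang T) A"
  using assms(2)
proof (induction rule: iprov.induct)
  case (iax \<Gamma> A) then show ?case using assms(1) by (auto simp: il_theory_def)
next
  case (iperm \<Gamma> A \<Delta>)
  then have "set \<Gamma> = set \<Delta>" by (metis set_mset_mset)
  then show ?case using iperm by auto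
qed (auto dest: iwf_of_subst simp: iwf_isubst_iff)

locale itheory =
  fixes T :: "('c, 'p) ithy"
  assumes il: "il_theory T"
begin

abbreviation wff :: "('c, 'p) ifm \<Rightarrow> bool" where "wff \<equiv> iwf (ilang T)"
abbreviation wft :: "'c tm \<Rightarrow> bool" where "wft \<equiv> twf (ilang T)"

text \<open>Sets absorb exchange, contraction and weakening. \<open>H\<close> may be infinite or
  contain formulas outside the language, since only a finite list from it has to occur in a
  derivation; hence \<open>der_mono\<close> carries no side condition.\<close>

definition der :: "('c, 'p) ifm set \<Rightarrow> ('c, 'p) ifm \<Rightarrow> bool" where
  "der H F \<longleftrightarrow> (\<exists>\<Gamma>. set \<Gamma> \<subseteq> H \<and> iprov T \<Gamma> F)"

lemma iprov_weaken: "iprov T \<Gamma> A \<Longrightarrow> (\<forall>B \<in> set \<Delta>. wff B) \<Longrightarrow> iprov T (\<Delta> @ \<Gamma>) A"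
  by (induction \<Delta>) (auto intro: iwk)

lemma iprov_absorb: "iprov T (\<Gamma> @ \<Delta>) A \<Longrightarrow> set \<Gamma> \<subseteq> set \<Delta> \<Longrightarrow> iprov T \<Delta> A"
proof (induction \<Gamma>)
  case (Cons B \<Gamma>)
  then obtain \<Delta>1 \<Delta>2 where d: "\<Delta> = \<Delta>1 @ B # \<Delta>2" by (auto simp: in_set_conv_decomp)
  have "iprov T (B # B # \<Gamma> @ \<Delta>1 @ \<Delta>2) A"
    using Cons.prems(1) by (rule iperm) (simp add: d)
  then have "iprov T (B # \<Gamma> @ \<Delta>1 @ \<Delta>2) A" by (rule icon)
  then have "iprov T (\<Gamma> @ \<Delta>) A" by (rule iperm) (simp add: d)
  then show ?case using Cons by simp
qed simp

lemma iprov_mono: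
  assumes "iprov T \<Gamma> A" and "set \<Gamma> \<subseteq> set \<Delta>" and "\<forall>B \<in> set \<Delta>. wff B"
  shows "iprov T \<Delta> A"
proof -
  have "iprov T (\<Gamma> @ \<Delta>) A"
    using iprov_weaken[OF assms(1,3)] by (rule iperm) simp
  then show ?thesis using assms(2) by (rule iprov_absorb)
qed

lemma der_iprov: "der (set \<Gamma>) F \<Longrightarrow> \<forall>B \<in> set \<Gamma>. wff B \<Longrightarrow> iprov T \<Gamma> F"
  unfolding der_def using iprov_mono by blast

lemma iprov_der: "iprov T \<Gamma> F \<Longrightarrow> der (set \<Gamma>) F"
  unfolding der_def by blast

lemma der_wff: "der H F \<Longrightarrow> wff F"
  unfolding der_def using iprov_wf[OF il] by blast

lemma der_mono: "der H F \<Longrightarrow> H \<subseteq> K \<Longrightarrow> der K F"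
  unfolding der_def by blast

lemma der_prem: "F \<in> H \<Longrightarrow> wff F \<Longrightarrow> der H F"
  unfolding der_def by (rule exI[of _ "[F]"]) (auto intro: iid)

text \<open>A simultaneous cut against all hypotheses. Only the well-formed ones must be derived,
  because others cannot occur in the list that proves \<open>F\<close>.\<close>

lemma der_cut:
  assumes "der K F" and "\<And>G. G \<in> K \<Longrightarrow> wff G \<Longrightarrow> der H G"
  shows "der H F"
proof -
  obtain \<Gamma> where g: "set \<Gamma> \<subseteq> K" "iprov T \<Gamma> F" using assms(1) by (auto simp: der_def)
  \<comment> \<open>The list \<Delta> collects what replaces the hypotheses that have been cut
    already.\<close>
  have "\<exists>\<Delta>'. set \<Delta>' \<subseteq> H \<and> iprov T \<Delta>' F"
    if "iprov T (\<Gamma> @ \<Delta>) F" "set \<Gamma> \<subseteq> K" "set \<Delta> \<subseteq> H" for \<Gamma> \<Delta>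
    using that
  proof (induction \<Gamma> arbitrary: \<Delta>)
    case (Cons A \<Gamma>)
    have "wff A" using iprov_wf[OF il Cons.prems(1)] by simp
    then obtain \<Theta> where th: "set \<Theta> \<subseteq> H" "iprov T \<Theta> A"
      using assms(2)[of A] Cons.prems(2) by (auto simp: der_def)
    have "iprov T (A # \<Gamma> @ \<Delta>) F" using Cons.prems(1) by simp
    then have "iprov T (\<Theta> @ \<Gamma> @ \<Delta>) F" using th(2) icut by blast
    then have "iprov T (\<Gamma> @ \<Theta> @ \<Delta>) F" by (rule iperm) simp
    then show ?case using Cons.IH[of "\<Theta> @ \<Delta>"] Cons.prems th by auto
  qed auto
  from this[of \<Gamma> "[]"] show ?thesis using g by (auto simp: der_def)
qed

lemma der_cut1: "iprov T [G] F \<Longrightarrow> der H G \<Longrightarrow> der H F"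
  by (rule der_cut[of "{G}"]) (auto simp: der_def[of "{G}"] intro: exI[of _ "[G]"])

text \<open>All copies of \<open>A\<close> are merged into one at the head of the list, where the
  rules that discharge a hypothesis expect it.\<close>

lemma der_insertE:
  assumes "der (insert A H) B" and "wff A"
  obtains \<Gamma> where "set \<Gamma> \<subseteq> H" "iprov T (A # \<Gamma>) B"
proof -
  obtain \<Gamma> where g: "set \<Gamma> \<subseteq> insert A H" "iprov T \<Gamma> B" using assms(1) by (auto simp: der_def)
  have w: "\<forall>C \<in> set \<Gamma>. wff C" using iprov_wf[OF il g(2)] by simp
  have "iprov T (A # filter (\<lambda>C. C \<noteq> A) \<Gamma>) B"
    using g(2) by (rule iprov_mono) (use assms w in auto)
  moreover have "set (filter (\<lambda>C. C \<noteq> A) \<Gamma>) \<subseteq> H" using g(1) by auto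
  ultimately show thesis using that by blast
qed

lemma der_impI: "der (insert A H) B \<Longrightarrow> wff A \<Longrightarrow> der H (Imp A B)"
  by (erule (1) der_insertE) (auto simp: der_def intro: iimpR)

lemma der_impE:
  assumes "der H (Imp A B)" and "der H A"
  shows "der H B"
proof (rule der_cut)
  have "wff A" "wff B" using der_wff[OF assms(1)] by auto
  then have "iprov T (Imp A B # [A] @ []) B" by (intro iimpL iid)
  then show "der {Imp A B, A} B" using iprov_der by fastforce
qed (use assms in auto)

lemma der_andI:
  assumes "der H A" and "der H B"
  shows "der H (And A B)"
proof -
  obtain \<Gamma> \<Delta> where "set \<Gamma> \<subseteq> H" "iprov T \<Gamma> A" "set \<Delta> \<subseteq> H" "iprov T \<Delta> B"
    using assms by (auto simp: der_def)
  then show ?thesis by (auto simp: der_def intro!: exI[of _ "\<Gamma> @ \<Delta>"] iandR)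
qed

lemma der_andE:
  assumes "der H (And A B)"
  shows "der H A" and "der H B"
proof -
  have w: "wff A" "wff B" using der_wff[OF assms(1)] by auto
  have "iprov T [And A B] A"
    by (rule iandL, rule iperm[of _ "[B,A]"]) (auto intro: iwk iid w)
  then show "der H A" using assms by (rule der_cut1)
  have "iprov T [And A B] B"
    by (rule iandL) (auto intro: iwk iid w)
  then show "der H B" using assms by (rule der_cut1)
qed

lemma der_botE: "der H IBot \<Longrightarrow> wff A \<Longrightarrow> der H A"
  by (rule der_cut1[OF ibotL])

lemma der_allI:
  assumes "der (isubst (shift 1) ` H) A"
  shows "der H (IAll A)"
proof -
  obtain \<Gamma> where g: "set \<Gamma> \<subseteq> isubst (shift 1) ` H" "iprov T \<Gamma> A" using assms by (auto simp: der_def)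
  then have "\<Gamma> \<in> lists (isubst (shift 1) ` H)" by auto
  then obtain \<Delta> where "\<Delta> \<in> lists H" "\<Gamma> = map (isubst (shift 1)) \<Delta>" by (auto simp: lists_image)
  then show ?thesis using g(2) by (auto simp: der_def intro!: exI[of _ \<Delta>] iallR)
qed

lemma der_allE:
  assumes "der H (IAll A)" and "wft t"
  shows "der H (isubst (inst [t]) A)"
proof -
  have "wff (isubst (inst [t]) A)"
    using der_wff[OF assms(1)] assms(2) by (subst iwf_isubst_iff) (auto simp: inst_def)
  then have "iprov T [IAll A] (isubst (inst [t]) A)" by (intro iallL[of _ t] iid assms(2))
  then show ?thesis using assms(1) by (rule der_cut1)
qed

lemma der_exI: "der H (isubst (inst [t]) A) \<Longrightarrow> wft t \<Longrightarrow> der H (IEx A)"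
  unfolding der_def using iexR by blast

lemma der_exE:
  assumes "der (insert A (isubst (shift 1) ` H)) (isubst (shift 1) B)" and "wff A"
  shows "der (insert (IEx A) H) B"
proof -
  obtain \<Gamma> where g: "set \<Gamma> \<subseteq> isubst (shift 1) ` H" "iprov T (A # \<Gamma>) (isubst (shift 1) B)"
    using assms by (rule der_insertE)
  then have "\<Gamma> \<in> lists (isubst (shift 1) ` H)" by auto
  then obtain \<Delta> where "\<Delta> \<in> lists H" "\<Gamma> = map (isubst (shift 1)) \<Delta>" by (auto simp: lists_image)
  then show ?thesis using g(2) by (auto simp: der_def intro!: exI[of _ "IEx A # \<Delta>"] iexL)
qed

text \<open>Substitution is not a rule of \<open>iprov\<close>, and the axioms need not be closed
  under it. It is simulated by universal generalisation followed by instantiation of the new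
  quantifiers.\<close>

lemma der_all_iter:
  assumes "iprov T [] A" and "\<forall>t \<in> set ts. wft t"
  shows "iprov T [] (isubst (inst ts) A)"
proof -
  have gen: "iprov T [] ((IAll ^^ n) A)" for n
    by (induction n) (auto intro: iallR assms(1))
  have subst_iter: "isubst \<sigma> ((IAll ^^ n) B) = (IAll ^^ n) (isubst (up n \<sigma>) B)" for n \<sigma> and B :: "('c,'p) ifm"
  proof (induction n arbitrary: \<sigma>)
    case (Suc n)
    have "up n (up 1 \<sigma>) = up (Suc n) \<sigma>"
      by (rule ext) (auto simp: up_def scomp_shift_shift, simp_all add: shift_def)
    then show ?case by (simp add: Suc)
  qed simp
  \<comment> \<open>Induction from the end of \<open>ts\<close>: the outermost quantifier binds the
    variable of highest index, so it receives the last term, lifted over the quantifiers that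
    remain.\<close>
  have "iprov T [] (isubst (inst ts) B)" if "iprov T [] ((IAll ^^ length ts) B)" "\<forall>t \<in> set ts. wft t" for ts B
    using that
  proof (induction ts arbitrary: B rule: rev_induct)
    case Nil
    have "(inst [] :: nat \<Rightarrow> 'c tm) = Var" by (auto simp: inst_def)
    then show ?case using Nil by simp
  next
    case (snoc t ts)
    have "der {} (IAll ((IAll ^^ length ts) B))" using iprov_der[OF snoc.prems(1)] by simp
    then have "der {} ((IAll ^^ length ts) (isubst (up (length ts) (inst [t])) B))"
      using der_allE[of "{}" _ t] snoc.prems(2) subst_iter by fastforce
    then have "iprov T [] ((IAll ^^ length ts) (isubst (up (length ts) (inst [t])) B))"
      using der_iprov[of "[]"] by simp
    then have "iprov T [] (isubst (inst ts) (isubst (up (length ts) (inst [t])) B))"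
      using snoc.IH snoc.prems(2) by (auto simp del: isubst_isubst)
    moreover have "scomp (inst ts) (up (length ts) (inst [t])) = inst (ts @ [t])"
      by (rule ext) (auto simp: scomp_def up_def scomp_inst_shift inst_def nth_append, auto simp: shift_def inst_def)
    ultimately show ?case by simp
  qed
  then show ?thesis using gen assms(2) by blast
qed

lemma iprov_subst0:
  assumes "iprov T [] A" and "\<And>i. wft (\<sigma> i)"
  shows "iprov T [] (isubst \<sigma> A)"
proof -
  obtain N where N: "\<forall>i \<in> ifv A. i < N" using finite_nat_set_iff_bounded[of "ifv A"] by auto
  \<comment> \<open>Only variables below \<open>N\<close> occur in \<open>A\<close>, so the lowering
    of larger indices by \<open>inst\<close> is invisible.\<close>
  have "isubst \<sigma> A = isubst (inst (map \<sigma> [0..<N])) A"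
    by (rule isubst_cong) (use N in \<open>auto simp: inst_def\<close>)
  then show ?thesis using der_all_iter[OF assms(1), of "map \<sigma> [0..<N]"] assms(2) by auto
qed

text \<open>The context is moved into the formula by implications, which reduces the claim to the
  empty context.\<close>

lemma iprov_subst:
  assumes "iprov T \<Gamma> A" and "\<And>i. wft (\<sigma> i)"
  shows "iprov T (map (isubst \<sigma>) \<Gamma>) (isubst \<sigma> A)"
  using assms(1)
proof (induction \<Gamma> arbitrary: A)
  case Nil then show ?case using iprov_subst0 assms(2) by simp
next
  case (Cons B \<Gamma>)
  have "iprov T \<Gamma> (Imp B A)" using Cons.prems by (rule iimpR)
  then have *: "iprov T (map (isubst \<sigma>) \<Gamma>) (Imp (isubst \<sigma> B) (isubst \<sigma> A))" using Cons.IH by fastforce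
  have w: "wff (isubst \<sigma> B)" "\<forall>C \<in> set (map (isubst \<sigma>) \<Gamma>). wff C"
    using iprov_wf[OF il *] by auto
  have "der (set (isubst \<sigma> B # map (isubst \<sigma>) \<Gamma>)) (isubst \<sigma> A)"
    by (rule der_impE[OF der_mono[OF iprov_der[OF *]]]) (auto intro: der_prem w)
  then have "iprov T (isubst \<sigma> B # map (isubst \<sigma>) \<Gamma>) (isubst \<sigma> A)"
    by (rule der_iprov) (use w in auto)
  then show ?case by simp
qed

lemma der_subst:
  assumes "der H F" and "\<And>i. wft (\<sigma> i)"
  shows "der (isubst \<sigma> ` H) (isubst \<sigma> F)"
proof -
  obtain \<Gamma> where "set \<Gamma> \<subseteq> H" "iprov T \<Gamma> F" using assms(1) by (auto simp: der_def)
  then show ?thesis unfolding der_def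
    by (intro exI[of _ "map (isubst \<sigma>) \<Gamma>"]) (auto intro: iprov_subst assms(2))
qed

end

subsection \<open>The Girard and the forgetful translation\<close>

lemma forget_girard [simp]: "forget (girard A) = A"
  by (induction A) auto

lemma girard_isubst: "girard (isubst \<sigma> A) = asubst \<sigma> (girard A)"
  by (induction A arbitrary: \<sigma>) auto

lemma forget_asubst [simp]: "forget (asubst \<sigma> A) = isubst \<sigma> (forget A)"
  by (induction A arbitrary: \<sigma>) auto

lemma awf_girard [simp]: "awf L (girard A) \<longleftrightarrow> iwf L A"
  by (induction A) auto

lemma iwf_forget [simp]: "iwf L (forget A) \<longleftrightarrow> awf L A"
  by (induction A) auto

lemma awf_of_subst: "awf L (asubst \<sigma> A) \<Longrightarrow> awf L A"
  by (induction A arbitrary: \<sigma>) (auto intro: twf_of_subst)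

lemma alang_girard_thy [simp]: "alang (girard_thy T) = ilang T"
  by (simp add: girard_thy_def)

lemma forget_sound:
  assumes "aprov (girard_thy T) \<Gamma> A"
  shows "iprov T (map forget \<Gamma>) (forget A)"
  using assms
proof (induction rule: aprov.induct)
  case (aax \<Gamma> A)
  then show ?case by (auto simp: girard_thy_def o_def intro: iax)
next
  case (aperm \<Gamma> A \<Delta>)
  then show ?case by (auto intro: iperm[of T "map forget \<Gamma>"])
next
  case (alolL \<Gamma> A B \<Delta> C)
  then show ?case using iimpL[of T "map forget \<Gamma>"] by simp
next
  case (aallL t A \<Gamma> B)
  then show ?case by (auto intro: iallL[of _ t])
next
  case (aallR \<Gamma> A)
  then show ?case by (auto intro!: iallR simp: o_def)
next
  case (aexL A \<Gamma> B)
  then show ?case by (auto intro!: iexL simp: o_def)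
next
  case (aexR \<Gamma> t A)
  then show ?case by (auto intro: iexR[of _ _ t])
next
  case (acut \<Gamma> A \<Delta> B)
  then show ?case by (auto intro: icut)
qed (auto simp: o_def intro: iid iwk ibotL iandL iandR iimpR icon)

lemma aprov_awf:
  assumes "\<And>\<Gamma> A. (\<Gamma>, A) \<in> aaxs T \<Longrightarrow> (\<forall>B \<in> set \<Gamma>. awf (alang T) B) \<and> awf (alang T) A"
    and "aprov T \<Gamma> A"
  shows "(\<forall>B \<in> set \<Gamma>. awf (alang T) B) \<and> awf (alang T) A"
  using assms(2)
proof (induction rule: aprov.induct)
  case (aax \<Gamma> A) then show ?case using assms(1) by auto
next
  case (aperm \<Gamma> A \<Delta>)
  then have "set \<Gamma> = set \<Delta>" by (metis set_mset_mset)
  then show ?case using aperm by auto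
qed (auto dest: awf_of_subst simp: awf_asubst_iff)

context itheory begin

abbreviation gt :: "('c, 'p) athy" where "gt \<equiv> girard_thy T"

lemma gt_wf: "aprov gt \<Gamma> A \<Longrightarrow> (\<forall>B \<in> set \<Gamma>. awf (ilang T) B) \<and> awf (ilang T) A"
  using aprov_awf[of gt \<Gamma> A] il by (fastforce simp: girard_thy_def il_theory_def)

lemma acut1: "aprov gt [A] B \<Longrightarrow> aprov gt (B # \<Delta>) C \<Longrightarrow> aprov gt (A # \<Delta>) C"
  using acut[of gt "[A]" B \<Delta> C] by simp

lemma bang_id: "awf (ilang T) A \<Longrightarrow> aprov gt [Bang A] A"
  by (intro abangL aid) simp

lemma bangR1: "aprov gt [Bang A] B \<Longrightarrow> aprov gt [Bang A] (Bang B)"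
  using abangR[of gt "[A]" B] by simp

lemma bang_dup: "awf (ilang T) A \<Longrightarrow> aprov gt [Bang A] (Bang (Bang A))"
  by (intro bangR1 aid) simp

text \<open>Falsity, atoms, implications and universal formulas translate into formulas that begin
  with \<open>Bang\<close>, and \<open>Bang A\<close> can be promoted to
  \<open>Bang (Bang A)\<close>. In the other two cases the claim is proved from banged components,
  whose \<open>Bang\<close> is then removed by cuts with the induction hypotheses.\<close>

lemma girard_bang: "wff A \<Longrightarrow> aprov gt [girard A] (Bang (girard A))"
proof (induction A)
  case (And A B)
  have "aprov gt ([Bang (girard A)] @ [Bang (girard B)]) (Tensor (girard A) (girard B))"
    using And.prems by (intro atensR bang_id) auto
  then have "aprov gt [Bang (girard A), Bang (girard B)] (Bang (Tensor (girard A) (girard B)))"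
    using abangR[of gt "[girard A, girard B]"] by simp
  then have "aprov gt [girard A, Bang (girard B)] (Bang (Tensor (girard A) (girard B)))"
    using acut1 And by fastforce
  then have "aprov gt [Bang (girard B), girard A] (Bang (Tensor (girard A) (girard B)))"
    by (rule aperm) simp
  then have "aprov gt [girard B, girard A] (Bang (Tensor (girard A) (girard B)))"
    using acut1 And by fastforce
  then have "aprov gt [girard A, girard B] (Bang (Tensor (girard A) (girard B)))"
    by (rule aperm) simp
  then show ?case by (auto intro: atensL)
next
  case (IEx A)
  have "aprov gt [Bang (girard A)] (AEx (asubst (up 1 (shift 1)) (girard A)))"
  proof (rule aexR[of _ _ "Var 0"])
    show "aprov gt [Bang (girard A)] (asubst (inst [Var 0]) (asubst (up 1 (shift 1)) (girard A)))"
      using IEx.prems by (auto intro: bang_id)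
  qed simp
  then have "aprov gt [Bang (girard A)] (Bang (AEx (asubst (up 1 (shift 1)) (girard A))))"
    by (rule bangR1)
  then have "aprov gt [girard A] (Bang (AEx (asubst (up 1 (shift 1)) (girard A))))"
    using acut1 IEx by fastforce
  then show ?case by (auto intro: aexL)
qed (auto intro: bang_dup)

lemma girard_bang_ctx:
  assumes "aprov gt (map Bang (map girard \<Gamma>) @ \<Delta>) A" and "\<forall>B \<in> set \<Gamma>. wff B"
  shows "aprov gt (map girard \<Gamma> @ \<Delta>) A"
  using assms
proof (induction \<Gamma> arbitrary: \<Delta>)
  case (Cons B \<Gamma>)
  have "aprov gt (Bang (girard B) # map Bang (map girard \<Gamma>) @ \<Delta>) A" using Cons.prems by simp
  then have "aprov gt (girard B # map Bang (map girard \<Gamma>) @ \<Delta>) A"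
    by (rule acut1[rotated]) (use Cons.prems girard_bang in auto)
  then have "aprov gt (map Bang (map girard \<Gamma>) @ girard B # \<Delta>) A" by (rule aperm) simp
  then have "aprov gt (map girard \<Gamma> @ girard B # \<Delta>) A" using Cons by auto
  then show ?case by (rule aperm) simp
qed simp

lemma abangL_list: "aprov gt (\<Gamma> @ \<Delta>) A \<Longrightarrow> aprov gt (map Bang \<Gamma> @ \<Delta>) A"
proof (induction \<Gamma> arbitrary: \<Delta>)
  case (Cons B \<Gamma>)
  have "aprov gt (\<Gamma> @ B # \<Delta>) A" using Cons.prems by (rule aperm) simp
  then have "aprov gt (map Bang \<Gamma> @ B # \<Delta>) A" by (rule Cons.IH)
  then have "aprov gt (B # map Bang \<Gamma> @ \<Delta>) A" by (rule aperm) simp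
  then show ?case by (auto intro: abangL)
qed simp

text \<open>Promotion asks for a context of banged formulas; by \<open>girard_bang_ctx\<close>, a
  context of translated formulas is as good.\<close>

lemma girard_promote:
  assumes "aprov gt (map girard \<Gamma>) A" and "\<forall>B \<in> set \<Gamma>. wff B"
  shows "aprov gt (map girard \<Gamma>) (Bang A)"
proof -
  have "aprov gt (map Bang (map girard \<Gamma>)) (Bang A)"
    by (rule abangR) (use abangL_list[of "map girard \<Gamma>" "[]"] assms(1) in simp)
  then show ?thesis using girard_bang_ctx[of \<Gamma> "[]"] assms(2) by simp
qed

lemma girard_sound: "iprov T \<Gamma> A \<Longrightarrow> aprov gt (map girard \<Gamma>) (girard A)"
proof (induction rule: iprov.induct)
  case (iax \<Gamma> A)
  then show ?case by (intro aax) (auto simp: girard_thy_def)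
next
  case (iperm \<Gamma> A \<Delta>)
  then show ?case by (auto intro: aperm[of gt "map girard \<Gamma>"])
next
  \<comment> \<open>Contraction exists for banged formulas only: both copies are replaced by
    \<open>Bang (girard A)\<close> and contracted, and the remaining one is cut against
    \<open>girard A\<close>.\<close>
  case (icon A \<Gamma> B)
  have w: "wff A" using iprov_wf[OF il icon.hyps] by simp
  have "aprov gt (Bang (girard A) # girard A # map girard \<Gamma>) (girard B)"
    by (rule abangL) (use icon in simp)
  then have "aprov gt (girard A # Bang (girard A) # map girard \<Gamma>) (girard B)"
    by (rule aperm) simp
  then have "aprov gt (Bang (girard A) # map girard \<Gamma>) (girard B)"
    by (rule acon[OF abangL])
  then show ?case using acut1 girard_bang[OF w] by auto
next
  case (iimpL \<Gamma> A B \<Delta> C)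
  then have "aprov gt (Lolli (girard A) (girard B) # map girard \<Gamma> @ map girard \<Delta>) (girard C)"
    by (intro alolL) auto
  then show ?case by (auto intro: abangL)
next
  case (iimpR A \<Gamma> B)
  have "aprov gt (map girard \<Gamma>) (Lolli (girard A) (girard B))"
    by (rule alolR) (use iimpR in simp)
  then show ?case using girard_promote iprov_wf[OF il iimpR.hyps] by auto
next
  case (iallL t A \<Gamma> B)
  then have "aprov gt (AAll (girard A) # map girard \<Gamma>) (girard B)"
    by (intro aallL[of _ t]) (auto simp: girard_isubst)
  then show ?case by (auto intro: abangL)
next
  case (iallR \<Gamma> A)
  have "aprov gt (map girard \<Gamma>) (AAll (girard A))"
    by (rule aallR) (use iallR in \<open>simp add: girard_isubst o_def\<close>)
  moreover have "\<forall>B \<in> set \<Gamma>. wff B" using iprov_wf[OF il iallR.hyps] by (auto simp: iwf_isubst_iff)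
  ultimately show ?case using girard_promote by auto
next
  case (iexL A \<Gamma> B)
  then show ?case by (auto intro!: aexL simp: girard_isubst o_def)
next
  case (iexR \<Gamma> t A)
  then show ?case by (auto intro: aexR[of _ _ t] simp: girard_isubst)
next
  case (icut \<Gamma> A \<Delta> B)
  then show ?case by (auto intro: acut)
next
  case (ibotL A)
  then show ?case by (auto intro!: abangL abotL)
next
  case (iandR \<Gamma> A \<Delta> B)
  then show ?case by (auto intro: atensR)
qed (auto intro: aid awk atensL)

text \<open>
  Formulas \<open>F\<close> of these shapes are equivalent to \<open>girard (forget F)\<close>. The formulas \<open>|A\<^sup>\<circ>|\<close> are among them,
  which is how \<open>Q1\<close>, stated for them, becomes applicable to derivations in the target theory.
\<close>

inductive girardlike :: "('c, 'p) afm \<Rightarrow> bool" where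
  "girardlike (Bang (girard A))"
| "girardlike A \<Longrightarrow> girardlike B \<Longrightarrow> girardlike (Tensor A B)"
| "girardlike A \<Longrightarrow> girardlike (AEx A)"

lemma aex_mono:
  assumes "aprov gt [A] B"
  shows "aprov gt [AEx A] (AEx B)"
proof (rule aexL)
  have "awf (ilang T) B" using gt_wf[OF assms] by simp
  show "aprov gt (A # map (asubst (shift 1)) []) (asubst (shift 1) (AEx B))"
    using assms by (auto intro!: aexR[of _ _ "Var 0"])
qed

lemma tensor_mono: "aprov gt [A] A' \<Longrightarrow> aprov gt [B] B' \<Longrightarrow> aprov gt [Tensor A B] (Tensor A' B')"
  using atensL[of gt A B "[]"] atensR[of gt "[A]" A' "[B]" B'] by simp

text \<open>At \<open>Bang (girard A)\<close> the forgotten formula translates into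
  \<open>girard A\<close>; dereliction and \<open>girard_bang\<close> are the two directions. The
  other shapes are built by monotone connectives.\<close>

lemma girardlike_equiv:
  assumes "girardlike F" and "awf (ilang T) F"
  shows "aprov gt [F] (girard (forget F)) \<and> aprov gt [girard (forget F)] F"
  using assms by (induction rule: girardlike.induct) (auto intro: bang_id girard_bang aex_mono tensor_mono)

lemma aprov_cut_ctx:
  assumes "list_all2 (\<lambda>X Y. aprov gt [X] Y) Xs Ys" and "aprov gt (Ys @ \<Delta>) B"
  shows "aprov gt (Xs @ \<Delta>) B"
  using assms
proof (induction arbitrary: \<Delta> rule: list_all2_induct)
  case (Cons X Xs Y Ys)
  have "aprov gt (X # Ys @ \<Delta>) B" using Cons acut1[of X Y "Ys @ \<Delta>"] by simp
  then have "aprov gt (Ys @ X # \<Delta>) B" by (rule aperm) simp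
  then have "aprov gt (Xs @ X # \<Delta>) B" by (rule Cons.IH)
  then show ?case by (rule aperm) simp
qed simp

end

lemma forget_star [simp]: "forget (star A) = A"
  by (induction A) auto

section \<open>Tuples of terms and curried types\<close>

lemma tms_length: "xs \<in> tms L n \<Longrightarrow> length xs = n"
  by (simp add: tms_def)

lemma tms_appendI [intro]: "xs \<in> tms L m \<Longrightarrow> ys \<in> tms L n \<Longrightarrow> xs @ ys \<in> tms L (m + n)"
  by (auto simp: tms_def)

lemma tms_vars [simp]: "map Var [m..<n] \<in> tms L (n - m)"
  by (auto simp: tms_def)

lemma tms_vars_simps [simp]:
  "map Var [m..<m + n] \<in> tms L n" "vars n \<in> tms L n"
  "map (shift k) [m..<m + n] \<in> tms L n" "map (shift k) [0..<n] \<in> tms L n"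
  by (auto simp: tms_def)

lemma tms_subst: "xs \<in> tms L n \<Longrightarrow> (\<And>i. twf L (\<sigma> i)) \<Longrightarrow> map (tsubst \<sigma>) xs \<in> tms L n"
  by (auto simp: tms_def twf_tsubst_iff)

lemma tms_shift: "xs \<in> tms L n \<Longrightarrow> map (tsubst (shift k)) xs \<in> tms L n"
  by (rule tms_subst) auto

lemma tms_take: "xs \<in> tms L (m + n) \<Longrightarrow> take m xs \<in> tms L m"
  by (auto simp: tms_def dest: in_set_takeD)

lemma tms_drop: "xs \<in> tms L (m + n) \<Longrightarrow> drop m xs \<in> tms L n"
  by (auto simp: tms_def dest: in_set_dropD)

lemma tms_inst: "xs \<in> tms L n \<Longrightarrow> twf L (inst xs i)"
  by (auto simp: tms_def inst_def)

lemma map_inst_vars [simp]: "length xs = n \<Longrightarrow> map (inst xs) [0..<n] = xs"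
  by (rule nth_equalityI) (auto simp: inst_def)

lemma tsubst_foldl_App: "tsubst \<sigma> (foldl App f xs) = foldl App (tsubst \<sigma> f) (map (tsubst \<sigma>) xs)"
  by (induction xs arbitrary: f) auto

lemma map_tsubst_tapp [simp]: "map (tsubst \<sigma>) (tapp fs xs) = tapp (map (tsubst \<sigma>) fs) (map (tsubst \<sigma>) xs)"
  by (simp add: tapp_def tsubst_foldl_App)

lemma arrs_simps [simp]: "arrs [] \<rho> = \<rho>" "arrs (\<sigma> # \<sigma>s) \<rho> = Fn \<sigma> (arrs \<sigma>s \<rho>)"
  by (auto simp: arrs_def)

lemma arrs_append [simp]: "arrs (\<sigma>s @ \<tau>s) \<rho> = arrs \<sigma>s (arrs \<tau>s \<rho>)"
  by (auto simp: arrs_def)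

lemma length_tarrs [simp]: "length (tarrs \<sigma>s \<rho>s) = length \<rho>s"
  by (simp add: tarrs_def)

lemma tarrs_tarrs [simp]: "tarrs \<sigma>s (tarrs \<tau>s \<rho>s) = tarrs (\<sigma>s @ \<tau>s) \<rho>s"
  by (auto simp: tarrs_def)

locale circ_interp = itheory It for It :: "('c, 'p) ithy" +
  fixes Is :: "('c, 'p) ithy" and p :: "('c, 'p, ('c, 'p) ifm) params"
  assumes il_Is: "il_theory Is"
    and params: "il_params (ilang Is) (ilang It) p"
    and A1: "A1 (girard_thy It)"
    and A2: "A2 (girard_thy Is) (girard_thy It) (girard_params p)"
    and A4: "A4 (girard_thy It) (girard_params p)"
    and A5: "A5 (girard_thy It) (girard_params p)
           (interp_fms (girard_thy Is) (girard_thy It) (girard_params p))"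
    and W_inh: "W_inhabited It p"
begin

abbreviation TM :: "nat \<Rightarrow> 'c tm list set" where "TM \<equiv> tms (ilang It)"
abbreviation sh :: "nat \<Rightarrow> 'c tm list \<Rightarrow> 'c tm list" where "sh n \<equiv> map (tsubst (shift n))"
abbreviation tup :: "ty list \<Rightarrow> 'c tm list set" where "tup \<tau>s \<equiv> TM (length \<tau>s)"

subsection \<open>Provable equality\<close>

lemma omega_sub: "sublang omega_lang (ilang It)"
  using A1 by (simp add: A1_def)

lemma omega_simps [simp]: "has_app (ilang It)" "CK \<in> csyms (ilang It)" "CS \<in> csyms (ilang It)" "Eq \<in> psyms (ilang It)"
  using omega_sub by (auto simp: sublang_def omega_lang_def)

text \<open>(A1) provides the axioms in the translation \<open>star\<close>; forgetting exponentials
  restores them.\<close>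

lemma der_omega: "(\<Gamma>, A) \<in> omega_axs (ilang It) \<Longrightarrow> der (set \<Gamma>) A"
proof -
  assume "(\<Gamma>, A) \<in> omega_axs (ilang It)"
  then have "(map (\<lambda>B. Bang (star B)) \<Gamma>, star A) \<in> aaxs (al_omega (ilang It))"
    by (auto simp: al_omega_def star_thy_def il_omega_def)
  then have "aprov gt (map (\<lambda>B. Bang (star B)) \<Gamma>) (star A)"
    using A1 by (auto simp: A1_def extends_def)
  from forget_sound[OF this] have "iprov It \<Gamma> A" by (simp add: o_def)
  then show ?thesis by (rule iprov_der)
qed

text \<open>Equations without hypotheses are stable under every substitution, so they may be applied
  under quantifiers.\<close>

definition peq :: "'c tm \<Rightarrow> 'c tm \<Rightarrow> bool" where
  "peq s t \<longleftrightarrow> der {} (IEq s t)"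

lemma peq_wft: "peq s t \<Longrightarrow> wft s" "peq s t \<Longrightarrow> wft t"
  unfolding peq_def by (auto dest: der_wff)

lemma peq_refl: "wft t \<Longrightarrow> peq t t"
  unfolding peq_def using der_omega[OF eq_refl] by simp

lemma peq_atom:
  assumes "peq s t" and "wff (IAtom P ts)"
  shows "der {isubst (inst [s]) (IAtom P ts)} (isubst (inst [t]) (IAtom P ts))"
proof (rule der_cut)
  show "der (set [IEq s t, isubst (inst [s]) (IAtom P ts)]) (isubst (inst [t]) (IAtom P ts))"
    using der_omega[OF eq_repl] assms peq_wft by blast
qed (use assms in \<open>auto simp: peq_def intro: der_mono der_prem\<close>)

lemma peq_sym:
  assumes "peq s t"
  shows "peq t s"
proof -
  \<comment> \<open>Replacement of \<open>s\<close> by \<open>t\<close> in the atom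
    \<open>x = s\<close>, where \<open>x\<close> is variable 0.\<close>
  have "wff (IAtom Eq [Var 0, tsubst (shift 1) s])"
    using peq_wft[OF assms] by (simp add: twf_tsubst_iff)
  from peq_atom[OF assms this] have "der {IEq s s} (IEq t s)" by (simp add: inst_def)
  then show ?thesis using peq_refl[OF peq_wft(1)[OF assms]] unfolding peq_def by (auto intro: der_cut)
qed

lemma peq_trans:
  assumes "peq s t" and "peq t u"
  shows "peq s u"
proof -
  have "wff (IAtom Eq [Var 0, tsubst (shift 1) u])"
    using peq_wft[OF assms(2)] by (simp add: twf_tsubst_iff)
  from peq_atom[OF peq_sym[OF assms(1)] this] have "der {IEq t u} (IEq s u)" by (simp add: inst_def)
  then show ?thesis using assms(2) unfolding peq_def by (auto intro: der_cut)
qed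

lemma peq_App:
  assumes "peq s s'" and "peq t t'"
  shows "peq (App s t) (App s' t')"
proof -
  note w = peq_wft[OF assms(1)] peq_wft[OF assms(2)]
  have "wff (IAtom Eq [tsubst (shift 1) (App s t), App (Var 0) (tsubst (shift 1) t)])"
    using w by (simp add: twf_tsubst_iff)
  from peq_atom[OF assms(1) this] have "der {IEq (App s t) (App s t)} (IEq (App s t) (App s' t))"
    by (simp add: inst_def)
  then have 1: "peq (App s t) (App s' t)"
    using peq_refl[of "App s t"] w unfolding peq_def by (auto intro: der_cut)
  have "wff (IAtom Eq [tsubst (shift 1) (App s' t), App (tsubst (shift 1) s') (Var 0)])"
    using w by (simp add: twf_tsubst_iff)
  from peq_atom[OF assms(2) this] have "der {IEq (App s' t) (App s' t)} (IEq (App s' t) (App s' t'))"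
    by (simp add: inst_def)
  then have 2: "peq (App s' t) (App s' t')"
    using peq_refl[of "App s' t"] w unfolding peq_def by (auto intro: der_cut)
  show ?thesis using peq_trans[OF 1 2] .
qed

lemma peq_subst: "peq s t \<Longrightarrow> (\<And>i. wft (\<sigma> i)) \<Longrightarrow> peq (tsubst \<sigma> s) (tsubst \<sigma> t)"
  unfolding peq_def using der_subst[of "{}" "IEq s t" \<sigma>] by simp

lemma peq_tsubst: "wft t \<Longrightarrow> (\<And>i. peq (\<sigma> i) (\<tau> i)) \<Longrightarrow> peq (tsubst \<sigma> t) (tsubst \<tau> t)"
  by (induction t) (auto intro: peq_refl peq_App)

text \<open>\<open>eq_repl\<close> exchanges one argument at a time; in the induction, those already
  exchanged are moved to \<open>us\<close>.\<close>

lemma peq_atoms: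
  assumes "list_all2 peq ss ts" and "us \<in> TM (length us)" and "P \<in> psyms (ilang It)"
    and "length us + length ss = arity P"
  shows "der {IAtom P (us @ ss)} (IAtom P (us @ ts))"
  using assms
proof (induction arbitrary: us rule: list_all2_induct)
  case Nil
  then show ?case by (auto intro!: der_prem simp: tms_def)
next
  case (Cons s ss t ts)
  let ?sh = "map (tsubst (shift 1))"
  have ss: "\<forall>u \<in> set ss. wft u" using Cons(2) by (fastforce simp: list_all2_conv_all_nth in_set_conv_nth intro: peq_wft(1))
  have "wff (IAtom P (?sh us @ Var 0 # ?sh ss))"
    using Cons.prems ss by (auto simp: twf_tsubst_iff tms_def)
  from peq_atom[OF Cons(1) this]
  have 1: "der {IAtom P (us @ s # ss)} (IAtom P (us @ t # ss))"
    by (simp add: inst_def o_def)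
  have "der {IAtom P ((us @ [t]) @ ss)} (IAtom P ((us @ [t]) @ ts))"
    by (rule Cons.IH) (use Cons.prems peq_wft[OF Cons(1)] in \<open>auto simp: tms_def\<close>)
  then show ?case using der_cut[of "{IAtom P (us @ t # ss)}"] 1 by simp
qed

text \<open>Two pointwise equal substitutions, in place of a single replaced variable, survive the
  passage under a quantifier by \<open>up\<close>. The case of implication uses the reversed
  equations.\<close>

lemma peq_formula:
  "wff F \<Longrightarrow> (\<And>i. peq (\<sigma> i) (\<tau> i)) \<Longrightarrow> der {isubst \<sigma> F} (isubst \<tau> F)"
proof (induction F arbitrary: \<sigma> \<tau>)
  case IBot
  then show ?case by (auto intro: der_prem)
next
  case (IAtom P ts)
  have "list_all2 peq (map (tsubst \<sigma>) ts) (map (tsubst \<tau>) ts)"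
    using IAtom by (auto simp: list_all2_conv_all_nth intro: peq_tsubst)
  from peq_atoms[OF this, of "[]" P] show ?case using IAtom by (simp add: tms_def)
next
  case (And A B)
  have w: "wff (isubst \<sigma> (And A B))" using And.prems peq_wft by (subst iwf_isubst_iff) auto
  have p: "der {isubst \<sigma> (And A B)} (And (isubst \<sigma> A) (isubst \<sigma> B))"
    using w by (auto intro: der_prem)
  have "der {isubst \<sigma> A} (isubst \<tau> A)" "der {isubst \<sigma> B} (isubst \<tau> B)" using And by auto
  then show ?case using der_andE[OF p] by (auto intro!: der_andI intro: der_cut)
next
  case (Imp A B)
  have "wft (\<sigma> i)" "wft (\<tau> i)" for i using Imp.prems(2)[of i] peq_wft by auto
  then have w: "wff (isubst \<sigma> (Imp A B))" "wff (isubst \<tau> A)" using Imp.prems(1)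
    by (auto simp: iwf_isubst_iff)
  have 1: "der {isubst \<tau> A} (isubst \<sigma> A)" "der {isubst \<sigma> B} (isubst \<tau> B)"
    by (rule Imp.IH; use Imp.prems peq_sym in auto)+
  have "der (insert (isubst \<tau> A) {isubst \<sigma> (Imp A B)}) (isubst \<sigma> B)"
    by (rule der_impE[of _ "isubst \<sigma> A"]) (use w 1 in \<open>auto intro: der_prem der_mono\<close>)
  then have "der (insert (isubst \<tau> A) {isubst \<sigma> (Imp A B)}) (isubst \<tau> B)"
    using der_cut[OF 1(2)] by auto
  then show ?case using w(2) by (simp add: der_impI)
next
  case (IAll A)
  have e: "peq (up 1 \<sigma> i) (up 1 \<tau> i)" for i
    using IAll.prems by (auto simp: up_def intro: peq_refl peq_subst)
  have "wff (isubst (shift 1) (isubst \<sigma> (IAll A)))" using IAll.prems peq_wft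
    by (subst iwf_isubst_iff, simp, subst iwf_isubst_iff) auto
  then have "der {isubst (shift 1) (isubst \<sigma> (IAll A))} (isubst (inst [Var 0]) (isubst (up 1 (shift 1)) (isubst (up 1 \<sigma>) A)))"
    by (intro der_allE) (auto intro: der_prem)
  then have "der {isubst (shift 1) (isubst \<sigma> (IAll A))} (isubst (up 1 \<sigma>) A)"
    by (simp add: scomp_assoc)
  moreover have "der {isubst (up 1 \<sigma>) A} (isubst (up 1 \<tau>) A)"
    by (rule IAll.IH) (use IAll.prems e in auto)
  ultimately have "der {isubst (shift 1) (isubst \<sigma> (IAll A))} (isubst (up 1 \<tau>) A)"
    by (auto intro: der_cut)
  then show ?case by (auto intro: der_allI)
next
  case (IEx A)
  have e: "peq (up 1 \<sigma> i) (up 1 \<tau> i)" for i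
    using IEx.prems by (auto simp: up_def intro: peq_refl peq_subst)
  have w: "wff (isubst (up 1 \<sigma>) A)"
    using IEx.prems e peq_wft by (subst iwf_isubst_iff) auto
  have "der {isubst (up 1 \<sigma>) A} (isubst (up 1 \<tau>) A)"
    by (rule IEx.IH) (use IEx.prems e in auto)
  then have "der {isubst (up 1 \<sigma>) A} (isubst (shift 1) (isubst \<tau> (IEx A)))"
    by (auto intro!: der_exI[of _ "Var 0"] simp: scomp_assoc)
  then show ?case using der_exE[of "isubst (up 1 \<sigma>) A" "{}"] w by simp
qed

subsection \<open>The predicates \<open>W\<close> and combinatory abstraction\<close>

abbreviation Wf :: "ty \<Rightarrow> 'c tm \<Rightarrow> ('c, 'p) ifm" where
  "Wf \<tau> t \<equiv> isubst (inst [t]) (W p \<tau>)"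

abbreviation WS :: "ty list \<Rightarrow> 'c tm list \<Rightarrow> ('c, 'p) ifm set" where
  "WS \<tau>s ts \<equiv> set (iWs p \<tau>s ts)"

lemma wff_W [simp]: "wff (W p \<tau>)"
  using params by (simp add: il_params_def)

lemma ifv_W: "ifv (W p \<tau>) \<subseteq> {0}"
  using params by (simp add: il_params_def)

text \<open>Variable 0 is the only one that can be free in \<open>W p \<tau>\<close>, so \<sigma>
  acts on the argument alone.\<close>

lemma isubst_Wf: "isubst \<sigma> (Wf \<tau> t) = Wf \<tau> (tsubst \<sigma> t)"
  using ifv_W[of \<tau>] by (auto intro!: isubst_cong simp: scomp_def inst_def)

lemma scomp_isubst_Wf [simp]: "isubst (scomp \<sigma> (inst [t])) (W p \<tau>) = Wf \<tau> (tsubst \<sigma> t)"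
  using isubst_Wf by simp

lemma wff_Wf: "wft t \<Longrightarrow> wff (Wf \<tau> t)"
  by (subst iwf_isubst_iff) (auto simp: inst_def)

lemma iWs_Nil [simp]: "iWs p [] ts = []" "iWs p \<tau>s [] = []"
  by (auto simp: iWs_def)

lemma iWs_Cons [simp]: "iWs p (\<tau> # \<tau>s) (t # ts) = Wf \<tau> t # iWs p \<tau>s ts"
  by (simp add: iWs_def)

lemma iWs_append: "length ts = length \<tau>s \<Longrightarrow> iWs p (\<tau>s @ \<rho>s) (ts @ us) = iWs p \<tau>s ts @ iWs p \<rho>s us"
  by (simp add: iWs_def)

lemma WS_append: "length ts = length \<tau>s \<Longrightarrow> WS (\<tau>s @ \<rho>s) (ts @ us) = WS \<tau>s ts \<union> WS \<rho>s us"
  by (simp add: iWs_append)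

lemma map_isubst_iWs: "map (isubst \<sigma>) (iWs p \<tau>s ts) = iWs p \<tau>s (map (tsubst \<sigma>) ts)"
  by (auto simp: iWs_def zip_map2)

lemma isubst_WS: "isubst \<sigma> ` WS \<tau>s ts = WS \<tau>s (map (tsubst \<sigma>) ts)"
  using map_isubst_iWs[of \<sigma> \<tau>s ts] by (metis set_map)

lemma wff_WS: "ts \<in> TM n \<Longrightarrow> F \<in> WS \<tau>s ts \<Longrightarrow> wff F"
  by (auto simp: iWs_def tms_def intro!: wff_Wf dest: set_zip_rightD)

lemma der_iconj: "F \<in> set Fs \<Longrightarrow> der H (iconj Fs) \<Longrightarrow> der H F"
  by (induction Fs rule: iconj.induct) (auto dest: der_andE)

lemma der_iconjI: "(\<And>F. F \<in> set Fs \<Longrightarrow> der H F) \<Longrightarrow> der H (iconj Fs)"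
proof (induction Fs rule: iconj.induct)
  case 1
  show ?case by (simp add: der_impI der_prem)
qed (auto intro: der_andI)

lemma wff_iconj: "wff (iconj Fs) \<longleftrightarrow> (\<forall>F \<in> set Fs. wff F)"
  by (induction Fs rule: iconj.induct) auto

lemma forget_aWs: "map forget (aWs (girard_params p) \<tau>s ts) = iWs p \<tau>s ts"
  by (auto simp: aWs_def iWs_def girard_params_def)

lemma forget_tensor: "forget (tensor As) = iconj (map forget As)"
  by (induction As rule: tensor.induct) auto

lemma forget_aWc [simp]: "forget (aWc (girard_params p) \<tau>s ts) = iWc p \<tau>s ts"
  by (simp add: aWc_def iWc_def forget_tensor forget_aWs)

lemma der_aWc: "aprov gt [] (aWc (girard_params p) \<tau>s ts) \<Longrightarrow> F \<in> WS \<tau>s ts \<Longrightarrow> der {} F"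
  using forget_sound[of It "[]"] der_iconj iprov_der by (fastforce simp: iWc_def)

lemma W_K: "der {} (Wf (Fn \<sigma> (Fn \<tau> \<sigma>)) (Cst CK))"
  using A4 der_aWc[of "[_]" "[Cst CK]"] by (auto simp: A4_def)

lemma W_S: "der {} (Wf (Fn (Fn \<sigma> (Fn \<tau> \<rho>)) (Fn (Fn \<sigma> \<tau>) (Fn \<sigma> \<rho>))) (Cst CS))"
  using A4 der_aWc[of "[_]" "[Cst CS]"] by (auto simp: A4_def)

text \<open>(A4) is stated for two variables; closure under substitution extends it to all
  terms.\<close>

lemma W_App:
  assumes "wft s" and "wft f"
  shows "der {Wf \<tau> s, Wf (Fn \<tau> \<rho>) f} (Wf \<rho> (App f s))"
proof -
  have "aprov gt (aWs (girard_params p) [\<tau>, Fn \<tau> \<rho>] [Var 0, Var 1]) (aWc (girard_params p) [\<rho>] [App (Var 1) (Var 0)])"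
    using A4 by (auto simp: A4_def)
  from forget_sound[OF this]
  have "iprov It [Wf \<tau> (Var 0), Wf (Fn \<tau> \<rho>) (Var 1)] (Wf \<rho> (App (Var 1) (Var 0)))"
    by (simp add: forget_aWs iWc_def)
  from der_subst[OF iprov_der[OF this], of "inst [s, f]"] assms
  show ?thesis by simp
qed

text \<open>Combinatory terms over variables of types \<Gamma> whose membership in \<open>W\<close>
  follows from that of their variables by application. A closed term in \<open>W\<close> counts as a
  constant as a whole, which admits the terms supplied by (A5) and by the witnesses of
  axioms.\<close>

inductive wtyped :: "ty list \<Rightarrow> 'c tm \<Rightarrow> ty \<Rightarrow> bool" for \<Gamma> :: "ty list" where
  wVar: "i < length \<Gamma> \<Longrightarrow> wtyped \<Gamma> (Var i) (\<Gamma> ! i)"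
| wConst: "tfv c = {} \<Longrightarrow> der {} (Wf \<tau> c) \<Longrightarrow> wft c \<Longrightarrow> wtyped \<Gamma> c \<tau>"
| wApp: "wtyped \<Gamma> f (Fn \<tau> \<rho>) \<Longrightarrow> wtyped \<Gamma> s \<tau> \<Longrightarrow> wtyped \<Gamma> (App f s) \<rho>"

lemma wtyped_wft: "wtyped \<Gamma> t \<tau> \<Longrightarrow> wft t"
  by (induction rule: wtyped.induct) auto

lemma wtyped_wft_inst: "wtyped \<Gamma> t \<tau> \<Longrightarrow> xs \<in> TM n \<Longrightarrow> wft (tsubst (inst xs) t)"
  by (subst twf_tsubst_iff) (auto dest: wtyped_wft simp: tms_inst)

lemma wtyped_tfv: "wtyped \<Gamma> t \<tau> \<Longrightarrow> tfv t \<subseteq> {..<length \<Gamma>}"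
  by (induction rule: wtyped.induct) auto

lemma wtyped_W:
  assumes "wtyped \<Gamma> t \<tau>" and "xs \<in> tup \<Gamma>"
  shows "der (WS \<Gamma> xs) (Wf \<tau> (tsubst (inst xs) t))"
  using assms
proof (induction rule: wtyped.induct)
  case (wVar i)
  have l: "length xs = length \<Gamma>" using wVar by (auto simp: tms_def)
  then have "Wf (\<Gamma> ! i) (xs ! i) \<in> WS \<Gamma> xs"
    using wVar by (auto simp: iWs_def in_set_conv_nth intro!: exI[of _ i] rev_image_eqI[of "(\<Gamma> ! i, xs ! i)"])
  then show ?case using wVar l wff_WS by (auto intro: der_prem)
next
  case (wConst c \<tau>)
  then show ?case by (auto simp: tsubst_closed intro: der_mono)
next
  case (wApp f \<tau> \<rho> s)
  have "wft (tsubst (inst xs) s)" "wft (tsubst (inst xs) f)"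
    using wApp wtyped_wft_inst by auto
  from der_cut[OF W_App[OF this]] show ?case using wApp by auto
qed

lemma wtyped_subst:
  "wtyped \<Delta> t \<rho> \<Longrightarrow> list_all2 (wtyped \<Gamma>) ss \<Delta> \<Longrightarrow> wtyped \<Gamma> (tsubst (inst ss) t) \<rho>"
proof (induction rule: wtyped.induct)
  case (wVar i)
  then show ?case by (auto simp: list_all2_conv_all_nth inst_def)
next
  case (wConst c \<tau>)
  then show ?case by (auto simp: tsubst_closed intro: wtyped.wConst)
qed (auto intro: wtyped.wApp)

lemma wK: "wtyped \<Gamma> (Cst CK) (Fn \<sigma> (Fn \<tau> \<sigma>))"
  by (rule wConst) (auto simp: W_K)

lemma wS: "wtyped \<Gamma> (Cst CS) (Fn (Fn \<sigma> (Fn \<tau> \<rho>)) (Fn (Fn \<sigma> \<tau>) (Fn \<sigma> \<rho>)))"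
  by (rule wConst) (auto simp: W_S)

lemma peq_K: "wft s \<Longrightarrow> wft t \<Longrightarrow> peq (App2 (Cst CK) s t) s"
  unfolding peq_def using der_omega[OF K_eq] by fastforce

lemma peq_S: "wft s \<Longrightarrow> wft t \<Longrightarrow> wft u \<Longrightarrow> peq (App3 (Cst CS) s t u) (App2 s u (App t u))"
  unfolding peq_def using der_omega[OF S_eq] by fastforce

text \<open>Bracket abstraction with \<open>CS\<close> and \<open>CK\<close>. The abstracted
  variable is the last one of the context, so the indices of the others do not change.\<close>

lemma wtyped_abs1:
  assumes "wtyped (\<Gamma> @ [\<sigma>]) t \<tau>"
  shows "\<exists>u. wtyped \<Gamma> u (Fn \<sigma> \<tau>) \<and>
    (\<forall>xs \<in> tup \<Gamma>. \<forall>y. wft y \<longrightarrow> peq (App (tsubst (inst xs) u) y) (tsubst (inst (xs @ [y])) t))"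
  using assms
proof (induction rule: wtyped.induct)
  case (wVar i)
  show ?case
  proof (cases "i = length \<Gamma>")
    case True
    let ?I = "App2 (Cst CS) (Cst CK) (Cst CK) :: 'c tm"
    \<comment> \<open>The argument discarded by the second \<open>CK\<close> must have some type;
      \<open>TyB\<close> is an arbitrary choice.\<close>
    have "wtyped \<Gamma> ?I (Fn \<sigma> \<sigma>)"
      by (rule wApp[OF wApp[OF wS wK] wK[of _ _ TyB]])
    moreover have "peq (App ?I y) y" if "wft y" for y
      by (rule peq_trans[OF peq_S peq_K]) (use that in auto)
    ultimately show ?thesis using True by (intro exI[of _ ?I]) (auto simp: tms_def nth_append)
  next
    case False
    then have i: "i < length \<Gamma>" using wVar by simp
    have "wtyped \<Gamma> (App (Cst CK) (Var i)) (Fn \<sigma> (\<Gamma> ! i))"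
      by (rule wApp[OF wK wtyped.wVar[OF i]])
    then show ?thesis using i
      by (intro exI[of _ "App (Cst CK) (Var i)"]) (auto simp: inst_def tms_def nth_append intro: peq_K)
  qed
next
  case (wConst c \<tau>)
  have "wtyped \<Gamma> (App (Cst CK) c) (Fn \<sigma> \<tau>)"
    by (rule wApp[OF wK wtyped.wConst]) (use wConst in auto)
  then show ?case using wConst
    by (intro exI[of _ "App (Cst CK) c"]) (auto simp: tsubst_closed intro: peq_K)
next
  case (wApp f \<tau> \<rho> s)
  then obtain u v where u: "wtyped \<Gamma> u (Fn \<sigma> (Fn \<tau> \<rho>))" "wtyped \<Gamma> v (Fn \<sigma> \<tau>)"
    "\<forall>xs \<in> tup \<Gamma>. \<forall>y. wft y \<longrightarrow> peq (App (tsubst (inst xs) u) y) (tsubst (inst (xs @ [y])) f)"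
    "\<forall>xs \<in> tup \<Gamma>. \<forall>y. wft y \<longrightarrow> peq (App (tsubst (inst xs) v) y) (tsubst (inst (xs @ [y])) s)"
    by blast
  have "wtyped \<Gamma> (App2 (Cst CS) u v) (Fn \<sigma> \<rho>)"
    by (rule wtyped.wApp[OF wtyped.wApp[OF wS u(1)] u(2)])
  moreover have "peq (App (tsubst (inst xs) (App2 (Cst CS) u v)) y) (tsubst (inst (xs @ [y])) (App f s))"
    if "xs \<in> tup \<Gamma>" "wft y" for xs y
  proof -
    have "wft (tsubst (inst xs) u)" "wft (tsubst (inst xs) v)"
      using u(1,2) that(1) wtyped_wft_inst by auto
    then have "peq (App (tsubst (inst xs) (App2 (Cst CS) u v)) y)
        (App2 (tsubst (inst xs) u) y (App (tsubst (inst xs) v) y))"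
      using that by (auto intro: peq_S)
    moreover have "peq (App2 (tsubst (inst xs) u) y (App (tsubst (inst xs) v) y)) (tsubst (inst (xs @ [y])) (App f s))"
      using u that by (simp add: peq_App)
    ultimately show ?thesis by (rule peq_trans)
  qed
  ultimately show ?case by blast
qed

lemma wtyped_abs:
  assumes "wtyped (\<Gamma> @ \<sigma>s) t \<tau>"
  shows "\<exists>u. wtyped \<Gamma> u (arrs \<sigma>s \<tau>) \<and>
    (\<forall>xs \<in> tup \<Gamma>. \<forall>ys \<in> tup \<sigma>s. peq (foldl App (tsubst (inst xs) u) ys) (tsubst (inst (xs @ ys)) t))"
  using assms
proof (induction \<sigma>s arbitrary: t \<tau> rule: rev_induct)
  case Nil
  then show ?case using wtyped_wft_inst by (intro exI[of _ t]) (auto simp: tms_def intro!: peq_refl)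
next
  case (snoc \<sigma> \<sigma>s)
  then obtain v where v: "wtyped (\<Gamma> @ \<sigma>s) v (Fn \<sigma> \<tau>)"
    "\<And>xs y. xs \<in> TM (length \<Gamma> + length \<sigma>s) \<Longrightarrow> wft y \<Longrightarrow> peq (App (tsubst (inst xs) v) y) (tsubst (inst (xs @ [y])) t)"
    using wtyped_abs1[of "\<Gamma> @ \<sigma>s" \<sigma> t \<tau>] by auto
  obtain u where u: "wtyped \<Gamma> u (arrs \<sigma>s (Fn \<sigma> \<tau>))"
    "\<And>xs ys. xs \<in> tup \<Gamma> \<Longrightarrow> ys \<in> tup \<sigma>s \<Longrightarrow> peq (foldl App (tsubst (inst xs) u) ys) (tsubst (inst (xs @ ys)) v)"
    using snoc.IH[OF v(1)] by auto
  have "peq (foldl App (tsubst (inst xs) u) ys) (tsubst (inst (xs @ ys)) t)"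
    if xs: "xs \<in> tup \<Gamma>" and ys': "ys \<in> TM (Suc (length \<sigma>s))" for xs ys
  proof -
    obtain y zs where ys: "ys = zs @ [y]" using ys' by (cases ys rule: rev_cases) (auto simp: tms_def)
    have zs: "zs \<in> tup \<sigma>s" and y: "wft y" using ys' by (auto simp: ys tms_def)
    have "peq (App (foldl App (tsubst (inst xs) u) zs) y) (App (tsubst (inst (xs @ zs)) v) y)"
      by (intro peq_App u peq_refl xs zs y)
    then show ?thesis using peq_trans v(2)[OF tms_appendI[OF xs zs] y] by (simp add: ys)
  qed
  then show ?case using u(1) by auto
qed

subsection \<open>Definable functions on tuples\<close>

text \<open>The equation for \<open>f\<close> is syntactic identity and holds for all tuples of the
  right length. Tuples can thus be split, joined and composed in HOL, without any beta-reduction in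
  the object theory.\<close>

definition Wdef :: "ty list \<Rightarrow> ty list \<Rightarrow> ('c tm list \<Rightarrow> 'c tm list) \<Rightarrow> bool" where
  "Wdef \<sigma>s \<tau>s f \<longleftrightarrow> (\<exists>ts. list_all2 (wtyped \<sigma>s) ts \<tau>s \<and>
     (\<forall>xs. length xs = length \<sigma>s \<longrightarrow> f xs = map (tsubst (inst xs)) ts))"

lemma list_all2_wtyped_tms: "list_all2 (wtyped \<sigma>s) ts \<tau>s \<Longrightarrow> ts \<in> tup \<tau>s"
  by (fastforce simp: tms_def list_all2_conv_all_nth in_set_conv_nth intro: wtyped_wft)

lemma Wdef_tms: "Wdef \<sigma>s \<tau>s f \<Longrightarrow> xs \<in> tup \<sigma>s \<Longrightarrow> f xs \<in> tup \<tau>s"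
  unfolding Wdef_def using list_all2_wtyped_tms tms_inst tms_subst tms_length by metis

lemma Wdef_length: "Wdef \<sigma>s \<tau>s f \<Longrightarrow> length xs = length \<sigma>s \<Longrightarrow> length (f xs) = length \<tau>s"
  unfolding Wdef_def by (auto dest: list_all2_lengthD)

text \<open>The terms behind \<open>f\<close> contain no variables besides their arguments. This
  lets witnesses pass under binders, where the arguments are shifted.\<close>

lemma Wdef_subst:
  assumes "Wdef \<sigma>s \<tau>s f" and "length xs = length \<sigma>s"
  shows "map (tsubst \<theta>) (f xs) = f (map (tsubst \<theta>) xs)"
proof -
  obtain ts where ts: "list_all2 (wtyped \<sigma>s) ts \<tau>s"
     "\<And>xs. length xs = length \<sigma>s \<Longrightarrow> f xs = map (tsubst (inst xs)) ts"
    using assms(1) by (auto simp: Wdef_def)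
  have "tsubst (scomp \<theta> (inst xs)) t = tsubst (inst (map (tsubst \<theta>) xs)) t" if "t \<in> set ts" for t
  proof (rule tsubst_cong)
    fix i assume "i \<in> tfv t"
    then have "i < length \<sigma>s" using that ts(1) wtyped_tfv by (fastforce simp: list_all2_conv_all_nth in_set_conv_nth)
    then show "scomp \<theta> (inst xs) i = inst (map (tsubst \<theta>) xs) i"
      using assms(2) by (simp add: scomp_def inst_def)
  qed
  then show ?thesis using assms(2) by (simp add: ts(2))
qed

lemma Wdef_W:
  assumes "Wdef \<sigma>s \<tau>s f" and "xs \<in> tup \<sigma>s" and "F \<in> WS \<tau>s (f xs)"
  shows "der (WS \<sigma>s xs) F"
proof -
  obtain ts where ts: "list_all2 (wtyped \<sigma>s) ts \<tau>s" "f xs = map (tsubst (inst xs)) ts"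
    using assms(1,2) by (auto simp: Wdef_def tms_def)
  then have "list_all2 (\<lambda>t \<tau>. der (WS \<sigma>s xs) (Wf \<tau> (tsubst (inst xs) t))) ts \<tau>s"
    using wtyped_W[OF _ assms(2)] by (auto elim: list_all2_mono)
  then show ?thesis using assms(3) unfolding ts(2)
    by (induction rule: list_all2_induct) auto
qed

lemma Wdef_cong: "Wdef \<sigma>s \<tau>s f \<Longrightarrow> (\<And>xs. length xs = length \<sigma>s \<Longrightarrow> f xs = g xs) \<Longrightarrow> Wdef \<sigma>s \<tau>s g"
  by (auto simp: Wdef_def)

lemma Wdef_comp:
  assumes "Wdef \<sigma>s \<tau>s f" and "Wdef \<tau>s \<rho>s g"
  shows "Wdef \<sigma>s \<rho>s (\<lambda>xs. g (f xs))"
proof -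
  obtain ts where ts: "list_all2 (wtyped \<sigma>s) ts \<tau>s"
     "\<And>xs. length xs = length \<sigma>s \<Longrightarrow> f xs = map (tsubst (inst xs)) ts"
    using assms(1) by (auto simp: Wdef_def)
  obtain us where us: "list_all2 (wtyped \<tau>s) us \<rho>s"
     "\<And>xs. length xs = length \<tau>s \<Longrightarrow> g xs = map (tsubst (inst xs)) us"
    using assms(2) by (auto simp: Wdef_def)
  have "list_all2 (wtyped \<sigma>s) (g ts) \<rho>s"
    using us(1) wtyped_subst[OF _ ts(1)] list_all2_lengthD[OF ts(1)]
    by (auto simp: us(2) list_all2_conv_all_nth)
  moreover have "g (f xs) = map (tsubst (inst xs)) (g ts)" if "length xs = length \<sigma>s" for xs
    using Wdef_subst[OF assms(2)] list_all2_lengthD[OF ts(1)] ts(2)[OF that] by simp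
  ultimately show ?thesis by (auto simp: Wdef_def)
qed

lemma Wdef_append:
  assumes "Wdef \<sigma>s \<tau>s f" and "Wdef \<sigma>s \<rho>s g"
  shows "Wdef \<sigma>s (\<tau>s @ \<rho>s) (\<lambda>xs. f xs @ g xs)"
proof -
  obtain ts us where "list_all2 (wtyped \<sigma>s) ts \<tau>s" "list_all2 (wtyped \<sigma>s) us \<rho>s"
    "\<And>xs. length xs = length \<sigma>s \<Longrightarrow> f xs = map (tsubst (inst xs)) ts"
    "\<And>xs. length xs = length \<sigma>s \<Longrightarrow> g xs = map (tsubst (inst xs)) us"
    using assms by (auto simp: Wdef_def)
  then show ?thesis unfolding Wdef_def
    by (intro exI[of _ "ts @ us"]) (auto intro: list_all2_appendI)
qed

lemma Wdef_slice:
  assumes "m + length \<tau>s \<le> length \<sigma>s" and "\<And>i. i < length \<tau>s \<Longrightarrow> \<sigma>s ! (m + i) = \<tau>s ! i"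
  shows "Wdef \<sigma>s \<tau>s (\<lambda>xs. take (length \<tau>s) (drop m xs))"
  unfolding Wdef_def
proof (intro exI conjI allI impI)
  show "list_all2 (wtyped \<sigma>s) (map Var [m..<m + length \<tau>s]) \<tau>s"
    using assms(1) by (auto simp: list_all2_conv_all_nth assms(2)[symmetric] intro: wVar)
  fix xs :: "'c tm list" assume "length xs = length \<sigma>s"
  then show "take (length \<tau>s) (drop m xs) = map (tsubst (inst xs)) (map Var [m..<m + length \<tau>s])"
    using assms(1) by (intro nth_equalityI) (auto simp: inst_def)
qed

lemma Wdef_take: "Wdef (\<sigma>s @ \<tau>s) \<sigma>s (take (length \<sigma>s))"
  using Wdef_slice[of 0 \<sigma>s "\<sigma>s @ \<tau>s"] by (simp add: nth_append)

lemma Wdef_drop: "Wdef (\<sigma>s @ \<tau>s) \<tau>s (drop (length \<sigma>s))"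
  by (rule Wdef_cong[OF Wdef_slice[of "length \<sigma>s"]]) (auto simp: nth_append)

lemma Wdef_id: "Wdef \<sigma>s \<sigma>s (\<lambda>xs. xs)"
  by (rule Wdef_cong[OF Wdef_take[of _ "[]", simplified]]) auto

lemma Wdef_const:
  assumes "length cs = length \<tau>s" and "\<And>c. c \<in> set cs \<Longrightarrow> tfv c = {} \<and> wft c" and "\<And>F. F \<in> WS \<tau>s cs \<Longrightarrow> der {} F"
  shows "Wdef \<sigma>s \<tau>s (\<lambda>_. cs)"
proof -
  have "list_all2 (wtyped \<sigma>s) cs \<tau>s" using assms
    by (induction rule: list_induct2) (auto intro: wConst)
  moreover have "cs = map (tsubst \<theta>) cs" for \<theta>
    using assms(2) by (auto simp: tsubst_closed intro: map_idI[symmetric])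
  ultimately show ?thesis by (auto simp: Wdef_def)
qed

lemma wtyped_foldl: "list_all2 (wtyped \<Gamma>) ss \<tau>s \<Longrightarrow> wtyped \<Gamma> f (arrs \<tau>s \<rho>) \<Longrightarrow> wtyped \<Gamma> (foldl App f ss) \<rho>"
  by (induction arbitrary: f rule: list_all2_induct) (auto intro: wApp)

lemma Wdef_tapp:
  assumes "Wdef \<sigma>s (tarrs \<tau>s \<rho>s) F" and "Wdef \<sigma>s \<tau>s G"
  shows "Wdef \<sigma>s \<rho>s (\<lambda>xs. tapp (F xs) (G xs))"
proof -
  obtain ts where ts: "list_all2 (wtyped \<sigma>s) ts (tarrs \<tau>s \<rho>s)"
     "\<And>xs. length xs = length \<sigma>s \<Longrightarrow> F xs = map (tsubst (inst xs)) ts"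
    using assms(1) by (auto simp: Wdef_def)
  obtain us where us: "list_all2 (wtyped \<sigma>s) us \<tau>s"
     "\<And>xs. length xs = length \<sigma>s \<Longrightarrow> G xs = map (tsubst (inst xs)) us"
    using assms(2) by (auto simp: Wdef_def)
  have "list_all2 (wtyped \<sigma>s) (tapp ts us) \<rho>s"
    using ts(1) wtyped_foldl[OF us(1)] by (auto simp: tapp_def tarrs_def list_all2_conv_all_nth)
  then show ?thesis using ts(2) us(2) unfolding Wdef_def by (intro exI[of _ "tapp ts us"]) auto
qed

text \<open>Currying by bracket abstraction in each component. This is the place where exact
  equations give way to provable ones.\<close>

lemma Wdef_abs:
  assumes "Wdef (\<sigma>s @ \<tau>s) \<rho>s f"
  shows "\<exists>F. Wdef \<sigma>s (tarrs \<tau>s \<rho>s) F \<and>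
    (\<forall>xs \<in> tup \<sigma>s. \<forall>ys \<in> tup \<tau>s. list_all2 peq (tapp (F xs) ys) (f (xs @ ys)))"
proof -
  obtain ts where ts: "list_all2 (wtyped (\<sigma>s @ \<tau>s)) ts \<rho>s"
     "\<And>xs. length xs = length \<sigma>s + length \<tau>s \<Longrightarrow> f xs = map (tsubst (inst xs)) ts"
    using assms by (auto simp: Wdef_def)
  have "\<exists>us. list_all2 (wtyped \<sigma>s) us (tarrs \<tau>s \<rho>s) \<and>
     (\<forall>xs \<in> tup \<sigma>s. \<forall>ys \<in> tup \<tau>s. list_all2 peq (tapp (map (tsubst (inst xs)) us) ys) (map (tsubst (inst (xs @ ys))) ts))"
    using ts(1)
  proof (induction rule: list_all2_induct)
    case Nil
    then show ?case by (auto simp: tapp_def tarrs_def)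
  next
    case (Cons t ts \<rho> \<rho>s)
    then obtain us where "list_all2 (wtyped \<sigma>s) us (tarrs \<tau>s \<rho>s) \<and>
     (\<forall>xs \<in> tup \<sigma>s. \<forall>ys \<in> tup \<tau>s. list_all2 peq (tapp (map (tsubst (inst xs)) us) ys) (map (tsubst (inst (xs @ ys))) ts))" by blast
    moreover obtain u where "wtyped \<sigma>s u (arrs \<tau>s \<rho>) \<and>
      (\<forall>xs \<in> tup \<sigma>s. \<forall>ys \<in> tup \<tau>s. peq (foldl App (tsubst (inst xs) u) ys) (tsubst (inst (xs @ ys)) t))"
      using wtyped_abs[OF Cons(1)] by blast
    ultimately show ?case by (intro exI[of _ "u # us"]) (auto simp: tapp_def tarrs_def)
  qed
  then obtain us where us: "list_all2 (wtyped \<sigma>s) us (tarrs \<tau>s \<rho>s)"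
     "\<forall>xs \<in> tup \<sigma>s. \<forall>ys \<in> tup \<tau>s. list_all2 peq (tapp (map (tsubst (inst xs)) us) ys) (map (tsubst (inst (xs @ ys))) ts)"
    by blast
  show ?thesis
    by (rule exI[of _ "\<lambda>xs. map (tsubst (inst xs)) us"]) (use us ts(2) in \<open>auto simp: Wdef_def tms_def\<close>)
qed

text \<open>At a function type, \<open>CK\<close> applied to an inhabitant of the result type is a
  constant function.\<close>

lemma W_inhabitant: "\<exists>c. tfv c = {} \<and> wft c \<and> der {} (Wf \<tau> c)"
proof (induction \<tau>)
  case (Fn \<sigma> \<tau>)
  then obtain c where c: "tfv c = {}" "wft c" "der {} (Wf \<tau> c)" by blast
  have "der {} (Wf (Fn \<sigma> \<tau>) (App (Cst CK) c))"
    by (rule der_cut[OF W_App[of c "Cst CK" \<tau> "Fn \<sigma> \<tau>"]]) (use c W_K in auto)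
  then show ?case using c by (intro exI[of _ "App (Cst CK) c"]) auto
qed (use W_inh iprov_der[of "[]"] in \<open>fastforce simp: W_inhabited_def ctms_def tms_def iWc_def\<close>)+

lemma Wdef_inhabitant: "\<exists>cs. \<forall>\<sigma>s. Wdef \<sigma>s \<tau>s (\<lambda>_. cs)"
proof -
  obtain c where c: "\<And>\<tau>. tfv (c \<tau>) = {} \<and> wft (c \<tau>) \<and> der {} (Wf \<tau> (c \<tau>))"
    using W_inhabitant by metis
  have "der {} F" if "F \<in> WS \<tau>s (map c \<tau>s)" for F
    using that c by (auto simp: iWs_def zip_map2 zip_same_conv_map)
  then have "Wdef \<sigma>s \<tau>s (\<lambda>_. map c \<tau>s)" for \<sigma>s using c by (intro Wdef_const) auto
  then show ?thesis by blast
qed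

end

lemma tpos_asubst [simp]: "tpos q (asubst \<sigma> A) = tpos q A"
  and tneg_asubst [simp]: "tneg q (asubst \<sigma> A) = tneg q A"
  by (induction A arbitrary: \<sigma>) auto

lemma scomp_up_shift_scomp [simp]: "scomp (up n \<sigma>) (scomp (shift n) \<tau>) = scomp (shift n) (scomp \<sigma> \<tau>)"
  by (simp add: scomp_assoc)

text \<open>Like \<open>inst\<close>, except that the remaining variables are sent to an environment
  \<open>e\<close> instead of being lowered. One substitution then specialises both the auxiliary
  variables and the free variables of a formula.\<close>

definition ext :: "'c tm list \<Rightarrow> (nat \<Rightarrow> 'c tm) \<Rightarrow> nat \<Rightarrow> 'c tm" where
  "ext ts e i = (if i < length ts then ts ! i else e (i - length ts))"

lemma ext_Var: "ext ts Var = inst ts"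
  by (auto simp: ext_def inst_def)

lemma scomp_ext_shift [simp]: "length ts = n \<Longrightarrow> scomp (ext ts e) (shift n) = e"
  by (auto simp: scomp_def ext_def shift_def)

lemma twf_ext: "\<forall>t \<in> set ts. twf L t \<Longrightarrow> (\<And>i. twf L (e i)) \<Longrightarrow> twf L (ext ts e i)"
  by (auto simp: ext_def)

lemma map_ext_vars [simp]: "m \<le> n \<Longrightarrow> n \<le> length ts \<Longrightarrow> map (ext ts e) [m..<n] = drop m (take n ts)"
  by (rule nth_equalityI) (auto simp: ext_def)

lemma vars_add: "vars (m + n) = vars m @ map Var [m..<m + n]"
  by (metis map_append upt_add_eq_append zero_le)

lemma map_up_vars [simp]: "map (up n \<sigma>) [0..<n] = vars n"
  by (rule nth_equalityI) (auto simp: up_def)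

context circ_interp begin

subsection \<open>The interpretation with exponentials forgotten\<close>

abbreviation gp :: "('c, 'p, ('c, 'p) afm) params" where "gp \<equiv> girard_params p"
abbreviation sgt :: "('c, 'p) athy" where "sgt \<equiv> girard_thy Is"

lemma gp_simps [simp]:
  "comp gp = comp p" "wty gp = wty p" "wat gp P = girard (wat p P)" "hat gp = hat p"
  "bq gp \<tau>s as A = girard (bq p \<tau>s as (forget A))"
  by (auto simp: girard_params_def)

definition J :: "('c, 'p) afm \<Rightarrow> 'c tm list \<Rightarrow> 'c tm list \<Rightarrow> ('c, 'p) ifm" where
  "J A xs ys = forget (interp gp A xs ys)"

lemma J_simps [simp]:
  "J ABot xs ys = IBot"
  "J (AAtom P ts) xs ys = (if P \<in> comp p then isubst (inst (ts @ xs)) (wat p P) else IAtom P ts)"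
  "J (Tensor A B) xs ys = And (J A (take (length (tpos gp A)) xs) (take (length (tneg gp A)) ys))
     (J B (drop (length (tpos gp A)) xs) (drop (length (tneg gp A)) ys))"
  "J (AAll A) xs ys = IAll (J A (sh 1 xs) (sh 1 ys))"
  "J (AEx A) xs ys = IEx (J A (sh 1 xs) (sh 1 ys))"
  "J (Bang A) xs as = bq p (tneg gp A) as
     (J (asubst (shift (length (tneg gp A))) A) (sh (length (tneg gp A)) xs) (vars (length (tneg gp A))))"
  by (auto simp: J_def Let_def)

lemma J_Lolli: "length fs = length (tpos gp B) \<Longrightarrow> length xs = length (tpos gp A) \<Longrightarrow>
  J (Lolli A B) (fs @ gs) (xs @ ws) = Imp (J A xs (tapp gs (xs @ ws))) (J B (tapp fs xs) ws)"
  by (simp add: J_def Let_def)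

lemma sub_st: "sublang (ilang Is) (ilang It)"
  using A2 by (simp add: A2_def)

lemma wat_params: "P \<in> comp p \<Longrightarrow> wff (wat p P)" "P \<in> comp p \<Longrightarrow> ifv (wat p P) \<subseteq> {..arity P}"
  using params by (auto simp: il_params_def)

lemma wff_bq: "as \<in> tup (hat p \<tau>s) \<Longrightarrow> wff A \<Longrightarrow> wff (bq p \<tau>s as A)"
  using params by (simp add: il_params_def)

lemma isubst_bq: "as \<in> tup (hat p \<tau>s) \<Longrightarrow> wff A \<Longrightarrow> (\<And>i. wft (\<sigma> i)) \<Longrightarrow>
    isubst \<sigma> (bq p \<tau>s as A) = bq p \<tau>s (map (tsubst \<sigma>) as) (isubst (up (length \<tau>s) \<sigma>) A)"
  using params by (simp add: il_params_def)

lemma tms_splitE: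
  assumes "xs \<in> tms L (m + n)"
  obtains ys zs where "xs = ys @ zs" "ys \<in> tms L m" "zs \<in> tms L n"
  using tms_take[OF assms] tms_drop[OF assms] append_take_drop_id[of m xs] by metis

lemma tapp_tms: "fs \<in> TM m \<Longrightarrow> xs \<in> TM n \<Longrightarrow> tapp fs xs \<in> TM m"
proof -
  have "wft (foldl App f xs)" if "wft f" "\<forall>x \<in> set xs. wft x" for f xs
    using that by (induction xs arbitrary: f) auto
  then show "fs \<in> TM m \<Longrightarrow> xs \<in> TM n \<Longrightarrow> tapp fs xs \<in> TM m" by (auto simp: tms_def tapp_def)
qed

text \<open>The substitution belongs to the statement because the clause for \<open>Bang\<close>
  interprets a shifted copy of the formula: the induction runs over \<open>A\<close>, with \<sigma>
  general.\<close>

lemma wff_J: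
  assumes "awf (ilang It) A" and "\<And>i. wft (\<sigma> i)"
    and "xs \<in> tup (tpos gp A)" and "ys \<in> tup (tneg gp A)"
  shows "wff (J (asubst \<sigma> A) xs ys)"
  using assms
proof (induction A arbitrary: \<sigma> xs ys)
  case (AAtom P ts)
  have "\<forall>t \<in> set (map (tsubst \<sigma>) ts @ xs). wft t" using AAtom by (auto simp: twf_tsubst_iff tms_def)
  then show ?case using AAtom wat_params(1)[of P] by (auto simp: iwf_isubst_iff twf_tsubst_iff)
next
  case (Tensor A B)
  then show ?case by (auto intro!: Tensor.IH intro: tms_take tms_drop)
next
  case (Lolli A B)
  obtain fs gs where f: "xs = fs @ gs" "fs \<in> tup (tpos gp B)" "gs \<in> tup (tneg gp A)"
    using Lolli.prems(3) by (auto elim: tms_splitE)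
  obtain zs ws where z: "ys = zs @ ws" "zs \<in> tup (tpos gp A)" "ws \<in> tup (tneg gp B)"
    using Lolli.prems(4) by (auto elim: tms_splitE)
  have "wff (Imp (J (asubst \<sigma> A) zs (tapp gs (zs @ ws))) (J (asubst \<sigma> B) (tapp fs zs) ws))"
    using Lolli f z tapp_tms tms_appendI[OF z(2,3)] by auto
  then show ?case using f z by (auto simp: J_Lolli tms_length)
next
  case (AAll A)
  then show ?case by (auto intro!: AAll.IH tms_shift twf_up)
next
  case (AEx A)
  then show ?case by (auto intro!: AEx.IH tms_shift twf_up)
next
  case (Bang A)
  have "wff (J (asubst (scomp (shift (length (tneg gp A))) \<sigma>) A) (sh (length (tneg gp A)) xs) (vars (length (tneg gp A))))"
    using Bang.prems tms_vars[of 0 "length (tneg gp A)"] by (intro Bang.IH tms_shift twf_scomp) auto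
  then show ?case using Bang.prems by (auto intro!: wff_bq)
qed auto

text \<open>As in \<open>wff_J\<close>, \<sigma> absorbs the shifts. In the exponential case, the
  requirement in \<open>il_params\<close> that bounded quantification be schematic moves
  \<open>e\<close> below the quantifier.\<close>

lemma isubst_J:
  assumes "awf (ilang It) A" and "\<And>i. wft (\<sigma> i)" and "\<And>i. wft (e i)"
    and "xs \<in> tup (tpos gp A)" and "ys \<in> tup (tneg gp A)"
  shows "isubst e (J (asubst \<sigma> A) xs ys) = J (asubst (scomp e \<sigma>) A) (map (tsubst e) xs) (map (tsubst e) ys)"
  using assms
proof (induction A arbitrary: \<sigma> e xs ys)
  case (AAtom P ts)
  show ?case
  proof (cases "P \<in> comp p")
    case True
    have "isubst (scomp e (inst (map (tsubst \<sigma>) ts @ xs))) (wat p P) = isubst (inst (map (tsubst (scomp e \<sigma>)) ts @ map (tsubst e) xs)) (wat p P)"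
    proof (rule isubst_cong)
      fix i assume "i \<in> ifv (wat p P)"
      then have "i < length (map (tsubst \<sigma>) ts @ xs)"
        using wat_params(2)[OF True] True AAtom.prems by (auto simp: tms_def)
      then show "scomp e (inst (map (tsubst \<sigma>) ts @ xs)) i = inst (map (tsubst (scomp e \<sigma>)) ts @ map (tsubst e) xs) i"
        by (simp add: scomp_def[of _ "inst _"] nth_append)
    qed
    then show ?thesis using True by simp
  qed simp
next
  case (Tensor A B)
  have "isubst e (J (asubst \<sigma> A) (take (length (tpos gp A)) xs) (take (length (tneg gp A)) ys)) =
     J (asubst (scomp e \<sigma>) A) (map (tsubst e) (take (length (tpos gp A)) xs)) (map (tsubst e) (take (length (tneg gp A)) ys))"
    by (rule Tensor.IH) (use Tensor.prems in \<open>auto intro: tms_take\<close>)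
  moreover have "isubst e (J (asubst \<sigma> B) (drop (length (tpos gp A)) xs) (drop (length (tneg gp A)) ys)) =
     J (asubst (scomp e \<sigma>) B) (map (tsubst e) (drop (length (tpos gp A)) xs)) (map (tsubst e) (drop (length (tneg gp A)) ys))"
    by (rule Tensor.IH) (use Tensor.prems in \<open>auto intro: tms_drop\<close>)
  ultimately show ?case by (simp add: take_map drop_map)
next
  case (Lolli A B)
  obtain fs gs where f: "xs = fs @ gs" "fs \<in> tup (tpos gp B)" "gs \<in> tup (tneg gp A)"
    using Lolli.prems(4) by (auto elim: tms_splitE)
  obtain zs ws where z: "ys = zs @ ws" "zs \<in> tup (tpos gp A)" "ws \<in> tup (tneg gp B)"
    using Lolli.prems(5) by (auto elim: tms_splitE)
  have "isubst e (J (asubst \<sigma> A) zs (tapp gs (zs @ ws))) = J (asubst (scomp e \<sigma>) A) (map (tsubst e) zs) (map (tsubst e) (tapp gs (zs @ ws)))"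
    by (rule Lolli.IH) (use Lolli.prems f z tapp_tms[OF f(3) tms_appendI[OF z(2,3)]] in auto)
  moreover have "isubst e (J (asubst \<sigma> B) (tapp fs zs) ws) = J (asubst (scomp e \<sigma>) B) (map (tsubst e) (tapp fs zs)) (map (tsubst e) ws)"
    by (rule Lolli.IH) (use Lolli.prems f z tapp_tms[OF f(2) z(2)] in auto)
  ultimately show ?case using f z by (simp add: J_Lolli tms_length)
next
  case (AAll A)
  have "isubst (up 1 e) (J (asubst (up 1 \<sigma>) A) (sh 1 xs) (sh 1 ys)) =
    J (asubst (scomp (up 1 e) (up 1 \<sigma>)) A) (map (tsubst (up 1 e)) (sh 1 xs)) (map (tsubst (up 1 e)) (sh 1 ys))"
    by (rule AAll.IH) (use AAll.prems in \<open>auto intro!: tms_shift twf_up\<close>)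
  then show ?case using scomp_up_shift[of 1 e] by (simp add: scomp_up_up)
next
  case (AEx A)
  have "isubst (up 1 e) (J (asubst (up 1 \<sigma>) A) (sh 1 xs) (sh 1 ys)) =
    J (asubst (scomp (up 1 e) (up 1 \<sigma>)) A) (map (tsubst (up 1 e)) (sh 1 xs)) (map (tsubst (up 1 e)) (sh 1 ys))"
    by (rule AEx.IH) (use AEx.prems in \<open>auto intro!: tms_shift twf_up\<close>)
  then show ?case using scomp_up_shift[of 1 e] by (simp add: scomp_up_up)
next
  case (Bang A)
  let ?n = "length (tneg gp A)"
  have v: "vars ?n \<in> TM ?n" using tms_vars[of 0 ?n] by simp
  have "isubst (up ?n e) (J (asubst (scomp (shift ?n) \<sigma>) A) (sh ?n xs) (vars ?n)) =
     J (asubst (scomp (up ?n e) (scomp (shift ?n) \<sigma>)) A) (map (tsubst (up ?n e)) (sh ?n xs)) (map (tsubst (up ?n e)) (vars ?n))"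
    by (rule Bang.IH) (use Bang.prems v in \<open>auto intro!: tms_shift twf_up twf_scomp\<close>)
  moreover have "wff (J (asubst (scomp (shift ?n) \<sigma>) A) (sh ?n xs) (vars ?n))"
    using Bang.prems v by (intro wff_J tms_shift twf_scomp) auto
  ultimately show ?case using Bang.prems by (simp add: isubst_bq)
qed auto

subsection \<open>The bounded quantifier\<close>

abbreviation fms :: "('c, 'p) afm set" where "fms \<equiv> interp_fms sgt gt gp"

lemma interp_fmsI:
  "awf (ilang Is) A \<Longrightarrow> xs \<in> tup (tpos gp A) \<Longrightarrow> ys \<in> tup (tneg gp A) \<Longrightarrow> interp gp A xs ys \<in> fms"
  by (auto simp: interp_fms_def)

lemma Wdef_Wterms:
  assumes "ts \<in> Wterms gt gp (tarrs \<sigma>s \<tau>s)"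
  shows "Wdef \<sigma>s \<tau>s (tapp ts)"
proof -
  have t: "ts \<in> ctms (ilang It) (length \<tau>s)" "aprov gt [] (aWc gp (tarrs \<sigma>s \<tau>s) ts)"
    using assms by (auto simp: Wterms_def)
  have "Wdef \<sigma>s (tarrs \<sigma>s \<tau>s) (\<lambda>_. ts)"
    by (rule Wdef_const) (use t der_aWc in \<open>auto simp: ctms_def tms_def\<close>)
  from Wdef_tapp[OF this Wdef_id] show ?thesis .
qed

lemma forget_Bang_aWs: "map forget (map Bang (aWs gp \<tau>s ts)) = iWs p \<tau>s ts"
  using forget_aWs by (simp add: o_def)

text \<open>
  The closed terms provided by \<open>A5\<close> depend on the formula. Applied to the formula
  \<open>|A|\<close> with variables as superscript, they serve for all superscripts and all instances of \<open>A\<close>.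
\<close>

definition generic :: "('c, 'p) afm \<Rightarrow> nat \<Rightarrow> ('c, 'p) afm" where
  "generic A j = interp gp (asubst (shift (length (tneg gp A))) (asubst (shift (j + length (tpos gp A))) A))
     (sh (length (tneg gp A)) (map Var [j..<j + length (tpos gp A)])) (vars (length (tneg gp A)))"

lemma generic_fms: "awf (ilang Is) A \<Longrightarrow> generic A j \<in> fms"
  unfolding generic_def
  using tms_vars[of 0 "length (tneg gp A)"] tms_vars[of j "j + length (tpos gp A)"]
  by (intro interp_fmsI tms_shift) (auto simp: awf_asubst_iff twf_scomp)

lemma bq_generic: "bq p (tneg gp A) as (forget (generic A j)) =
    J (Bang (asubst (shift (j + length (tpos gp A))) A)) (map Var [j..<j + length (tpos gp A)]) as"
  by (simp add: generic_def J_def Let_def)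

lemma isubst_generic:
  assumes "awf (ilang Is) A" and "ts \<in> TM (j + length (tpos gp A))" and "\<And>i. wft (e i)"
    and "as \<in> tup (hat p (tneg gp A))"
  shows "isubst (ext ts e) (J (Bang (asubst (shift (j + length (tpos gp A))) A)) (map Var [j..<j + length (tpos gp A)]) as)
    = J (Bang (asubst e A)) (drop j ts) (map (tsubst (ext ts e)) as)"
proof -
  let ?k = "length (tpos gp A)"
  have w: "awf (ilang It) A" using assms(1) sub_st sublang_awf by blast
  have e: "wft (ext ts e i)" for i using assms(2,3) by (intro twf_ext) (auto simp: tms_def)
  have "isubst (ext ts e) (J (asubst (shift (j + ?k)) (Bang A)) (map Var [j..<j + ?k]) as)
    = J (asubst (scomp (ext ts e) (shift (j + ?k))) (Bang A)) (map (tsubst (ext ts e)) (map Var [j..<j + ?k])) (map (tsubst (ext ts e)) as)"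
    by (rule isubst_J) (use w e assms(4) tms_vars[of j "j + ?k"] in auto)
  then show ?thesis using assms(2) by (simp add: tms_length del: J_simps)
qed

text \<open>A single substitution specialises all variables: the first \<open>j\<close> become the
  arguments of the witnessing function, the following ones the superscript, and the rest the
  environment.\<close>

lemma generic_inst:
  assumes A: "awf (ilang Is) A" and h: "Wdef \<sigma>s (hat p (tneg gp A)) h" and j: "j = length \<sigma>s"
    and der: "der (WS \<sigma>s (vars j) \<union> {bq p (tneg gp A) (h (vars j)) (forget (generic A j))}) G"
    and ts: "ts \<in> tup \<sigma>s" and xs: "xs \<in> tup (tpos gp A)" and env: "\<And>i. wft (e i)"
  shows "der (WS \<sigma>s ts \<union> {J (Bang (asubst e A)) xs (h ts)}) (isubst (ext (ts @ xs) e) G)"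
proof -
  let ?e = "ext (ts @ xs) e"
  have tx: "ts @ xs \<in> TM (j + length (tpos gp A))" unfolding j using ts xs by (rule tms_appendI)
  have e: "wft (?e i)" for i using tx env by (intro twf_ext) (auto simp: tms_def)
  have v: "map (tsubst ?e) (vars j) = ts" using tms_length[OF ts] j by simp
  have "map (tsubst ?e) (h (vars j)) = h ts" using Wdef_subst[OF h, of "vars j" ?e] j unfolding v by simp
  then have "isubst ?e (bq p (tneg gp A) (h (vars j)) (forget (generic A j))) = J (Bang (asubst e A)) xs (h ts)"
    unfolding bq_generic using isubst_generic[OF A tx env Wdef_tms[OF h]] tms_length[OF ts] j by (simp del: J_simps)
  then show ?thesis using der_subst[OF der, of ?e, OF e] unfolding image_Un isubst_WS v by simp
qed

text \<open>The order of quantifiers matters: by way of \<open>generic\<close>, the closed tuple is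
  fixed before the environment, the superscript and the arguments. It is the same in
  \<open>sqcup\<close> and \<open>circ\<close>.\<close>

lemma eta:
  assumes "awf (ilang Is) A"
  shows "\<exists>E. Wdef (tneg gp A) (hat p (tneg gp A)) E \<and>
    (\<forall>e xs zs. (\<forall>i. wft (e i)) \<longrightarrow> xs \<in> tup (tpos gp A) \<longrightarrow> zs \<in> tup (tneg gp A) \<longrightarrow>
      der (WS (tneg gp A) zs \<union> {J (Bang (asubst e A)) xs (E zs)}) (J (asubst e A) xs zs))"
proof -
  let ?n = "length (tneg gp A)" and ?k = "length (tpos gp A)" and ?\<tau> = "tneg gp A"
  let ?vx = "map Var [?n..<?n + ?k]"
  obtain \<eta> where \<eta>: "\<eta> \<in> Wterms gt gp (tarrs ?\<tau> (hat p ?\<tau>))" "C_eta gt gp ?\<tau> (generic A ?n) \<eta>"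
    using A5 generic_fms[OF assms, of ?n] unfolding A5_def gp_simps by blast
  have w: "awf (ilang It) A" using assms sub_st sublang_awf by blast
  note W = Wdef_Wterms[OF \<eta>(1)]
  have "aprov gt (map Bang (aWs gp ?\<tau> (vars ?n)) @ [Bang (bq gp ?\<tau> (tapp \<eta> (vars ?n)) (generic A ?n))])
      (asubst (inst (vars ?n)) (generic A ?n))"
    using \<eta>(2) by (simp add: C_eta_def)
  from iprov_der[OF forget_sound[OF this]]
  have 1: "der (WS ?\<tau> (vars ?n) \<union> {bq p ?\<tau> (tapp \<eta> (vars ?n)) (forget (generic A ?n))}) (isubst (inst (vars ?n)) (forget (generic A ?n)))"
    unfolding map_append forget_Bang_aWs by simp
  have G: "isubst (inst (vars ?n)) (forget (generic A ?n)) = J (asubst (shift (?n + ?k)) A) ?vx (vars ?n)"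
    unfolding generic_def J_def[symmetric] asubst_asubst
    by (subst isubst_J) (use w in \<open>auto intro!: twf_scomp tms_shift tms_inst simp: scomp_assoc\<close>)
  have "der (WS ?\<tau> zs \<union> {J (Bang (asubst e A)) xs (tapp \<eta> zs)}) (J (asubst e A) xs zs)"
    if env: "\<And>i. wft (e i)" and xs: "xs \<in> TM ?k" and zs: "zs \<in> TM ?n" for e xs zs
  proof -
    let ?e = "ext (zs @ xs) e"
    have e: "wft (?e i)" for i using xs zs env by (intro twf_ext) (auto simp: tms_def)
    have "isubst ?e (J (asubst (shift (?n + ?k)) A) ?vx (vars ?n)) = J (asubst e A) xs zs"
      using isubst_J[OF w _ e tms_vars_simps(1)[of ?n] tms_vars_simps(2), of "shift (?n + ?k)"] tms_length[OF xs] tms_length[OF zs] by simp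
    then show ?thesis using generic_inst[OF assms W refl 1 zs xs, of e, OF env] unfolding G by simp
  qed
  then show ?thesis using W by blast
qed

lemma sqcup:
  assumes "awf (ilang Is) A"
  shows "\<exists>U. Wdef (hat p (tneg gp A) @ hat p (tneg gp A)) (hat p (tneg gp A)) U \<and>
    (\<forall>e xs y1 y2. (\<forall>i. wft (e i)) \<longrightarrow> xs \<in> tup (tpos gp A) \<longrightarrow>
      y1 \<in> tup (hat p (tneg gp A)) \<longrightarrow> y2 \<in> tup (hat p (tneg gp A)) \<longrightarrow>
      der (WS (hat p (tneg gp A)) y1 \<union> WS (hat p (tneg gp A)) y2 \<union> {J (Bang (asubst e A)) xs (U (y1 @ y2))})
        (And (J (Bang (asubst e A)) xs y1) (J (Bang (asubst e A)) xs y2)))"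
proof -
  let ?\<tau> = "tneg gp A" let ?h = "hat p ?\<tau>"
  let ?k = "length (tpos gp A)" and ?m = "length ?h"
  \<comment> \<open>Room for the two bounds that are to be merged.\<close>
  let ?j = "?m + ?m"
  let ?v1 = "vars ?m" and ?v2 = "map Var [?m..<?m + ?m] :: 'c tm list"
  let ?F = "\<lambda>as. bq p ?\<tau> as (forget (generic A ?j))"
  obtain u where u: "u \<in> Wterms gt gp (tarrs ?h (tarrs ?h ?h))" "C_sqcup gt gp ?\<tau> (generic A ?j) u"
    using A5 generic_fms[OF assms, of ?j] unfolding A5_def gp_simps by blast
  note W = Wdef_Wterms[OF u(1)[unfolded tarrs_tarrs]]
  have "aprov gt (map Bang (aWs gp (hat p ?\<tau>) ?v1 @ aWs gp (hat p ?\<tau>) ?v2) @ [Bang (bq gp ?\<tau> (tapp u (?v1 @ ?v2)) (generic A ?j))])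
      (Tensor (bq gp ?\<tau> ?v1 (generic A ?j)) (bq gp ?\<tau> ?v2 (generic A ?j)))"
    using u(2) unfolding C_sqcup_def by simp
  from iprov_der[OF forget_sound[OF this]]
  have 1: "der (WS (?h @ ?h) (vars ?j) \<union> {?F (tapp u (vars ?j))}) (And (?F ?v1) (?F ?v2))"
    unfolding map_append forget_Bang_aWs vars_add by (simp add: WS_append)
  have "der (WS ?h y1 \<union> WS ?h y2 \<union> {J (Bang (asubst e A)) xs (tapp u (y1 @ y2))})
      (And (J (Bang (asubst e A)) xs y1) (J (Bang (asubst e A)) xs y2))"
    if env: "\<And>i. wft (e i)" and xs: "xs \<in> TM ?k" and y: "y1 \<in> TM ?m" "y2 \<in> TM ?m" for e xs y1 y2
  proof -
    let ?e = "ext ((y1 @ y2) @ xs) e"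
    have yy: "y1 @ y2 \<in> tup (?h @ ?h)" unfolding length_append using y by (rule tms_appendI)
    have t: "(y1 @ y2) @ xs \<in> TM (?j + ?k)" using tms_appendI[OF yy xs] by simp
    note l = tms_length[OF xs] tms_length[OF y(1)] tms_length[OF y(2)]
    have s: "map (tsubst ?e) ?v1 = y1" "map (tsubst ?e) ?v2 = y2" using l by simp_all
    have f: "isubst ?e (?F as) = J (Bang (asubst e A)) xs (map (tsubst ?e) as)" if "as \<in> TM ?m" for as
      unfolding bq_generic using isubst_generic[OF assms t env that] l by (simp del: J_simps)
    have "isubst ?e (And (?F ?v1) (?F ?v2)) = And (J (Bang (asubst e A)) xs y1) (J (Bang (asubst e A)) xs y2)"
      by (simp only: isubst.simps f tms_vars_simps s)
    then show ?thesis using generic_inst[OF assms W _ 1 yy xs, of e, OF _ env] l by (simp add: WS_append del: J_simps)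
  qed
  then show ?thesis using W by blast
qed

lemma circ:
  assumes "awf (ilang Is) A"
  shows "\<exists>C. Wdef (tarrs \<rho>s (hat p (tneg gp A)) @ hat p \<rho>s) (hat p (tneg gp A)) C \<and>
    (\<forall>e xs fs zs. (\<forall>i. wft (e i)) \<longrightarrow> xs \<in> tup (tpos gp A) \<longrightarrow>
      fs \<in> tup (hat p (tneg gp A)) \<longrightarrow> zs \<in> tup (hat p \<rho>s) \<longrightarrow>
      der (WS (tarrs \<rho>s (hat p (tneg gp A))) fs \<union> WS (hat p \<rho>s) zs \<union> {J (Bang (asubst e A)) xs (C (fs @ zs))})
        (bq p \<rho>s zs (J (Bang (asubst (scomp (shift (length \<rho>s)) e) A)) (sh (length \<rho>s) xs)
           (tapp (sh (length \<rho>s) fs) (vars (length \<rho>s))))))"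
proof -
  let ?\<tau> = "tneg gp A" let ?h = "hat p ?\<tau>" and ?h' = "hat p \<rho>s"
  let ?n = "length ?\<tau>" and ?k = "length (tpos gp A)" and ?m = "length ?h" and ?m' = "length ?h'" and ?r = "length \<rho>s"
  let ?j = "?m + ?m'"
  let ?v1 = "vars ?m" and ?v2 = "map Var [?m..<?m + ?m'] :: 'c tm list" and ?vx = "map Var [?j..<?j + ?k] :: 'c tm list"
  let ?sh = "sh ?r"
  let ?G = "J (asubst (scomp (shift ?r) (shift (?j + ?k))) (Bang A)) (?sh ?vx) (tapp (?sh ?v1) (vars ?r))"
  have w: "awf (ilang It) A" using assms sub_st sublang_awf by blast
  obtain c where c: "c \<in> Wterms gt gp (tarrs (tarrs \<rho>s ?h) (tarrs ?h' ?h))" "C_circ gt gp \<rho>s ?\<tau> (generic A ?j) c"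
    using A5 generic_fms[OF assms, of ?j] unfolding A5_def gp_simps by blast
  note W = Wdef_Wterms[OF c(1)[unfolded tarrs_tarrs]]
  have t1: "tapp (?sh ?v1) (vars ?r) \<in> TM ?m" by (rule tapp_tms[of _ _ _ ?r]) auto
  have body: "forget (generic A ?j) = J (asubst (scomp (shift ?n) (shift (?j + ?k))) A) (sh ?n ?vx) (vars ?n)"
    by (simp add: generic_def J_def)
  have "isubst (up ?n (shift ?r)) (forget (generic A ?j)) =
     J (asubst (scomp (up ?n (shift ?r)) (scomp (shift ?n) (shift (?j + ?k)))) A)
       (map (tsubst (up ?n (shift ?r))) (sh ?n ?vx)) (map (tsubst (up ?n (shift ?r))) (vars ?n))"
    unfolding body by (rule isubst_J) (use w in \<open>auto intro!: twf_scomp twf_up tms_shift\<close>)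
  \<comment> \<open>The outer bound variables enter the body only through the bound to which they
    are arguments; the formula and its superscript are merely shifted past them.\<close>
  then have G: "bq p ?\<tau> (tapp (?sh ?v1) (vars ?r)) (isubst (up ?n (shift ?r)) (forget (generic A ?j))) = ?G"
    by simp
  have "aprov gt (map Bang (aWs gp (tarrs \<rho>s (hat p ?\<tau>)) ?v1) @ map Bang (aWs gp (hat p \<rho>s) ?v2) @ [Bang (bq gp ?\<tau> (tapp c (?v1 @ ?v2)) (generic A ?j))])
      (bq gp \<rho>s ?v2 (Bang (bq gp ?\<tau> (tapp (?sh ?v1) (vars ?r)) (asubst (up ?n (shift ?r)) (generic A ?j)))))"
    by (rule c(2)[unfolded C_circ_def gp_simps(4), rule_format]) auto
  from iprov_der[OF forget_sound[OF this]]
  have 1: "der (WS (tarrs \<rho>s ?h @ ?h') (vars ?j) \<union> {bq p ?\<tau> (tapp c (vars ?j)) (forget (generic A ?j))}) (bq p \<rho>s ?v2 ?G)"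
    unfolding map_append forget_Bang_aWs gp_simps forget_girard forget.simps forget_asubst G vars_add
    by (simp add: WS_append Un_assoc del: J_simps asubst.simps)
  have wG: "wff ?G" by (rule wff_J) (use w t1 in \<open>auto intro!: twf_scomp tms_shift simp del: map_map\<close>)
  have "der (WS (tarrs \<rho>s ?h) fs \<union> WS ?h' zs \<union> {J (Bang (asubst e A)) xs (tapp c (fs @ zs))})
      (bq p \<rho>s zs (J (Bang (asubst (scomp (shift ?r) e) A)) (?sh xs) (tapp (?sh fs) (vars ?r))))"
    if env: "\<And>i. wft (e i)" and xs: "xs \<in> TM ?k" and fs: "fs \<in> TM ?m" and zs: "zs \<in> TM ?m'" for e xs fs zs
  proof -
    let ?e = "ext ((fs @ zs) @ xs) e"
    note l = tms_length[OF xs] tms_length[OF fs] tms_length[OF zs]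
    have fz: "fs @ zs \<in> tup (tarrs \<rho>s ?h @ ?h')" using tms_appendI[OF fs zs] by simp
    have e: "wft (?e i)" for i using fs zs xs env by (intro twf_ext) (auto simp: tms_def)
    have s: "map (tsubst ?e) ?v1 = fs" "map (tsubst ?e) ?v2 = zs" "map (tsubst ?e) ?vx = xs" using l by simp_all
    have ups: "map (tsubst (up ?r ?e)) (?sh ys) = ?sh (map (tsubst ?e) ys)" for ys by simp
    have "isubst (up ?r ?e) ?G = J (asubst (scomp (up ?r ?e) (scomp (shift ?r) (shift (?j + ?k)))) (Bang A))
        (map (tsubst (up ?r ?e)) (?sh ?vx)) (map (tsubst (up ?r ?e)) (tapp (?sh ?v1) (vars ?r)))"
      by (rule isubst_J) (use w e t1 in \<open>auto intro!: twf_scomp twf_up tms_shift simp del: map_map\<close>)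
    also have "\<dots> = J (Bang (asubst (scomp (shift ?r) e) A)) (?sh xs) (tapp (?sh fs) (vars ?r))"
      unfolding map_tsubst_tapp ups s using l by (simp del: J_simps)
    finally have G': "isubst (up ?r ?e) ?G = J (Bang (asubst (scomp (shift ?r) e) A)) (?sh xs) (tapp (?sh fs) (vars ?r))" .
    have "isubst ?e (bq p \<rho>s ?v2 ?G) = bq p \<rho>s (map (tsubst ?e) ?v2) (isubst (up ?r ?e) ?G)"
      by (rule isubst_bq[OF _ wG e]) simp
    then have "der (WS (tarrs \<rho>s ?h @ ?h') (fs @ zs) \<union> {J (Bang (asubst e A)) xs (tapp c (fs @ zs))})
        (bq p \<rho>s zs (J (Bang (asubst (scomp (shift ?r) e) A)) (?sh xs) (tapp (?sh fs) (vars ?r))))"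
      using generic_inst[OF assms W _ 1 fz xs, of e, OF _ env] unfolding G' s by simp
    then show ?thesis using l by (simp add: WS_append del: J_simps)
  qed
  then show ?thesis using W by blast
qed

subsection \<open>Monotonicity of the bounded quantifier\<close>

text \<open>
  \<open>Q1\<close> is applied to the Girard translation of a derivation. These are the formulas for which the
  required formulas \<open>|A|\<close> can be exchanged with the Girard translation, on the left and on the right.
\<close>

definition hyp_ok :: "('c, 'p) ifm \<Rightarrow> bool" where
  "hyp_ok F \<longleftrightarrow> (\<exists>X \<in> fms. forget X = F \<and> aprov gt [X] (girard F))"

definition goal_ok :: "('c, 'p) ifm \<Rightarrow> bool" where
  "goal_ok F \<longleftrightarrow> (\<exists>X \<in> fms. forget X = F \<and> aprov gt [girard F] X)"

lemma hyp_ok_wff: "hyp_ok F \<Longrightarrow> wff F"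
  unfolding hyp_ok_def using gt_wf by fastforce

lemma aWs_girard: "aWs gp \<tau>s ts = map girard (iWs p \<tau>s ts)"
  by (auto simp: aWs_def iWs_def girard_params_def girard_isubst)

lemma tensor_girard: "Fs \<noteq> [] \<Longrightarrow> tensor (map girard Fs) = girard (iconj Fs)"
  by (induction Fs rule: iconj.induct) auto

lemma wff_iWc: "ts \<in> TM n \<Longrightarrow> wff (iWc p \<tau>s ts)"
  by (auto simp: iWc_def wff_iconj intro: wff_WS)

text \<open>The empty tuple is a separate case: the empty \<open>tensor\<close> is
  \<open>Lolli ABot ABot\<close>, whereas the Girard translation of the empty conjunction carries
  further exponentials. Both are provable.\<close>

lemma aWc_girard:
  assumes "ts \<in> TM n"
  shows "aprov gt [Bang (aWc gp \<tau>s ts)] (girard (iWc p \<tau>s ts))"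
proof (cases "iWs p \<tau>s ts = []")
  case True
  then have "iprov It [] (iWc p \<tau>s ts)"
    using der_iprov[of "[]"] der_iconjI[of "[]" "{}"] by (simp add: iWc_def)
  from girard_sound[OF this] have "aprov gt [] (girard (iWc p \<tau>s ts))" by simp
  moreover have "awf (ilang It) (Bang (aWc gp \<tau>s ts))" using True by (simp add: aWc_def aWs_girard)
  ultimately show ?thesis by (auto intro: awk)
next
  case False
  then have "aWc gp \<tau>s ts = girard (iWc p \<tau>s ts)" by (simp add: aWc_def aWs_girard iWc_def tensor_girard)
  then show ?thesis using wff_iWc[OF assms] by (auto intro: bang_id)
qed

lemma asubst_aWc: "asubst \<sigma> (aWc gp \<tau>s ts) = aWc gp \<tau>s (map (tsubst \<sigma>) ts)"
proof -
  have "asubst \<sigma> (tensor As) = tensor (map (asubst \<sigma>) As)" for \<sigma> :: "nat \<Rightarrow> 'c tm" and As :: "('c, 'p) afm list"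
    by (induction As rule: tensor.induct) auto
  then show ?thesis unfolding aWc_def aWs_girard
    by (simp add: o_def girard_isubst[symmetric] map_isubst_iWs[symmetric] del: isubst_isubst)
qed

text \<open>Hypotheses come in three groups: \<open>W\<close> of terms not bound here stays outside
  the quantifier, \<open>W\<close> of the bound variables is free by (Q2), and \<open>D\<close> gets
  quantified. The derivation is translated, its formulas are exchanged for members of
  \<open>fms\<close>, (Q1) is applied, and exponentials are forgotten again.\<close>

lemma bq_mono:
  assumes as: "as \<in> tup (hat p \<rho>s)" and us: "us \<in> tup \<sigma>s"
    and D: "\<And>F. F \<in> D \<Longrightarrow> hyp_ok F" and B: "goal_ok B"
    and der: "der (WS \<sigma>s (sh (length \<rho>s) us) \<union> WS \<rho>s (vars (length \<rho>s)) \<union> D) B"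
  shows "der (WS \<sigma>s us \<union> bq p \<rho>s as ` D) (bq p \<rho>s as B)"
proof -
  let ?r = "length \<rho>s"
  let ?su = "sh ?r us"
  obtain \<Gamma> where \<Gamma>: "set \<Gamma> \<subseteq> WS \<sigma>s ?su \<union> WS \<rho>s (vars ?r) \<union> D" "iprov It \<Gamma> B"
    using der by (auto simp: der_def)
  \<comment> \<open>Only finitely many members of \<open>D\<close> enter the derivation, and the
    affine sequent needs them as a list.\<close>
  define Ds where "Ds = filter (\<lambda>F. F \<in> D) \<Gamma>"
  have Ds: "set Ds \<subseteq> D" by (auto simp: Ds_def)
  have su: "?su \<in> tup \<sigma>s" using tms_shift[OF us] .
  \<comment> \<open>(Q1) admits \<open>W\<close> of a whole tuple as one formula, so each group of
    \<open>W\<close>-hypotheses is packed into a conjunction.\<close>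
  have "wff (iWc p \<sigma>s ?su)" "wff (iWc p \<rho>s (vars ?r))" using su by (auto intro: wff_iWc[of _ ?r] wff_iWc)
  moreover have "wff F" if "F \<in> set Ds" for F using that Ds D hyp_ok_wff by blast
  ultimately have w: "\<forall>F \<in> set ([iWc p \<sigma>s ?su, iWc p \<rho>s (vars ?r)] @ Ds). wff F" by auto
  have "der (set ([iWc p \<sigma>s ?su, iWc p \<rho>s (vars ?r)] @ Ds)) F" if F: "F \<in> set \<Gamma>" for F
  proof -
    consider "F \<in> WS \<sigma>s ?su" | "F \<in> WS \<rho>s (vars ?r)" | "F \<in> set Ds" using F \<Gamma>(1) by (auto simp: Ds_def)
    then show ?thesis
    proof cases
      case 1
      then show ?thesis using w by (intro der_iconj[OF 1]) (auto simp: iWc_def intro: der_prem)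
    next
      case 2
      then show ?thesis using w by (intro der_iconj[OF 2]) (auto simp: iWc_def intro: der_prem)
    next
      case 3
      then show ?thesis using w by (auto intro: der_prem)
    qed
  qed
  then have "der (set ([iWc p \<sigma>s ?su, iWc p \<rho>s (vars ?r)] @ Ds)) B"
    by (intro der_cut[OF iprov_der[OF \<Gamma>(2)]])
  then have "iprov It ([iWc p \<sigma>s ?su, iWc p \<rho>s (vars ?r)] @ Ds) B" using w by (rule der_iprov)
  from girard_sound[OF this]
  have g: "aprov gt (girard (iWc p \<sigma>s ?su) # girard (iWc p \<rho>s (vars ?r)) # map girard Ds) (girard B)" by simp
  obtain X where X: "X \<in> fms" "forget X = B" "aprov gt [girard B] X" using B by (auto simp: goal_ok_def)
  have "\<exists>Y \<in> fms. forget Y = F \<and> aprov gt [Y] (girard F)" if "F \<in> set Ds" for F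
    using D Ds that by (auto simp: hyp_ok_def)
  then obtain y where y: "\<And>F. F \<in> set Ds \<Longrightarrow> y F \<in> fms \<and> forget (y F) = F \<and> aprov gt [y F] (girard F)"
    by metis
  let ?Wu = "Bang (aWc gp \<sigma>s us)" and ?Ws = "Bang (aWc gp \<sigma>s ?su)" and ?Wr = "Bang (aWc gp \<rho>s (vars ?r))"
  have "aprov gt ((girard (iWc p \<sigma>s ?su) # girard (iWc p \<rho>s (vars ?r)) # map girard Ds) @ []) X"
    using acut[OF g X(3)] by simp
  then have "aprov gt ((?Ws # ?Wr # map y Ds) @ []) X"
    by (rule aprov_cut_ctx[rotated])
      (use y aWc_girard[OF su] aWc_girard[of "vars ?r" ?r] in \<open>auto simp: list_all2_map1 list_all2_map2 list_all2_same simp del: map_map\<close>)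
  \<comment> \<open>The form required by (Q1): the outer \<open>W\<close>-hypothesis is a shift, so
    the bound variables do not occur in it.\<close>
  then have a: "aprov gt (map (asubst (shift ?r)) [?Wu] @ ?Wr # map y Ds) X"
    by (simp add: asubst_aWc)
  have "aprov gt ([?Wu] @ map (bq gp \<rho>s as) (?Wr # map y Ds)) (bq gp \<rho>s as X)"
  proof -
    have "is_bangW (ilang It) gp ?Wu" "is_bangW (ilang It) gp ?Wr"
      using us tms_vars_simps(2) unfolding is_bangW_def by blast+
    moreover have Q: "Q1 gt gp fms" using A5 by (simp add: A5_def)
    ultimately show ?thesis using y
      by (intro Q[unfolded Q1_def alang_girard_thy gp_simps(4), rule_format, OF as _ _ X(1) a]) auto
  qed
  from iprov_der[OF forget_sound[OF this]]
  have 1: "der (set (iWc p \<sigma>s us # bq p \<rho>s as (iWc p \<rho>s (vars ?r)) # map (\<lambda>F. bq p \<rho>s as (forget (y F))) Ds)) (bq p \<rho>s as B)"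
    by (simp add: X(2) o_def)
  \<comment> \<open>(Q2) removes the quantified \<open>W\<close> of the bound variables.\<close>
  have "Q2 gt gp" using A5 by (simp add: A5_def)
  then have "aprov gt [] (bq gp \<rho>s as ?Wr)" using as by (simp add: Q2_def)
  from iprov_der[OF forget_sound[OF this]]
  have 2: "der {} (bq p \<rho>s as (iWc p \<rho>s (vars ?r)))" by simp
  show ?thesis
  proof (rule der_cut[OF 1])
    fix F assume F: "F \<in> set (iWc p \<sigma>s us # bq p \<rho>s as (iWc p \<rho>s (vars ?r)) # map (\<lambda>F. bq p \<rho>s as (forget (y F))) Ds)" and wF: "wff F"
    then consider "F = iWc p \<sigma>s us" | "F = bq p \<rho>s as (iWc p \<rho>s (vars ?r))" | "F \<in> bq p \<rho>s as ` D"
      using y Ds by fastforce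
    then show "der (WS \<sigma>s us \<union> bq p \<rho>s as ` D) F"
    proof cases
      case 1
      then show ?thesis using wff_WS[OF us] by (auto simp: iWc_def intro!: der_iconjI der_prem)
    next
      case 2
      then show ?thesis using \<open>der {} (bq p \<rho>s as (iWc p \<rho>s (vars ?r)))\<close> by (auto intro: der_mono)
    next
      case 3
      then show ?thesis using wF by (auto intro: der_prem)
    qed
  qed
qed

section \<open>Interpreted source formulas under an environment\<close>

abbreviation pos :: "('c, 'p) ifm \<Rightarrow> ty list" where "pos \<equiv> ipos p"
abbreviation neg :: "('c, 'p) ifm \<Rightarrow> ty list" where "neg \<equiv> ineg p"
abbreviation wfs :: "(nat \<Rightarrow> 'c tm) \<Rightarrow> bool" where "wfs e \<equiv> \<forall>i. twf (ilang Is) (e i)"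
abbreviation swf :: "('c, 'p) ifm \<Rightarrow> bool" where "swf \<equiv> iwf (ilang Is)"

lemma wfs_wft: "wfs e \<Longrightarrow> wft (e i)"
  using sub_st sublang_twf by blast

lemma wfs_up: "wfs e \<Longrightarrow> wfs (up n e)"
  by (auto intro: twf_up)

lemma wfs_scomp_shift: "wfs e \<Longrightarrow> wfs (scomp (shift n) e)"
  by (auto intro: twf_scomp)

lemma swf_wff: "swf A \<Longrightarrow> wff A"
  using sub_st sublang_iwf by blast

lemma fold_pos_neg [simp]: "tpos gp (girard A) = pos A" "tneg gp (girard A) = neg A"
  by (simp_all add: ipos_def ineg_def)

lemma pos_neg_simps [simp]:
  "pos (And A B) = pos A @ pos B" "neg (And A B) = neg A @ neg B"
  "pos (IEx A) = pos A" "neg (IEx A) = neg A"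
  "pos (IAll A) = pos A" "neg (IAll A) = hat p (neg A)"
  "pos (Imp A B) = tarrs (pos A) (pos B) @ tarrs (pos A @ neg B) (neg A)"
  "neg (Imp A B) = hat p (pos A @ neg B)"
  "pos (isubst \<sigma> A) = pos A" "neg (isubst \<sigma> A) = neg A"
  by (simp_all add: ipos_def ineg_def girard_isubst del: fold_pos_neg)

text \<open>The environment is an argument of its own: going under a binder lifts \<open>e\<close>
  or composes it with a shift and leaves \<open>A\<close> alone, so an induction on \<open>A\<close>
  can vary it.\<close>

definition K :: "(nat \<Rightarrow> 'c tm) \<Rightarrow> ('c, 'p) ifm \<Rightarrow> 'c tm list \<Rightarrow> 'c tm list \<Rightarrow> ('c, 'p) ifm" where
  "K e A xs ys = J (asubst e (girard A)) xs ys"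

lemma interp_circ_K: "interp_circ p (isubst e A) xs ys = K e A xs ys"
  by (simp add: interp_circ_def K_def J_def girard_isubst)

lemma K_isubst [simp]: "K e (isubst \<sigma> A) xs ys = K (scomp e \<sigma>) A xs ys"
  by (simp add: K_def girard_isubst)

lemma wff_K:
  assumes "swf A" "wfs e" "xs \<in> tup (pos A)" "ys \<in> tup (neg A)"
  shows "wff (K e A xs ys)"
  unfolding K_def by (rule wff_J) (use assms swf_wff wfs_wft in auto)

lemma isubst_K:
  assumes "swf A" "wfs e" "\<And>i. wft (\<sigma> i)" "xs \<in> tup (pos A)" "ys \<in> tup (neg A)"
  shows "isubst \<sigma> (K e A xs ys) = K (scomp \<sigma> e) A (map (tsubst \<sigma>) xs) (map (tsubst \<sigma>) ys)"
  unfolding K_def by (rule isubst_J) (use assms swf_wff wfs_wft in auto)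

lemma isubst_shift_K:
  assumes "swf A" "wfs e" "xs \<in> tup (pos A)" "ys \<in> tup (neg A)"
  shows "isubst (shift n) (K e A xs ys) = K (scomp (shift n) e) A (sh n xs) (sh n ys)"
  using assms by (simp add: isubst_K)

lemma K_And: "length xs = length (pos A) \<Longrightarrow> length ys = length (neg A) \<Longrightarrow>
    K e (And A B) (xs @ us) (ys @ vs) = And (K e A xs ys) (K e B us vs)"
  by (simp add: K_def)

lemma K_IEx: "K e (IEx A) xs ys = IEx (K (up 1 e) A (sh 1 xs) (sh 1 ys))"
  by (simp add: K_def)

lemma K_IAll: "K e (IAll A) xs as =
    bq p (neg A) as (IAll (K (up 1 (scomp (shift (length (neg A))) e)) A
      (sh 1 (sh (length (neg A)) xs)) (sh 1 (vars (length (neg A))))))"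
  by (simp add: K_def scomp_up_up)

lemma K_Imp:
  assumes "length fs = length (pos B)"
  shows "K e (Imp A B) (fs @ gs) as =
    bq p (pos A @ neg B) as
      (let a = length (pos A); b = length (neg B); r = a + b;
           e' = scomp (shift r) e; us = vars a; ws = map Var [a..<a + b]
       in Imp (K e' A us (tapp (sh r gs) (us @ ws))) (K e' B (tapp (sh r fs) us) ws))"
  unfolding K_def Let_def using assms by (simp add: J_Lolli vars_add)

text \<open>The equations are applied to a version of the formula with variables for both tuples, of
  which the two sides are instances; \<open>e\<close> is shifted past these variables.\<close>

lemma K_peq:
  assumes A: "swf A" and env: "wfs e"
    and xs: "list_all2 peq xs xs'" "length xs = length (pos A)"
    and ys: "list_all2 peq ys ys'" "length ys = length (neg A)"
  shows "der {K e A xs ys} (K e A xs' ys')"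
proof -
  let ?k = "length (pos A)" and ?n = "length (neg A)"
  let ?F = "K (scomp (shift (?k + ?n)) e) A (vars ?k) (map Var [?k..<?k + ?n])"
  have w: "wfs (scomp (shift (?k + ?n)) e)" using env by (rule wfs_scomp_shift)
  have inst: "isubst (inst (us @ vs)) ?F = K e A us vs"
    if "us \<in> TM ?k" "vs \<in> TM ?n" for us vs
  proof -
    have i: "wft (inst (us @ vs) i)" for i using that by (intro twf_inst) (auto simp: tms_def)
    have "map (tsubst (inst (us @ vs))) (vars ?k) = us"
      "map (tsubst (inst (us @ vs))) (map Var [?k..<?k + ?n]) = vs"
      using that map_ext_vars[of 0 ?k "us @ vs" Var] map_ext_vars[of ?k "?k + ?n" "us @ vs" Var]
      by (simp_all add: ext_Var tms_length)
    moreover have "scomp (inst (us @ vs)) (scomp (shift (?k + ?n)) e) = e"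
      using that by (simp add: scomp_assoc tms_length)
    ultimately show ?thesis using isubst_K[OF A w i, of "vars ?k" "map Var [?k..<?k + ?n]"] by simp
  qed
  have "\<forall>i < length xs. peq (xs ! i) (xs' ! i)" "\<forall>i < length ys. peq (ys ! i) (ys' ! i)"
    and l: "length xs' = ?k" "length ys' = ?n"
    using xs ys by (auto simp: list_all2_conv_all_nth)
  then have peq: "peq (inst (xs @ ys) i) (inst (xs' @ ys') i)" for i
    using xs ys by (auto simp: inst_def nth_append peq_refl)
  have "set xs \<union> set xs' \<union> set ys \<union> set ys' \<subseteq> {t. wft t}"
    using xs(1) ys(1) peq_wft by (fastforce simp: list_all2_conv_all_nth in_set_conv_nth)
  then have "xs \<in> TM ?k" "ys \<in> TM ?n" "xs' \<in> TM ?k" "ys' \<in> TM ?n"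
    using xs ys l by (auto simp: tms_def)
  moreover have "wff ?F" using A w by (intro wff_K) auto
  ultimately show ?thesis using peq_formula[of ?F "inst (xs @ ys)" "inst (xs' @ ys')"] peq inst by simp
qed

lemma peq_refl_list: "xs \<in> TM n \<Longrightarrow> list_all2 peq xs xs"
  by (auto simp: tms_def list_all2_same intro: peq_refl)

lemma peq_sym_list: "list_all2 peq xs ys \<Longrightarrow> list_all2 peq ys xs"
  by (auto simp: list_all2_conv_all_nth intro: peq_sym)

text \<open>Every exponential in the interpretation stands in front of a bounded quantification, and
  \<open>girard_params\<close> defines the latter as a Girard translation.\<close>

lemma girardlike_interp: "girardlike (interp gp (girard A) xs ys)"
  by (induction A arbitrary: xs ys) (auto simp: Let_def intro: girardlike.intros)

lemma K_girardlike:
  assumes "swf A" "wfs e" "xs \<in> tup (pos A)" "ys \<in> tup (neg A)"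
  shows "\<exists>X \<in> fms. X = interp gp (asubst e (girard A)) xs ys \<and> forget X = K e A xs ys \<and>
     aprov gt [X] (girard (K e A xs ys)) \<and> aprov gt [girard (K e A xs ys)] X"
proof -
  let ?X = "interp gp (asubst e (girard A)) xs ys"
  have 1: "?X \<in> fms" by (rule interp_fmsI) (use assms in \<open>auto simp: awf_asubst_iff\<close>)
  have 2: "girardlike ?X" using girardlike_interp[of "isubst e A"] by (simp add: girard_isubst)
  have 3: "forget ?X = K e A xs ys" by (simp add: K_def J_def)
  have "awf (ilang It) ?X" using wff_K[OF assms] unfolding 3[symmetric] by simp
  from girardlike_equiv[OF 2 this] show ?thesis using 1 3 by auto
qed

lemma hyp_ok_K:
  assumes "swf A" "wfs e" "xs \<in> tup (pos A)" "ys \<in> tup (neg A)"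
  shows "hyp_ok (K e A xs ys)"
  using K_girardlike[OF assms] by (auto simp: hyp_ok_def)

lemma goal_ok_K:
  assumes "swf A" "wfs e" "xs \<in> tup (pos A)" "ys \<in> tup (neg A)"
  shows "goal_ok (K e A xs ys)"
  using K_girardlike[OF assms] by (auto simp: goal_ok_def)

text \<open>The formula \<open>|A|\<close> below the bounded quantifier of an implication is a
  \<open>Lolli\<close> without \<open>Bang\<close>, hence not \<open>girardlike\<close>. It still
  follows from the Girard translation by dereliction, with \<open>K_girardlike\<close> used in
  opposite directions on the two sides; a goal asks for no more.\<close>

lemma goal_ok_Imp:
  assumes A: "swf A" and B: "swf B" and env: "wfs e"
    and xs: "xs \<in> tup (pos A)" and ws: "ws \<in> tup (neg B)"
    and fs: "fs \<in> tup (pos B)" and gs: "gs \<in> tup (neg A)"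
  shows "goal_ok (Imp (K e A xs (tapp gs (xs @ ws))) (K e B (tapp fs xs) ws))"
proof -
  let ?F = "K e A xs (tapp gs (xs @ ws))" and ?G = "K e B (tapp fs xs) ws"
  let ?X = "interp gp (asubst e (Lolli (girard A) (girard B))) (fs @ gs) (xs @ ws)"
  let ?Y = "interp gp (asubst e (girard A)) xs (tapp gs (xs @ ws))"
  let ?Z = "interp gp (asubst e (girard B)) (tapp fs xs) ws"
  have t: "tapp gs (xs @ ws) \<in> tup (neg A)" "tapp fs xs \<in> tup (pos B)"
    using tapp_tms[OF gs tms_appendI[OF xs ws]] tapp_tms[OF fs xs] by auto
  have X: "?X = Lolli ?Y ?Z" using xs fs by (simp add: Let_def tms_length)
  have "?X \<in> fms" by (rule interp_fmsI) (use A B env xs ws fs gs in \<open>auto simp: awf_asubst_iff\<close>)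
  moreover have "forget ?X = Imp ?F ?G" unfolding X by (simp add: K_def J_def)
  moreover have "aprov gt [girard (Imp ?F ?G)] ?X"
  proof -
    have "aprov gt [?Y] (girard ?F)" "aprov gt [girard ?G] ?Z"
      using K_girardlike[OF A env xs t(1)] K_girardlike[OF B env t(2) ws] by auto
    then have "aprov gt (Lolli (girard ?F) (girard ?G) # [?Y] @ []) ?Z" by (rule alolL)
    then have "aprov gt [?Y, Lolli (girard ?F) (girard ?G)] ?Z" by (rule aperm) simp
    then have "aprov gt [Lolli (girard ?F) (girard ?G)] (Lolli ?Y ?Z)" by (rule alolR)
    then show ?thesis unfolding X by (auto intro: abangL)
  qed
  ultimately show ?thesis unfolding goal_ok_def by blast
qed

text \<open>As for implication, dereliction leads to the unbanged \<open>AAll\<close>, whose body is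
  then reached by instantiation at the eigenvariable.\<close>

lemma goal_ok_All:
  assumes A: "swf A" and env: "wfs e"
    and xs: "xs \<in> tup (pos A)" and ys: "ys \<in> tup (neg A)"
  shows "goal_ok (IAll (K (up 1 e) A (sh 1 xs) (sh 1 ys)))"
proof -
  let ?F = "K (up 1 e) A (sh 1 xs) (sh 1 ys)"
  let ?X = "interp gp (asubst e (AAll (girard A))) xs ys"
  let ?Y = "interp gp (asubst (up 1 e) (girard A)) (sh 1 xs) (sh 1 ys)"
  have X: "?X = AAll ?Y" by simp
  have "?X \<in> fms" by (rule interp_fmsI) (use A env xs ys in \<open>auto simp: awf_asubst_iff twf_up\<close>)
  moreover have "forget ?X = IAll ?F" unfolding X by (simp add: K_def J_def)
  moreover have "aprov gt [girard (IAll ?F)] ?X"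
  proof -
    have "aprov gt [girard ?F] ?Y"
      using K_girardlike[OF A wfs_up[OF env, of 1] tms_shift[OF xs, of 1] tms_shift[OF ys, of 1]] by auto
    then have "aprov gt [asubst (inst [Var 0]) (asubst (up 1 (shift 1)) (girard ?F))] ?Y" by simp
    then have "aprov gt [AAll (asubst (up 1 (shift 1)) (girard ?F))] ?Y" by (rule aallL) simp
    then have "aprov gt (map (asubst (shift 1)) [AAll (girard ?F)]) ?Y" by simp
    then have "aprov gt [AAll (girard ?F)] (AAll ?Y)" by (rule aallR)
    then show ?thesis unfolding X by (auto intro: abangL)
  qed
  ultimately show ?thesis unfolding goal_ok_def by blast
qed

subsection \<open>Combining counterwitnesses\<close>

lemma Wdef_merge:
  assumes "Wdef (\<sigma>s @ \<sigma>s) \<sigma>s f" and "Wdef (\<tau>s @ \<tau>s) \<tau>s g"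
  shows "\<exists>h. Wdef ((\<sigma>s @ \<tau>s) @ (\<sigma>s @ \<tau>s)) (\<sigma>s @ \<tau>s) h \<and>
    (\<forall>x y u v. length x = length \<sigma>s \<longrightarrow> length y = length \<tau>s \<longrightarrow> length u = length \<sigma>s \<longrightarrow>
       h ((x @ y) @ (u @ v)) = f (x @ u) @ g (y @ v))"
proof -
  let ?m = "length \<sigma>s" and ?n = "length \<tau>s"
  note fst = Wdef_take[of "\<sigma>s @ \<tau>s" "\<sigma>s @ \<tau>s"] note snd = Wdef_drop[of "\<sigma>s @ \<tau>s" "\<sigma>s @ \<tau>s"]
  note l = Wdef_take[of \<sigma>s \<tau>s] note r = Wdef_drop[of \<sigma>s \<tau>s]
  let ?h = "\<lambda>v. f (take ?m (take (?m + ?n) v) @ take ?m (drop (?m + ?n) v)) @ g (drop ?m (take (?m + ?n) v) @ drop ?m (drop (?m + ?n) v))"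
  have "Wdef ((\<sigma>s @ \<tau>s) @ (\<sigma>s @ \<tau>s)) (\<sigma>s @ \<tau>s) ?h"
    using Wdef_append[OF Wdef_comp[OF Wdef_append[OF Wdef_comp[OF fst l] Wdef_comp[OF snd l]] assms(1)]
        Wdef_comp[OF Wdef_append[OF Wdef_comp[OF fst r] Wdef_comp[OF snd r]] assms(2)]]
    by simp
  then show ?thesis by (intro exI[of _ ?h]) auto
qed

text \<open>The function must not depend on superscript or environment, since it becomes part of a
  closed witness.\<close>

definition merges :: "('c, 'p) ifm \<Rightarrow> ('c tm list \<Rightarrow> 'c tm list) \<Rightarrow> bool" where
  "merges A M \<longleftrightarrow> Wdef (neg A @ neg A) (neg A) M \<and>
    (\<forall>e xs y1 y2. wfs e \<longrightarrow> xs \<in> tup (pos A) \<longrightarrow>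
      y1 \<in> tup (neg A) \<longrightarrow> y2 \<in> tup (neg A) \<longrightarrow>
      der (WS (neg A) y1 \<union> WS (neg A) y2 \<union> {K e A xs (M (y1 @ y2))}) (And (K e A xs y1) (K e A xs y2)))"

lemma merges_bang:
  assumes "girard C = Bang A" and "swf C"
  shows "\<exists>M. merges C M"
proof -
  have A: "awf (ilang Is) A" using assms by (metis awf.simps(7) awf_girard)
  have "neg C = hat p (tneg gp A)" "pos C = tpos gp A"
    using assms(1) by (auto simp: ineg_def ipos_def simp del: fold_pos_neg)
  moreover have "K e C xs ys = J (Bang (asubst e A)) xs ys" for e xs ys
    using assms(1) by (simp add: K_def del: J_simps)
  moreover obtain U where "Wdef (hat p (tneg gp A) @ hat p (tneg gp A)) (hat p (tneg gp A)) U"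
    "\<And>e xs y1 y2. (\<forall>i. wft (e i)) \<Longrightarrow> xs \<in> tup (tpos gp A) \<Longrightarrow>
      y1 \<in> tup (hat p (tneg gp A)) \<Longrightarrow> y2 \<in> tup (hat p (tneg gp A)) \<Longrightarrow>
      der (WS (hat p (tneg gp A)) y1 \<union> WS (hat p (tneg gp A)) y2 \<union> {J (Bang (asubst e A)) xs (U (y1 @ y2))})
        (And (J (Bang (asubst e A)) xs y1) (J (Bang (asubst e A)) xs y2))"
    using sqcup[OF A] by blast
  ultimately have "merges C U" using wfs_wft unfolding merges_def by (simp del: J_simps)
  then show ?thesis by blast
qed

lemma merges_ex: "swf A \<Longrightarrow> \<exists>M. merges A M"
proof (induction A)
  case (And A B)
  then obtain M N where M: "merges A M" and N: "merges B N" by auto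
  obtain h where h: "Wdef ((neg A @ neg B) @ (neg A @ neg B)) (neg A @ neg B) h"
    and h_eq: "\<And>x y u v. length x = length (neg A) \<Longrightarrow> length y = length (neg B) \<Longrightarrow> length u = length (neg A) \<Longrightarrow>
       h ((x @ y) @ (u @ v)) = M (x @ u) @ N (y @ v)"
    using Wdef_merge M N unfolding merges_def by metis
  have "der (WS (neg (And A B)) y1 \<union> WS (neg (And A B)) y2 \<union> {K e (And A B) xs (h (y1 @ y2))})
      (And (K e (And A B) xs y1) (K e (And A B) xs y2))" (is "der ?H _")
    if env: "wfs e" and xs: "xs \<in> tup (pos (And A B))"
      and y1: "y1 \<in> tup (neg (And A B))" and y2: "y2 \<in> tup (neg (And A B))" for e xs y1 y2
  proof -
    obtain u v where u: "xs = u @ v" "u \<in> tup (pos A)" "v \<in> tup (pos B)"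
      using xs by (auto elim: tms_splitE)
    obtain a b where a: "y1 = a @ b" "a \<in> tup (neg A)" "b \<in> tup (neg B)"
      using y1 by (auto elim: tms_splitE)
    obtain c d where c: "y2 = c @ d" "c \<in> tup (neg A)" "d \<in> tup (neg B)"
      using y2 by (auto elim: tms_splitE)
    have t: "M (a @ c) \<in> tup (neg A)" "N (b @ d) \<in> tup (neg B)"
      using M N Wdef_tms tms_appendI[OF a(2) c(2)] tms_appendI[OF a(3) c(3)] unfolding merges_def length_append[symmetric] by blast+
    have h': "K e (And A B) xs (h (y1 @ y2)) = And (K e A u (M (a @ c))) (K e B v (N (b @ d)))"
      unfolding a c u using a c u t h_eq[of a b c d] by (simp add: tms_length K_And)
    have "wff (And (K e A u (M (a @ c))) (K e B v (N (b @ d))))" using And.prems t u env by (simp add: wff_K)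
    then have "der ?H (And (K e A u (M (a @ c))) (K e B v (N (b @ d))))"
      unfolding h' by (auto intro: der_prem)
    note h2 = der_andE[OF this]
    have "der ?H (And (K e A u a) (K e A u c))"
    proof (rule der_cut)
      show "der (WS (neg A) a \<union> WS (neg A) c \<union> {K e A u (M (a @ c))}) (And (K e A u a) (K e A u c))"
        using M env u a c unfolding merges_def by blast
    qed (use h2 a c in \<open>auto simp: WS_append tms_length intro: der_prem\<close>)
    note 1 = der_andE[OF this]
    have "der ?H (And (K e B v b) (K e B v d))"
    proof (rule der_cut)
      show "der (WS (neg B) b \<union> WS (neg B) d \<union> {K e B v (N (b @ d))}) (And (K e B v b) (K e B v d))"
        using N env u a c unfolding merges_def by blast
    qed (use h2 a c in \<open>auto simp: WS_append tms_length intro: der_prem\<close>)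
    note 2 = der_andE[OF this]
    have "And (K e (And A B) xs y1) (K e (And A B) xs y2) = And (And (K e A u a) (K e B v b)) (And (K e A u c) (K e B v d))"
      unfolding a u c using a u c by (simp add: K_And tms_length)
    then show ?thesis using 1 2 by (auto intro!: der_andI)
  qed
  then show ?case using h by (auto simp: merges_def)
next
  case (IEx A)
  then obtain M where M: "merges A M" by auto
  have "der (WS (neg A) y1 \<union> WS (neg A) y2 \<union> {K e (IEx A) xs (M (y1 @ y2))}) (And (K e (IEx A) xs y1) (K e (IEx A) xs y2))"
    if env: "wfs e" and xs: "xs \<in> tup (pos A)"
      and y1: "y1 \<in> tup (neg A)" and y2: "y2 \<in> tup (neg A)" for e xs y1 y2
  proof -
    let ?F = "\<lambda>y. K (up 1 e) A (sh 1 xs) (sh 1 y)"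
    have W: "Wdef (neg A @ neg A) (neg A) M" using M by (simp add: merges_def)
    have t: "M (y1 @ y2) \<in> tup (neg A)" by (rule Wdef_tms[OF W]) (use y1 y2 in auto)
    \<comment> \<open>The terms behind \<open>M\<close> do not contain the eigenvariable, so
      \<open>M\<close> commutes with the shift.\<close>
    have m: "sh 1 (M (y1 @ y2)) = M (sh 1 y1 @ sh 1 y2)"
      using Wdef_subst[OF W, of "y1 @ y2"] y1 y2 by (simp add: tms_length)
    have w: "wff (?F y)" if "y \<in> tup (neg A)" for y
      using IEx.prems env xs that by (intro wff_K wfs_up tms_shift) auto
    have "der (WS (neg A) (sh 1 y1) \<union> WS (neg A) (sh 1 y2) \<union> {K (up 1 e) A (sh 1 xs) (M (sh 1 y1 @ sh 1 y2))}) (And (?F y1) (?F y2))"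
      using M wfs_up[OF env] tms_shift[OF xs] tms_shift[OF y1] tms_shift[OF y2] unfolding merges_def by blast
    then have 1: "der (insert (?F (M (y1 @ y2))) (isubst (shift 1) ` (WS (neg A) y1 \<union> WS (neg A) y2))) (And (?F y1) (?F y2))"
      by (simp add: image_Un isubst_WS m[unfolded One_nat_def])
    have 2: "der (insert (?F (M (y1 @ y2))) H) (isubst (shift 1) (IEx (?F y)))"
      if "der (insert (?F (M (y1 @ y2))) H) (?F y)" for y H
      using that by (auto intro!: der_exI[of _ "Var 0"])
    have "der (insert (IEx (?F (M (y1 @ y2)))) (WS (neg A) y1 \<union> WS (neg A) y2)) (And (IEx (?F y1)) (IEx (?F y2)))"
    proof (rule der_exE)
      show "der (insert (?F (M (y1 @ y2))) (isubst (shift 1) ` (WS (neg A) y1 \<union> WS (neg A) y2)))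
          (isubst (shift 1) (And (IEx (?F y1)) (IEx (?F y2))))"
        unfolding isubst.simps(3) by (intro der_andI 2 der_andE[OF 1])
    qed (rule w[OF t])
    then show ?thesis by (simp add: K_IEx)
  qed
  then show ?case using M by (auto simp: merges_def)
\<comment> \<open>Falsity, atoms, implication and universal quantification translate into formulas
  with an outermost \<open>Bang\<close>.\<close>
qed (rule merges_bang; simp)+

subsection \<open>Distributing a bounded quantifier over a hypothesis\<close>

text \<open>A form of (C_circ) for all source formulas: \<open>h\<close> is a counterwitness that
  may depend on the bound variables, and \<open>c\<close> computes from the bound \<open>zs\<close>
  one that serves for all of them at once.\<close>

definition distributes :: "ty list \<Rightarrow> ty list \<Rightarrow> ('c, 'p) ifm \<Rightarrow> ('c tm list \<Rightarrow> 'c tm list) \<Rightarrow> ('c tm list \<Rightarrow> 'c tm list) \<Rightarrow> bool" where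
  "distributes \<sigma>s \<rho>s A h c \<longleftrightarrow> Wdef (\<sigma>s @ hat p \<rho>s) (neg A) c \<and>
    (\<forall>e xs us zs. wfs e \<longrightarrow> xs \<in> tup (pos A) \<longrightarrow> us \<in> tup \<sigma>s \<longrightarrow> zs \<in> tup (hat p \<rho>s) \<longrightarrow>
      der (WS \<sigma>s us \<union> WS (hat p \<rho>s) zs \<union> {K e A xs (c (us @ zs))})
        (bq p \<rho>s zs (K (scomp (shift (length \<rho>s)) e) A (sh (length \<rho>s) xs) (h (sh (length \<rho>s) us @ vars (length \<rho>s))))))"

text \<open>\<open>h\<close> is curried so that \<open>circ\<close> applies to the tuple
  \<open>F us\<close>. Its conclusion contains \<open>F us\<close> applied to the bound variables
  where \<open>h\<close> is wanted; the provable equality between the two is carried below the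
  quantifier by \<open>bq_mono\<close>.\<close>

lemma distributes_bang:
  assumes C: "girard C = Bang A" "swf C" and h: "Wdef (\<sigma>s @ \<rho>s) (neg C) h"
  shows "\<exists>c. distributes \<sigma>s \<rho>s C h c"
proof -
  let ?r = "length \<rho>s"
  have A: "awf (ilang Is) A" using C by (metis awf.simps(7) awf_girard)
  have n: "neg C = hat p (tneg gp A)" "pos C = tpos gp A"
    using C by (auto simp: ineg_def ipos_def simp del: fold_pos_neg)
  have K: "K e C xs ys = J (Bang (asubst e A)) xs ys" for e xs ys
    using C by (simp add: K_def del: J_simps)
  obtain D where D: "Wdef (tarrs \<rho>s (neg C) @ hat p \<rho>s) (neg C) D"
    and D_der: "\<And>e xs fs zs. wfs e \<Longrightarrow> xs \<in> tup (pos C) \<Longrightarrow>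
      fs \<in> tup (neg C) \<Longrightarrow> zs \<in> tup (hat p \<rho>s) \<Longrightarrow>
      der (WS (tarrs \<rho>s (neg C)) fs \<union> WS (hat p \<rho>s) zs \<union> {K e C xs (D (fs @ zs))})
        (bq p \<rho>s zs (K (scomp (shift ?r) e) C (sh ?r xs) (tapp (sh ?r fs) (vars ?r))))"
    unfolding K n using circ[OF A, of \<rho>s] wfs_wft by metis
  obtain F where F: "Wdef \<sigma>s (tarrs \<rho>s (neg C)) F"
    and F_eq: "\<And>us ys. us \<in> tup \<sigma>s \<Longrightarrow> ys \<in> TM ?r \<Longrightarrow> list_all2 peq (tapp (F us) ys) (h (us @ ys))"
    using Wdef_abs[OF h] by blast
  define c where "c v = D (F (take (length \<sigma>s) v) @ drop (length \<sigma>s) v)" for v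
  have c: "Wdef (\<sigma>s @ hat p \<rho>s) (neg C) c"
    unfolding c_def by (rule Wdef_comp[OF Wdef_append[OF Wdef_comp[OF Wdef_take F] Wdef_drop] D])
  have "der (WS \<sigma>s us \<union> WS (hat p \<rho>s) zs \<union> {K e C xs (c (us @ zs))})
        (bq p \<rho>s zs (K (scomp (shift ?r) e) C (sh ?r xs) (h (sh ?r us @ vars ?r))))"
    if env: "wfs e" and xs: "xs \<in> tup (pos C)" and us: "us \<in> tup \<sigma>s" and zs: "zs \<in> tup (hat p \<rho>s)"
    for e xs us zs
  proof -
    let ?d = "scomp (shift ?r) e"
    let ?F = "K ?d C (sh ?r xs) (tapp (F (sh ?r us)) (vars ?r))"
    let ?G = "K ?d C (sh ?r xs) (h (sh ?r us @ vars ?r))"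
    have sF: "sh ?r (F us) = F (sh ?r us)" using Wdef_subst[OF F] us by (simp add: tms_length)
    have tF: "F us \<in> tup (neg C)" using Wdef_tms[OF F us] by simp
    note su = tms_shift[OF us, of ?r] note sx = tms_shift[OF xs, of ?r]
    have t1: "tapp (F (sh ?r us)) (vars ?r) \<in> tup (neg C)"
      using tapp_tms[OF Wdef_tms[OF F su], of "vars ?r" ?r] by simp
    have t2: "h (sh ?r us @ vars ?r) \<in> tup (neg C)"
      by (rule Wdef_tms[OF h]) (use su in auto)
    note env' = wfs_scomp_shift[OF env, of ?r]
    have 1: "der (WS (tarrs \<rho>s (neg C)) (F us) \<union> WS (hat p \<rho>s) zs \<union> {K e C xs (D (F us @ zs))}) (bq p \<rho>s zs ?F)"
      using D_der[OF env xs tF zs] unfolding sF .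
    have "der {?F} ?G"
      by (rule K_peq[OF C(2) env' peq_refl_list[OF sx] _ F_eq[OF su]]) (use tms_length[OF sx] tms_length[OF t1] in auto)
    then have "der (WS \<sigma>s us \<union> bq p \<rho>s zs ` {?F}) (bq p \<rho>s zs ?G)"
      by (intro bq_mono[OF zs us]) (use hyp_ok_K[OF C(2) env' sx t1] goal_ok_K[OF C(2) env' sx t2] in \<open>auto intro: der_mono\<close>)
    then show ?thesis
    proof (rule der_cut)
      fix G assume "G \<in> WS \<sigma>s us \<union> bq p \<rho>s zs ` {?F}" "wff G"
      moreover have "der (WS \<sigma>s us \<union> WS (hat p \<rho>s) zs \<union> {K e C xs (c (us @ zs))}) (bq p \<rho>s zs ?F)"
        by (rule der_cut[OF 1]) (use us Wdef_W[OF F us] in \<open>auto simp: c_def tms_length intro: der_prem der_mono\<close>)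
      ultimately show "der (WS \<sigma>s us \<union> WS (hat p \<rho>s) zs \<union> {K e C xs (c (us @ zs))}) G"
        by (auto intro: der_prem)
    qed
  qed
  then show ?thesis using c by (auto simp: distributes_def)
qed

lemma distributes_ex: "swf A \<Longrightarrow> Wdef (\<sigma>s @ \<rho>s) (neg A) h \<Longrightarrow> \<exists>c. distributes \<sigma>s \<rho>s A h c"
proof (induction A arbitrary: h)
  case (And A B)
  let ?r = "length \<rho>s"
  let ?f = "\<lambda>v. take (length (neg A)) (h v)" and ?g = "\<lambda>v. drop (length (neg A)) (h v)"
  have h: "Wdef (\<sigma>s @ \<rho>s) (neg A @ neg B) h" using And.prems by simp
  have f: "Wdef (\<sigma>s @ \<rho>s) (neg A) ?f" and g: "Wdef (\<sigma>s @ \<rho>s) (neg B) ?g"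
    using Wdef_comp[OF h Wdef_take] Wdef_comp[OF h Wdef_drop] .
  obtain c d where c: "distributes \<sigma>s \<rho>s A ?f c" and d: "distributes \<sigma>s \<rho>s B ?g d"
    using And.IH(1)[OF _ f] And.IH(2)[OF _ g] And.prems by auto
  have Wc: "Wdef (\<sigma>s @ hat p \<rho>s) (neg A) c" and Wd: "Wdef (\<sigma>s @ hat p \<rho>s) (neg B) d"
    using c d by (auto simp: distributes_def)
  have "der (WS \<sigma>s us \<union> WS (hat p \<rho>s) zs \<union> {K e (And A B) xs (c (us @ zs) @ d (us @ zs))})
        (bq p \<rho>s zs (K (scomp (shift ?r) e) (And A B) (sh ?r xs) (h (sh ?r us @ vars ?r))))" (is "der ?H _")
    if env: "wfs e" and xs: "xs \<in> tup (pos (And A B))" and us: "us \<in> tup \<sigma>s" and zs: "zs \<in> tup (hat p \<rho>s)"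
    for e xs us zs
  proof -
    let ?d = "scomp (shift ?r) e"
    let ?v = "sh ?r us @ vars ?r"
    obtain u v where u: "xs = u @ v" "u \<in> tup (pos A)" "v \<in> tup (pos B)"
      using xs by (auto elim: tms_splitE)
    let ?F = "K ?d A (sh ?r u) (?f ?v)" and ?G = "K ?d B (sh ?r v) (?g ?v)"
    have uz: "us @ zs \<in> tup (\<sigma>s @ hat p \<rho>s)" using us zs by auto
    have vt: "?v \<in> tup (\<sigma>s @ \<rho>s)" using tms_shift[OF us] by auto
    note t = Wdef_tms[OF f vt] Wdef_tms[OF g vt] Wdef_tms[OF Wc uz] Wdef_tms[OF Wd uz]
    have e: "K e (And A B) xs (c (us @ zs) @ d (us @ zs)) = And (K e A u (c (us @ zs))) (K e B v (d (us @ zs)))"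
      unfolding u using u t by (simp add: K_And tms_length)
    have "K ?d (And A B) (sh ?r u @ sh ?r v) (?f ?v @ ?g ?v) = And ?F ?G"
      by (rule K_And) (use u tms_length[OF t(1)] tms_length in auto)
    then have e': "K ?d (And A B) (sh ?r xs) (h ?v) = And ?F ?G" by (simp add: u)
    have "wff (And (K e A u (c (us @ zs))) (K e B v (d (us @ zs))))"
      using And.prems u t env by (simp add: wff_K)
    then have "der ?H (And (K e A u (c (us @ zs))) (K e B v (d (us @ zs))))"
      unfolding e by (auto intro: der_prem)
    note hyps = der_andE[OF this]
    have 1: "der ?H (bq p \<rho>s zs ?F)"
    proof (rule der_cut)
      show "der (WS \<sigma>s us \<union> WS (hat p \<rho>s) zs \<union> {K e A u (c (us @ zs))}) (bq p \<rho>s zs ?F)"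
        using c env u us zs unfolding distributes_def by blast
    qed (use hyps in \<open>auto intro: der_prem\<close>)
    have 2: "der ?H (bq p \<rho>s zs ?G)"
    proof (rule der_cut)
      show "der (WS \<sigma>s us \<union> WS (hat p \<rho>s) zs \<union> {K e B v (d (us @ zs))}) (bq p \<rho>s zs ?G)"
        using d env u us zs unfolding distributes_def by blast
    qed (use hyps in \<open>auto intro: der_prem\<close>)
    note env' = wfs_scomp_shift[OF env, of ?r]
    have ok: "hyp_ok ?F" "hyp_ok ?G" using And.prems env' u t by (auto intro!: hyp_ok_K tms_shift)
    have ok': "goal_ok (And ?F ?G)" unfolding e'[symmetric]
      by (rule goal_ok_K) (use And.prems env' tms_shift[OF xs] Wdef_tms[OF h vt] in auto)
    have "der (WS \<sigma>s us \<union> bq p \<rho>s zs ` {?F, ?G}) (bq p \<rho>s zs (And ?F ?G))"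
    proof (rule bq_mono[OF zs us _ ok'])
      show "der (WS \<sigma>s (sh ?r us) \<union> WS \<rho>s (vars ?r) \<union> {?F, ?G}) (And ?F ?G)"
        by (rule der_andI; rule der_prem) (use ok hyp_ok_wff in auto)
    qed (use ok in auto)
    then show ?thesis unfolding e'
      by (rule der_cut) (use 1 2 in \<open>auto intro: der_prem\<close>)
  qed
  then show ?case using Wdef_append[OF Wc Wd]
    by (intro exI[of _ "\<lambda>v. c v @ d v"]) (auto simp: distributes_def)
next
  case (IEx A)
  let ?r = "length \<rho>s"
  have h: "Wdef (\<sigma>s @ \<rho>s) (neg A) h" using IEx.prems by simp
  obtain c where c: "distributes \<sigma>s \<rho>s A h c" using IEx.IH[OF _ h] IEx.prems by auto
  have Wc: "Wdef (\<sigma>s @ hat p \<rho>s) (neg A) c" using c by (auto simp: distributes_def)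
  have "der (WS \<sigma>s us \<union> WS (hat p \<rho>s) zs \<union> {K e (IEx A) xs (c (us @ zs))})
        (bq p \<rho>s zs (K (scomp (shift ?r) e) (IEx A) (sh ?r xs) (h (sh ?r us @ vars ?r))))"
    if env: "wfs e" and xs: "xs \<in> tup (pos A)" and us: "us \<in> tup \<sigma>s" and zs: "zs \<in> tup (hat p \<rho>s)"
    for e xs us zs
  proof -
    let ?d = "scomp (shift ?r) e"
    let ?v = "sh ?r us @ vars ?r" let ?v1 = "sh ?r (sh 1 us) @ vars ?r"
    let ?F = "K (up 1 e) A (sh 1 xs) (sh 1 (c (us @ zs)))"
    let ?E = "K ?d (IEx A) (sh ?r xs) (h ?v)"
    let ?G = "K (scomp (shift ?r) (up 1 e)) A (sh ?r (sh 1 xs)) (h ?v1)"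
    let ?E1 = "isubst (up ?r (shift 1)) ?E"
    have uz: "us @ zs \<in> tup (\<sigma>s @ hat p \<rho>s)" using us zs by auto
    have vt: "?v \<in> tup (\<sigma>s @ \<rho>s)" using tms_shift[OF us] by auto
    have vt1: "?v1 \<in> tup (\<sigma>s @ \<rho>s)" using tms_shift[OF tms_shift[OF us]] by auto
    note env' = wfs_scomp_shift[OF env, of ?r]
    note th = Wdef_tms[OF h vt] note tc = Wdef_tms[OF Wc uz]
    have swf: "swf A" using IEx.prems by simp
    have sc: "sh 1 (c (us @ zs)) = c (sh 1 us @ sh 1 zs)"
      using Wdef_subst[OF Wc, of "us @ zs"] us zs by (simp add: tms_length)
    have upv: "map (tsubst (up ?r (shift 1))) ?v = ?v1" by simp
    have "map (tsubst (up ?r (shift 1))) (h ?v) = h ?v1"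
      using Wdef_subst[OF h, of ?v "up ?r (shift 1)"] us unfolding upv by (simp add: tms_length)
    then have E1: "?E1 = K (scomp (up ?r (shift 1)) ?d) (IEx A) (sh ?r (sh 1 xs)) (h ?v1)"
      by (subst isubst_K) (use IEx.prems env' th tms_shift[OF xs] in \<open>auto intro: twf_up\<close>)
    have sE: "isubst (shift 1) (bq p \<rho>s zs ?E) = bq p \<rho>s (sh 1 zs) ?E1"
      by (rule isubst_bq) (use zs IEx.prems env' th tms_shift[OF xs] in \<open>auto intro!: wff_K\<close>)
    \<comment> \<open>The property of \<open>c\<close> at the environment \<open>up 1 e\<close>, in
      which the quantified variable is the eigenvariable.\<close>
    have "der (WS \<sigma>s (sh 1 us) \<union> WS (hat p \<rho>s) (sh 1 zs) \<union> {K (up 1 e) A (sh 1 xs) (c (sh 1 us @ sh 1 zs))}) (bq p \<rho>s (sh 1 zs) ?G)"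
      using c wfs_up[OF env] tms_shift[OF xs] tms_shift[OF us] tms_shift[OF zs] unfolding distributes_def by blast
    then have 1: "der (insert ?F (isubst (shift 1) ` (WS \<sigma>s us \<union> WS (hat p \<rho>s) zs))) (bq p \<rho>s (sh 1 zs) ?G)"
      by (simp add: image_Un isubst_WS sc[unfolded One_nat_def])
    have G: "der {?G} ?E1"
    proof -
      \<comment> \<open>The existential witness is the eigenvariable: it has index 0 outside the
        bounded quantifier, hence \<open>?r\<close> below the \<open>?r\<close> bound
        variables.\<close>
      let ?t = "[Var ?r] :: 'c tm list"
      have strip: "map (tsubst (inst ?t)) (sh 1 ys) = ys" for ys by (simp add: map_idI)
      have "isubst (inst ?t) (K (up 1 (scomp (up ?r (shift 1)) ?d)) A (sh 1 (sh ?r (sh 1 xs))) (sh 1 (h ?v1)))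
        = K (scomp (inst ?t) (up 1 (scomp (up ?r (shift 1)) ?d))) A (map (tsubst (inst ?t)) (sh 1 (sh ?r (sh 1 xs)))) (map (tsubst (inst ?t)) (sh 1 (h ?v1)))"
        by (rule isubst_K[OF swf]) (use env xs Wdef_tms[OF h vt1] in \<open>auto intro!: tms_shift twf_up twf_scomp simp del: map_map\<close>)
      also have "scomp (inst ?t) (up 1 (scomp (up ?r (shift 1)) ?d)) = scomp (shift ?r) (up 1 e)"
        by (rule ext) (auto simp: scomp_def up_def scomp_assoc shift_def)
      finally have e: "isubst (inst ?t) (K (up 1 (scomp (up ?r (shift 1)) ?d)) A (sh 1 (sh ?r (sh 1 xs))) (sh 1 (h ?v1))) = ?G" unfolding strip .
      have "wff ?G" using swf env xs Wdef_tms[OF h vt1] by (intro wff_K wfs_scomp_shift wfs_up tms_shift) auto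
      then show ?thesis unfolding E1 unfolding K_IEx by (intro der_exI[of _ "Var ?r"]) (simp_all only: e der_prem singleton_iff twf.simps)
    qed
    have ok: "hyp_ok ?G" using swf env xs Wdef_tms[OF h vt1] by (intro hyp_ok_K wfs_scomp_shift wfs_up tms_shift) auto
    have ok': "goal_ok ?E1" unfolding E1
      by (rule goal_ok_K) (use IEx.prems env xs Wdef_tms[OF h vt1] in \<open>auto intro!: tms_shift twf_up twf_scomp simp del: map_map\<close>)
    \<comment> \<open>The entailment below the quantifier is purely logical, so the tuple outside is
      taken to be empty.\<close>
    have "der (WS [] [] \<union> bq p \<rho>s (sh 1 zs) ` {?G}) (bq p \<rho>s (sh 1 zs) ?E1)"
      by (rule bq_mono[OF tms_shift[OF zs] _ _ ok']) (use ok G in \<open>auto simp: tms_def intro: der_mono\<close>)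
    then have "der (insert ?F (isubst (shift 1) ` (WS \<sigma>s us \<union> WS (hat p \<rho>s) zs))) (isubst (shift 1) (bq p \<rho>s zs ?E))"
      unfolding sE by (rule der_cut) (use 1 in auto)
    then have "der (insert (IEx ?F) (WS \<sigma>s us \<union> WS (hat p \<rho>s) zs)) (bq p \<rho>s zs ?E)"
      by (rule der_exE) (use swf env xs tc in \<open>auto intro!: wff_K wfs_up tms_shift twf_up\<close>)
    then show ?thesis by (simp add: K_IEx)
  qed
  then show ?case using Wc by (auto simp: distributes_def)
qed (rule distributes_bang; simp)+

subsection \<open>Witnessable entailments\<close>

definition KK :: "(nat \<Rightarrow> 'c tm) \<Rightarrow> ('c, 'p) ifm list \<Rightarrow> 'c tm list \<Rightarrow> 'c tm list \<Rightarrow> ('c, 'p) ifm list" where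
  "KK e \<Gamma> xs ys = interp_ctx p (map (isubst e) \<Gamma>) xs ys"

abbreviation P :: "('c, 'p) ifm list \<Rightarrow> ty list" where "P \<equiv> ctx_pos p"
abbreviation N :: "('c, 'p) ifm list \<Rightarrow> ty list" where "N \<equiv> ctx_neg p"

lemma KK_Nil [simp]: "KK e [] xs ys = []"
  by (simp add: KK_def)

lemma KK_Cons: "length xs = length (pos A) \<Longrightarrow> length ys = length (neg A) \<Longrightarrow>
    KK e (A # \<Gamma>) (xs @ us) (ys @ vs) = K e A xs ys # KK e \<Gamma> us vs"
  by (simp add: KK_def interp_circ_K Let_def)

lemma ctx_simps [simp]:
  "P [] = []" "N [] = []" "P (A # \<Gamma>) = pos A @ P \<Gamma>" "N (A # \<Gamma>) = neg A @ N \<Gamma>"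
  "P (\<Gamma> @ \<Delta>) = P \<Gamma> @ P \<Delta>" "N (\<Gamma> @ \<Delta>) = N \<Gamma> @ N \<Delta>"
  "P (map (isubst \<sigma>) \<Gamma>) = P \<Gamma>" "N (map (isubst \<sigma>) \<Gamma>) = N \<Gamma>"
  by (simp_all add: ctx_pos_def ctx_neg_def o_def)

lemma KK_single: "length xs = length (pos A) \<Longrightarrow> length ys = length (neg A) \<Longrightarrow> KK e [A] xs ys = [K e A xs ys]"
  using KK_Cons[of xs A ys e "[]" "[]" "[]"] by simp

lemma KK_append: "xs \<in> tup (P \<Gamma>) \<Longrightarrow> ys \<in> tup (N \<Gamma>) \<Longrightarrow>
    KK e (\<Gamma> @ \<Delta>) (xs @ us) (ys @ vs) = KK e \<Gamma> xs ys @ KK e \<Delta> us vs"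
proof (induction \<Gamma> arbitrary: xs ys)
  case (Cons A \<Gamma>)
  obtain x x' where x: "xs = x @ x'" "x \<in> tup (pos A)" "x' \<in> tup (P \<Gamma>)"
    using Cons.prems(1) by (auto elim: tms_splitE)
  obtain y y' where y: "ys = y @ y'" "y \<in> tup (neg A)" "y' \<in> tup (N \<Gamma>)"
    using Cons.prems(2) by (auto elim: tms_splitE)
  show ?case using Cons.IH[OF x(3) y(3)] x y by (simp add: KK_Cons tms_length)
qed (auto simp: tms_def)

lemma KK_isubst [simp]: "KK e (map (isubst \<sigma>) \<Gamma>) xs ys = KK (scomp e \<sigma>) \<Gamma> xs ys"
  by (simp add: KK_def)

lemma KK_ConsE:
  assumes "xs \<in> tup (P (A # \<Gamma>))" and "ys \<in> tup (N (A # \<Gamma>))"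
  obtains x x' y y' where "xs = x @ x'" "x \<in> tup (pos A)" "x' \<in> tup (P \<Gamma>)"
    "ys = y @ y'" "y \<in> tup (neg A)" "y' \<in> tup (N \<Gamma>)"
    "\<And>e. KK e (A # \<Gamma>) xs ys = K e A x y # KK e \<Gamma> x' y'"
proof -
  obtain x x' where x: "xs = x @ x'" "x \<in> tup (pos A)" "x' \<in> tup (P \<Gamma>)"
    using assms(1) by (auto elim: tms_splitE)
  obtain y y' where y: "ys = y @ y'" "y \<in> tup (neg A)" "y' \<in> tup (N \<Gamma>)"
    using assms(2) by (auto elim: tms_splitE)
  show thesis using x y by (intro that[of x x' y y']) (simp_all add: KK_Cons tms_length)
qed

lemma KK_ok:
  assumes "\<forall>A \<in> set \<Gamma>. swf A" "wfs e" "xs \<in> tup (P \<Gamma>)" "ys \<in> tup (N \<Gamma>)" "F \<in> set (KK e \<Gamma> xs ys)"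
  shows "hyp_ok F \<and> goal_ok F"
  using assms
proof (induction \<Gamma> arbitrary: xs ys)
  case (Cons A \<Gamma>)
  show ?case
  proof (rule KK_ConsE[OF Cons.prems(3,4)])
    fix x x' y y'
    assume "x \<in> tup (pos A)" "x' \<in> tup (P \<Gamma>)" "y \<in> tup (neg A)" "y' \<in> tup (N \<Gamma>)"
      "\<And>e. KK e (A # \<Gamma>) xs ys = K e A x y # KK e \<Gamma> x' y'"
    then show ?thesis using Cons.prems Cons.IH[of x' y'] by (auto intro: hyp_ok_K goal_ok_K)
  qed
qed simp

lemmas KK_hyp_ok = KK_ok[THEN conjunct1]
lemmas KK_wff = KK_hyp_ok[THEN hyp_ok_wff]

lemma iconj_Cons: "Fs \<noteq> [] \<Longrightarrow> iconj (F # Fs) = And F (iconj Fs)"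
  by (cases Fs) auto

text \<open>A nonempty context behaves like the conjunction of its members, which transfers
  \<open>merges_ex\<close> and \<open>distributes_ex\<close> to contexts. The empty conjunction is
  an implication with counterwitness types \<open>hat p (hat p [])\<close>, so empty contexts are
  treated apart.\<close>

lemma iconj_ctx: "\<Gamma> \<noteq> [] \<Longrightarrow> pos (iconj \<Gamma>) = P \<Gamma> \<and> neg (iconj \<Gamma>) = N \<Gamma> \<and> (swf (iconj \<Gamma>) \<longleftrightarrow> (\<forall>A \<in> set \<Gamma>. swf A))"
  by (induction \<Gamma> rule: iconj.induct) auto

lemma K_iconj: "\<Gamma> \<noteq> [] \<Longrightarrow> xs \<in> tup (P \<Gamma>) \<Longrightarrow> ys \<in> tup (N \<Gamma>) \<Longrightarrow> K e (iconj \<Gamma>) xs ys = iconj (KK e \<Gamma> xs ys)"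
proof (induction \<Gamma> arbitrary: xs ys rule: list_nonempty_induct)
  case (single A)
  then show ?case by (simp add: KK_single tms_length)
next
  case (cons A \<Gamma>)
  show ?case
  proof (rule KK_ConsE[OF cons.prems])
    fix x x' y y'
    assume 1: "xs = x @ x'" "x \<in> tup (pos A)" "x' \<in> tup (P \<Gamma>)" "ys = y @ y'" "y \<in> tup (neg A)" "y' \<in> tup (N \<Gamma>)"
      "\<And>e. KK e (A # \<Gamma>) xs ys = K e A x y # KK e \<Gamma> x' y'"
    have "KK e \<Gamma> x' y' \<noteq> []" using cons.hyps by (cases \<Gamma>) (simp_all add: KK_def Let_def)
    then have "iconj (KK e (A # \<Gamma>) xs ys) = And (K e A x y) (K e (iconj \<Gamma>) x' y')"
      using cons.IH[OF 1(3,6)] by (simp add: 1(7) iconj_Cons)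
    then show ?thesis using 1 cons.hyps by (simp add: iconj_Cons K_And tms_length)
  qed
qed

lemma map_isubst_KK:
  "\<forall>A \<in> set \<Gamma>. swf A \<Longrightarrow> wfs e \<Longrightarrow> (\<And>i. wft (\<sigma> i)) \<Longrightarrow> xs \<in> tup (P \<Gamma>) \<Longrightarrow> ys \<in> tup (N \<Gamma>) \<Longrightarrow>
    map (isubst \<sigma>) (KK e \<Gamma> xs ys) = KK (scomp \<sigma> e) \<Gamma> (map (tsubst \<sigma>) xs) (map (tsubst \<sigma>) ys)"
proof (induction \<Gamma> arbitrary: xs ys)
  case (Cons A \<Gamma>)
  show ?case
  proof (rule KK_ConsE[OF Cons.prems(4,5)])
    fix x x' y y'
    assume "xs = x @ x'" "x \<in> tup (pos A)" "x' \<in> tup (P \<Gamma>)"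
      "ys = y @ y'" "y \<in> tup (neg A)" "y' \<in> tup (N \<Gamma>)"
      "\<And>e. KK e (A # \<Gamma>) xs ys = K e A x y # KK e \<Gamma> x' y'"
    then show ?thesis using Cons.prems Cons.IH[of x' y'] by (simp add: KK_Cons isubst_K tms_length)
  qed
qed simp

lemma isubst_KK:
  "\<forall>A \<in> set \<Gamma>. swf A \<Longrightarrow> wfs e \<Longrightarrow> (\<And>i. wft (\<sigma> i)) \<Longrightarrow> xs \<in> tup (P \<Gamma>) \<Longrightarrow> ys \<in> tup (N \<Gamma>) \<Longrightarrow>
    isubst \<sigma> ` set (KK e \<Gamma> xs ys) = set (KK (scomp \<sigma> e) \<Gamma> (map (tsubst \<sigma>) xs) (map (tsubst \<sigma>) ys))"
  using map_isubst_KK by (metis list.set_map)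

lemma KK_peq:
  "\<forall>A \<in> set \<Gamma>. swf A \<Longrightarrow> wfs e \<Longrightarrow> xs \<in> tup (P \<Gamma>) \<Longrightarrow> ys \<in> tup (N \<Gamma>) \<Longrightarrow> list_all2 peq ys ys' \<Longrightarrow>
    F \<in> set (KK e \<Gamma> xs ys') \<Longrightarrow> der (set (KK e \<Gamma> xs ys)) F"
proof (induction \<Gamma> arbitrary: xs ys ys')
  case (Cons A \<Gamma>)
  show ?case
  proof (rule KK_ConsE[OF Cons.prems(3,4)])
    fix x x' y y'
    assume x: "xs = x @ x'" "x \<in> tup (pos A)" "x' \<in> tup (P \<Gamma>)"
      "ys = y @ y'" "y \<in> tup (neg A)" "y' \<in> tup (N \<Gamma>)"
      "\<And>e. KK e (A # \<Gamma>) xs ys = K e A x y # KK e \<Gamma> x' y'"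
    then obtain z z' where z: "ys' = z @ z'" "list_all2 peq y z" "list_all2 peq y' z'"
      using Cons.prems(5) by (auto simp: list_all2_append1)
    have "length z = length (neg A)" using z x by (auto dest: list_all2_lengthD simp: tms_length)
    then have "KK e (A # \<Gamma>) xs ys' = K e A x z # KK e \<Gamma> x' z'"
      using x z by (simp add: KK_Cons tms_length)
    moreover have "der {K e A x y} (K e A x z)"
      by (rule K_peq) (use x z Cons.prems in \<open>auto intro: peq_refl_list simp: tms_length\<close>)
    ultimately show ?thesis using Cons.IH[OF _ Cons.prems(2) x(3,6) z(3)] Cons.prems x(7) by (auto intro: der_mono)
  qed
qed simp

text \<open>
  Only instances by terms of the source theory are admitted, since \<open>A5\<close> speaks about source formulas.
  Quantifying over all of them makes the quantifier rules, which move a variable, uniform in \<open>\<gamma>\<close> and \<open>a\<close>.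
\<close>

definition witnesses :: "('c, 'p) ifm list \<Rightarrow> ('c, 'p) ifm list \<Rightarrow> ('c tm list \<Rightarrow> 'c tm list) \<Rightarrow> ('c tm list \<Rightarrow> 'c tm list) \<Rightarrow> bool" where
  "witnesses \<Gamma> \<Delta> \<gamma> a \<longleftrightarrow> Wdef (P \<Gamma> @ N \<Delta>) (N \<Gamma>) \<gamma> \<and> Wdef (P \<Gamma>) (P \<Delta>) a \<and>
    (\<forall>e xs ws F. wfs e \<longrightarrow> xs \<in> tup (P \<Gamma>) \<longrightarrow> ws \<in> tup (N \<Delta>) \<longrightarrow> F \<in> set (KK e \<Delta> (a xs) ws) \<longrightarrow>
      der (WS (P \<Gamma>) xs \<union> WS (N \<Delta>) ws \<union> set (KK e \<Gamma> xs (\<gamma> (xs @ ws)))) F)"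

lemma witnessesD:
  assumes "witnesses \<Gamma> \<Delta> \<gamma> a"
  shows "Wdef (P \<Gamma> @ N \<Delta>) (N \<Gamma>) \<gamma>" and "Wdef (P \<Gamma>) (P \<Delta>) a"
    and "\<And>e xs ws F. wfs e \<Longrightarrow> xs \<in> tup (P \<Gamma>) \<Longrightarrow> ws \<in> tup (N \<Delta>) \<Longrightarrow> F \<in> set (KK e \<Delta> (a xs) ws) \<Longrightarrow>
      der (WS (P \<Gamma>) xs \<union> WS (N \<Delta>) ws \<union> set (KK e \<Gamma> xs (\<gamma> (xs @ ws)))) F"
  using assms unfolding witnesses_def by blast+

definition ent :: "('c, 'p) ifm list \<Rightarrow> ('c, 'p) ifm list \<Rightarrow> bool" where
  "ent \<Gamma> \<Delta> \<longleftrightarrow> (\<forall>A \<in> set \<Gamma> \<union> set \<Delta>. swf A) \<and> (\<exists>\<gamma> a. witnesses \<Gamma> \<Delta> \<gamma> a)"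

lemma entI:
  assumes "\<forall>A \<in> set \<Gamma> \<union> set \<Delta>. swf A" and "Wdef (P \<Gamma> @ N \<Delta>) (N \<Gamma>) \<gamma>" and "Wdef (P \<Gamma>) (P \<Delta>) a"
    and "\<And>e xs ws F. wfs e \<Longrightarrow> xs \<in> tup (P \<Gamma>) \<Longrightarrow> ws \<in> tup (N \<Delta>) \<Longrightarrow> F \<in> set (KK e \<Delta> (a xs) ws) \<Longrightarrow>
      der (WS (P \<Gamma>) xs \<union> WS (N \<Delta>) ws \<union> set (KK e \<Gamma> xs (\<gamma> (xs @ ws)))) F"
  shows "ent \<Gamma> \<Delta>"
  using assms unfolding ent_def witnesses_def by blast

lemma ent_swf: "ent \<Gamma> \<Delta> \<Longrightarrow> A \<in> set \<Gamma> \<union> set \<Delta> \<Longrightarrow> swf A"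
  by (auto simp: ent_def)

text \<open>Witnesses compose forwards and counterwitnesses backwards.\<close>

lemma ent_comp:
  assumes "ent \<Gamma> \<Delta>" and "ent \<Delta> \<Theta>"
  shows "ent \<Gamma> \<Theta>"
proof -
  obtain g a where ga: "witnesses \<Gamma> \<Delta> g a" using assms(1) by (auto simp: ent_def)
  note g = witnessesD(1)[OF ga] and a = witnessesD(2)[OF ga] and 1 = witnessesD(3)[OF ga]
  obtain h b where hb: "witnesses \<Delta> \<Theta> h b" using assms(2) by (auto simp: ent_def)
  note h = witnessesD(1)[OF hb] and b = witnessesD(2)[OF hb] and 2 = witnessesD(3)[OF hb]
  let ?m = "length (P \<Gamma>)"
  \<comment> \<open>The counterwitness with which the second entailment challenges \<Delta>, at the
    witness that the first one provides for \<Delta>.\<close>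
  let ?k = "\<lambda>v. h (a (take ?m v) @ drop ?m v)"
  have k: "Wdef (P \<Gamma> @ N \<Theta>) (N \<Delta>) ?k"
    by (rule Wdef_comp[OF Wdef_append[OF Wdef_comp[OF Wdef_take a] Wdef_drop] h])
  have gk: "Wdef (P \<Gamma> @ N \<Theta>) (N \<Gamma>) (\<lambda>v. g (take ?m v @ ?k v))"
    by (rule Wdef_comp[OF Wdef_append[OF Wdef_take k] g])
  show ?thesis
  proof (rule entI[OF _ gk Wdef_comp[OF a b]])
    show "\<forall>A \<in> set \<Gamma> \<union> set \<Theta>. swf A" using assms ent_swf by blast
    fix e xs ws F
    assume env: "wfs e" and xs: "xs \<in> TM ?m" and ws: "ws \<in> tup (N \<Theta>)" and F: "F \<in> set (KK e \<Theta> (b (a xs)) ws)"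
    have xw: "xs @ ws \<in> tup (P \<Gamma> @ N \<Theta>)" using xs ws by auto
    have tk: "?k (xs @ ws) \<in> tup (N \<Delta>)" by (rule Wdef_tms[OF k xw])
    have e: "take ?m (xs @ ws) = xs" "drop ?m (xs @ ws) = ws" using xs by (auto simp: tms_length)
    let ?H = "WS (P \<Gamma>) xs \<union> WS (N \<Theta>) ws \<union> set (KK e \<Gamma> xs (g (take ?m (xs @ ws) @ ?k (xs @ ws))))"
    show "der ?H F"
    proof (rule der_cut[OF 2[OF env Wdef_tms[OF a xs] ws F]])
      fix G assume G: "G \<in> WS (P \<Delta>) (a xs) \<union> WS (N \<Theta>) ws \<union> set (KK e \<Delta> (a xs) (h (a xs @ ws)))" "wff G"
      consider "G \<in> WS (P \<Delta>) (a xs)" | "G \<in> WS (N \<Theta>) ws" | "G \<in> set (KK e \<Delta> (a xs) (?k (xs @ ws)))"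
        using G(1) unfolding e by blast
      then show "der ?H G"
      proof cases
        case 1
        then show ?thesis using Wdef_W[OF a xs] by (auto intro: der_mono)
      next
        case 2
        then show ?thesis using G by (auto intro: der_prem)
      next
        case 3
        have WW: "WS (P \<Gamma> @ N \<Theta>) (xs @ ws) = WS (P \<Gamma>) xs \<union> WS (N \<Theta>) ws"
          using xs by (simp add: WS_append tms_length)
        show ?thesis
        proof (rule der_cut[OF 1[OF env xs tk 3]])
          fix G assume "G \<in> WS (P \<Gamma>) xs \<union> WS (N \<Delta>) (?k (xs @ ws)) \<union> set (KK e \<Gamma> xs (g (xs @ ?k (xs @ ws))))" "wff G"
          then show "der ?H G" using Wdef_W[OF k xw, of G] unfolding WW e by (auto intro: der_prem der_mono)
        qed
      qed
    qed
  qed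
qed

lemma Wdef_Nil: "Wdef \<sigma>s [] (\<lambda>_. [])"
  by (rule Wdef_const) auto

lemma der_iconj_KK:
  assumes "\<forall>A \<in> set \<Gamma>. swf A" "wfs e" "xs \<in> tup (P \<Gamma>)" "ys \<in> tup (N \<Gamma>)" "set (KK e \<Gamma> xs ys) \<subseteq> H"
  shows "der H (iconj (KK e \<Gamma> xs ys))"
  using assms(5) KK_wff[OF assms(1-4)] by (auto intro!: der_iconjI der_prem)

definition merges_ctx :: "('c, 'p) ifm list \<Rightarrow> ('c tm list \<Rightarrow> 'c tm list) \<Rightarrow> bool" where
  "merges_ctx \<Gamma> M \<longleftrightarrow> Wdef (N \<Gamma> @ N \<Gamma>) (N \<Gamma>) M \<and> (\<forall>e xs y1 y2 F. wfs e \<longrightarrow> xs \<in> tup (P \<Gamma>) \<longrightarrow>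
    y1 \<in> tup (N \<Gamma>) \<longrightarrow> y2 \<in> tup (N \<Gamma>) \<longrightarrow> F \<in> set (KK e \<Gamma> xs y1) \<union> set (KK e \<Gamma> xs y2) \<longrightarrow>
    der (WS (N \<Gamma>) y1 \<union> WS (N \<Gamma>) y2 \<union> set (KK e \<Gamma> xs (M (y1 @ y2)))) F)"

lemma merges_ctx_ex:
  assumes "\<forall>A \<in> set \<Gamma>. swf A"
  shows "\<exists>M. merges_ctx \<Gamma> M"
proof (cases "\<Gamma> = []")
  case True
  then show ?thesis using Wdef_Nil[of "[]"] by (auto simp: merges_ctx_def)
next
  case False
  note C = iconj_ctx[OF False]
  obtain M where M: "merges (iconj \<Gamma>) M" using merges_ex C assms by blast
  then have W: "Wdef (N \<Gamma> @ N \<Gamma>) (N \<Gamma>) M" using C by (simp add: merges_def)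
  have "der (WS (N \<Gamma>) y1 \<union> WS (N \<Gamma>) y2 \<union> set (KK e \<Gamma> xs (M (y1 @ y2)))) F" (is "der ?H F")
    if h: "wfs e" "xs \<in> tup (P \<Gamma>)" "y1 \<in> tup (N \<Gamma>)" "y2 \<in> tup (N \<Gamma>)"
      and F: "F \<in> set (KK e \<Gamma> xs y1) \<union> set (KK e \<Gamma> xs y2)" for e xs y1 y2 F
  proof -
    have t: "M (y1 @ y2) \<in> tup (N \<Gamma>)" by (rule Wdef_tms[OF W]) (use h in auto)
    have 1: "der (WS (N \<Gamma>) y1 \<union> WS (N \<Gamma>) y2 \<union> {iconj (KK e \<Gamma> xs (M (y1 @ y2)))}) (And (iconj (KK e \<Gamma> xs y1)) (iconj (KK e \<Gamma> xs y2)))"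
      using M h C unfolding merges_def K_iconj[OF False h(2,3), symmetric] K_iconj[OF False h(2,4), symmetric] K_iconj[OF False h(2) t, symmetric]
      by simp
    have "der ?H (And (iconj (KK e \<Gamma> xs y1)) (iconj (KK e \<Gamma> xs y2)))"
    proof (rule der_cut[OF 1])
      fix G assume "G \<in> WS (N \<Gamma>) y1 \<union> WS (N \<Gamma>) y2 \<union> {iconj (KK e \<Gamma> xs (M (y1 @ y2)))}" "wff G"
      then show "der ?H G" using der_iconj_KK[OF assms h(1,2) t, of ?H] der_prem[of G ?H] by blast
    qed
    from der_andE[OF this] show ?thesis using F by (auto intro: der_iconj)
  qed
  then show ?thesis using W unfolding merges_ctx_def by blast
qed

text \<open>Both entailments challenge the same \<Gamma>, each with its own counterwitness;
  \<open>M\<close> produces one that is as strong as the two together.\<close>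

lemma ent_pair:
  assumes "ent \<Gamma> \<Delta>" and "ent \<Gamma> \<Theta>"
  shows "ent \<Gamma> (\<Delta> @ \<Theta>)"
proof -
  obtain g a where ga: "witnesses \<Gamma> \<Delta> g a" using assms(1) by (auto simp: ent_def)
  note g = witnessesD(1)[OF ga] and a = witnessesD(2)[OF ga] and 1 = witnessesD(3)[OF ga]
  obtain h b where hb: "witnesses \<Gamma> \<Theta> h b" using assms(2) by (auto simp: ent_def)
  note h = witnessesD(1)[OF hb] and b = witnessesD(2)[OF hb] and 2 = witnessesD(3)[OF hb]
  have swf: "\<forall>A \<in> set \<Gamma>. swf A" using assms ent_swf by blast
  obtain M where MM: "merges_ctx \<Gamma> M" using merges_ctx_ex[OF swf] by blast
  then have W: "Wdef (N \<Gamma> @ N \<Gamma>) (N \<Gamma>) M" by (simp add: merges_ctx_def)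
  let ?m = "length (P \<Gamma>)" and ?d = "length (N \<Delta>)"
  let ?g = "\<lambda>v. g (take ?m v @ take ?d (drop ?m v))" and ?h = "\<lambda>v. h (take ?m v @ drop ?d (drop ?m v))"
  have Wg: "Wdef (P \<Gamma> @ N (\<Delta> @ \<Theta>)) (N \<Gamma>) ?g" unfolding ctx_simps
    by (rule Wdef_comp[OF Wdef_append[OF Wdef_take Wdef_comp[OF Wdef_drop Wdef_take]] g])
  have Wh: "Wdef (P \<Gamma> @ N (\<Delta> @ \<Theta>)) (N \<Gamma>) ?h" unfolding ctx_simps
    by (rule Wdef_comp[OF Wdef_append[OF Wdef_take Wdef_comp[OF Wdef_drop Wdef_drop]] h])
  have WM: "Wdef (P \<Gamma> @ N (\<Delta> @ \<Theta>)) (N \<Gamma>) (\<lambda>v. M (?g v @ ?h v))"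
    by (rule Wdef_comp[OF Wdef_append[OF Wg Wh] W])
  have Wa: "Wdef (P \<Gamma>) (P (\<Delta> @ \<Theta>)) (\<lambda>x. a x @ b x)" unfolding ctx_simps by (rule Wdef_append[OF a b])
  show ?thesis
  proof (rule entI[OF _ WM Wa])
    show "\<forall>A \<in> set \<Gamma> \<union> set (\<Delta> @ \<Theta>). swf A" using assms ent_swf by auto
    fix e xs ws F
    assume env: "wfs e" and xs: "xs \<in> TM ?m" and ws: "ws \<in> tup (N (\<Delta> @ \<Theta>))"
      and F: "F \<in> set (KK e (\<Delta> @ \<Theta>) (a xs @ b xs) ws)"
    obtain w1 w2 where w: "ws = w1 @ w2" "w1 \<in> TM ?d" "w2 \<in> tup (N \<Theta>)"
      using ws by (auto elim: tms_splitE)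
    have xw: "xs @ ws \<in> tup (P \<Gamma> @ N (\<Delta> @ \<Theta>))" unfolding length_append using xs ws by (rule tms_appendI)
    have e: "?g (xs @ ws) = g (xs @ w1)" "?h (xs @ ws) = h (xs @ w2)" using xs w by (auto simp: tms_length)
    have tg: "g (xs @ w1) \<in> tup (N \<Gamma>)" "h (xs @ w2) \<in> tup (N \<Gamma>)"
      using Wdef_tms[OF Wg xw] Wdef_tms[OF Wh xw] unfolding e .
    let ?H = "WS (P \<Gamma>) xs \<union> WS (N (\<Delta> @ \<Theta>)) ws \<union> set (KK e \<Gamma> xs (M (?g (xs @ ws) @ ?h (xs @ ws))))"
    have W': "WS (P \<Gamma>) xs \<union> WS (N (\<Delta> @ \<Theta>)) ws = WS (P \<Gamma> @ N (\<Delta> @ \<Theta>)) (xs @ ws)"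
      "WS (N (\<Delta> @ \<Theta>)) ws = WS (N \<Delta>) w1 \<union> WS (N \<Theta>) w2"
      using xs w by (auto simp: WS_append tms_length)
    have hyp: "der ?H G" if "G \<in> set (KK e \<Gamma> xs (g (xs @ w1))) \<union> set (KK e \<Gamma> xs (h (xs @ w2)))" for G
    proof (rule der_cut[OF MM[unfolded merges_ctx_def, THEN conjunct2, rule_format, OF env[rule_format] xs tg that]])
      fix G assume "G \<in> WS (N \<Gamma>) (g (xs @ w1)) \<union> WS (N \<Gamma>) (h (xs @ w2)) \<union> set (KK e \<Gamma> xs (M (g (xs @ w1) @ h (xs @ w2))))" "wff G"
      then show "der ?H G" using Wdef_W[OF Wg xw, of G] Wdef_W[OF Wh xw, of G] unfolding e W'(1)[symmetric]
        by (auto intro: der_prem der_mono)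
    qed
    have "F \<in> set (KK e \<Delta> (a xs) w1) \<or> F \<in> set (KK e \<Theta> (b xs) w2)"
      using F Wdef_tms[OF a xs] w by (auto simp: KK_append)
    then show "der ?H F"
    proof
      assume F: "F \<in> set (KK e \<Delta> (a xs) w1)"
      show ?thesis by (rule der_cut[OF 1[OF env xs w(2) F]]) (use hyp W'(2) in \<open>auto intro: der_prem\<close>)
    next
      assume F: "F \<in> set (KK e \<Theta> (b xs) w2)"
      show ?thesis by (rule der_cut[OF 2[OF env xs w(3) F]]) (use hyp W'(2) in \<open>auto intro: der_prem\<close>)
    qed
  qed
qed

lemma ent_part:
  assumes "\<forall>A \<in> set \<Gamma> \<union> set \<Delta> \<union> set \<Theta>. swf A"
  shows "ent (\<Gamma> @ \<Delta> @ \<Theta>) \<Delta>"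
proof -
  \<comment> \<open>The discarded parts must be challenged as well; any closed tuples in
    \<open>W\<close> will do.\<close>
  obtain c d where c: "\<And>\<sigma>s. Wdef \<sigma>s (N \<Gamma>) (\<lambda>_. c)" and d: "\<And>\<sigma>s. Wdef \<sigma>s (N \<Theta>) (\<lambda>_. d)"
    using Wdef_inhabitant by metis
  let ?m = "length (P \<Gamma>)" and ?d = "length (P \<Delta>)" and ?n = "length (P (\<Gamma> @ \<Delta> @ \<Theta>))"
  have g: "Wdef (P (\<Gamma> @ \<Delta> @ \<Theta>) @ N \<Delta>) (N (\<Gamma> @ \<Delta> @ \<Theta>)) (\<lambda>v. c @ drop ?n v @ d)"
    using Wdef_append[OF c Wdef_append[OF Wdef_drop[of "P (\<Gamma> @ \<Delta> @ \<Theta>)" "N \<Delta>"] d]] unfolding ctx_simps .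
  have a: "Wdef (P (\<Gamma> @ \<Delta> @ \<Theta>)) (P \<Delta>) (\<lambda>v. take ?d (drop ?m v))"
    using Wdef_comp[OF Wdef_drop[of "P \<Gamma>" "P \<Delta> @ P \<Theta>"] Wdef_take] unfolding ctx_simps .
  show ?thesis
  proof (rule entI[OF _ g a])
    fix e xs ws F
    assume env: "wfs e" and xs: "xs \<in> TM ?n" and ws: "ws \<in> tup (N \<Delta>)"
      and F: "F \<in> set (KK e \<Delta> (take ?d (drop ?m xs)) ws)"
    obtain x yz where x: "xs = x @ yz" "x \<in> TM ?m" "yz \<in> TM (length (P \<Delta>) + length (P \<Theta>))"
      using xs by (auto elim: tms_splitE)
    obtain y z where y: "yz = y @ z" "y \<in> tup (P \<Delta>)" "z \<in> tup (P \<Theta>)"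
      using x(3) by (auto elim: tms_splitE)
    have ct: "c \<in> tup (N \<Gamma>)" using Wdef_tms[OF c[of "[]"], of "[]"] by (simp add: tms_def)
    have "KK e (\<Gamma> @ \<Delta> @ \<Theta>) (x @ y @ z) (c @ ws @ d) = KK e \<Gamma> x c @ KK e \<Delta> y ws @ KK e \<Theta> z d"
      using ct x y ws by (simp add: KK_append)
    moreover have "F \<in> set (KK e \<Delta> y ws)" using F x y by (simp add: tms_length)
    moreover have "wff F" by (rule KK_wff[OF _ env y(2) ws calculation(2)]) (use assms in auto)
    ultimately show "der (WS (P (\<Gamma> @ \<Delta> @ \<Theta>)) xs \<union> WS (N \<Delta>) ws \<union> set (KK e (\<Gamma> @ \<Delta> @ \<Theta>) xs (c @ drop ?n (xs @ ws) @ d))) F"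
      using xs x y by (auto simp: tms_length intro: der_prem)
  qed (use assms in auto)
qed

lemma ent_subset:
  assumes "set \<Delta> \<subseteq> set \<Gamma>" and "\<forall>A \<in> set \<Gamma>. swf A"
  shows "ent \<Gamma> \<Delta>"
  using assms(1)
proof (induction \<Delta>)
  case Nil
  then show ?case using ent_part[of \<Gamma> "[]" "[]"] assms(2) by simp
next
  case (Cons A \<Delta>)
  then obtain \<Gamma>1 \<Gamma>2 where "\<Gamma> = \<Gamma>1 @ [A] @ \<Gamma>2" by (auto simp: in_set_conv_decomp)
  then have "ent \<Gamma> [A]" using ent_part[of \<Gamma>1 "[A]" \<Gamma>2] assms(2) by simp
  then show ?case using ent_pair[of \<Gamma> "[A]" \<Delta>] Cons by simp
qed

text \<open>Cut with a shared context: pairing keeps a copy of \<Gamma> beside \<Delta>.\<close>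

lemma ent_cut:
  assumes "ent \<Gamma> \<Delta>" and "ent \<Delta>' \<Theta>" and "set \<Delta>' \<subseteq> set \<Gamma> \<union> set \<Delta>"
  shows "ent \<Gamma> \<Theta>"
proof -
  have s: "\<forall>A \<in> set \<Gamma> \<union> set \<Delta>. swf A" using assms(1) ent_swf by blast
  have "ent \<Gamma> (\<Gamma> @ \<Delta>)" using ent_pair[OF ent_subset assms(1)] s by simp
  moreover have "ent (\<Gamma> @ \<Delta>) \<Delta>'" using assms(3) s by (intro ent_subset) auto
  ultimately show ?thesis using assms(2) ent_comp by blast
qed

definition distributes_ctx :: "ty list \<Rightarrow> ty list \<Rightarrow> ('c, 'p) ifm list \<Rightarrow> ('c tm list \<Rightarrow> 'c tm list) \<Rightarrow> ('c tm list \<Rightarrow> 'c tm list) \<Rightarrow> bool" where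
  "distributes_ctx \<sigma>s \<rho>s \<Gamma> h c \<longleftrightarrow> Wdef (\<sigma>s @ hat p \<rho>s) (N \<Gamma>) c \<and>
    (\<forall>e xs us zs F. wfs e \<longrightarrow> xs \<in> tup (P \<Gamma>) \<longrightarrow> us \<in> tup \<sigma>s \<longrightarrow> zs \<in> tup (hat p \<rho>s) \<longrightarrow>
      F \<in> set (KK (scomp (shift (length \<rho>s)) e) \<Gamma> (sh (length \<rho>s) xs) (h (sh (length \<rho>s) us @ vars (length \<rho>s)))) \<longrightarrow>
      der (WS \<sigma>s us \<union> WS (hat p \<rho>s) zs \<union> set (KK e \<Gamma> xs (c (us @ zs)))) (bq p \<rho>s zs F))"

lemma distributes_ctxD:
  assumes "distributes_ctx \<sigma>s \<rho>s \<Gamma> h c"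
  shows "Wdef (\<sigma>s @ hat p \<rho>s) (N \<Gamma>) c"
    and "\<And>e xs us zs F. wfs e \<Longrightarrow> xs \<in> tup (P \<Gamma>) \<Longrightarrow> us \<in> tup \<sigma>s \<Longrightarrow> zs \<in> tup (hat p \<rho>s) \<Longrightarrow>
      F \<in> set (KK (scomp (shift (length \<rho>s)) e) \<Gamma> (sh (length \<rho>s) xs) (h (sh (length \<rho>s) us @ vars (length \<rho>s)))) \<Longrightarrow>
      der (WS \<sigma>s us \<union> WS (hat p \<rho>s) zs \<union> set (KK e \<Gamma> xs (c (us @ zs)))) (bq p \<rho>s zs F)"
  using assms unfolding distributes_ctx_def by blast+

text \<open>The context is distributed as one conjunction; its members are then projected below the
  quantifier by \<open>bq_mono\<close>.\<close>

lemma distributes_ctx_ex: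
  assumes swf: "\<forall>A \<in> set \<Gamma>. swf A" and h: "Wdef (\<sigma>s @ \<rho>s) (N \<Gamma>) h"
  shows "\<exists>c. distributes_ctx \<sigma>s \<rho>s \<Gamma> h c"
proof (cases "\<Gamma> = []")
  case True
  then show ?thesis using Wdef_Nil[of "\<sigma>s @ hat p \<rho>s"] by (auto simp: distributes_ctx_def)
next
  case False
  note C = iconj_ctx[OF False]
  let ?r = "length \<rho>s"
  obtain c where c: "distributes \<sigma>s \<rho>s (iconj \<Gamma>) h c" using distributes_ex[of "iconj \<Gamma>" \<sigma>s \<rho>s h] C swf h by auto
  then have W: "Wdef (\<sigma>s @ hat p \<rho>s) (N \<Gamma>) c" using C by (simp add: distributes_def)
  have "der (WS \<sigma>s us \<union> WS (hat p \<rho>s) zs \<union> set (KK e \<Gamma> xs (c (us @ zs)))) (bq p \<rho>s zs F)" (is "der ?H _")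
    if env: "wfs e" and xs: "xs \<in> tup (P \<Gamma>)" and us: "us \<in> tup \<sigma>s" and zs: "zs \<in> tup (hat p \<rho>s)"
      and F: "F \<in> set (KK (scomp (shift ?r) e) \<Gamma> (sh ?r xs) (h (sh ?r us @ vars ?r)))" for e xs us zs F
  proof -
    let ?L = "KK (scomp (shift ?r) e) \<Gamma> (sh ?r xs) (h (sh ?r us @ vars ?r))"
    have uz: "us @ zs \<in> tup (\<sigma>s @ hat p \<rho>s)" and uv: "sh ?r us @ vars ?r \<in> tup (\<sigma>s @ \<rho>s)"
      using us zs tms_shift[OF us] by auto
    note x = tms_shift[OF xs, of ?r] note t = Wdef_tms[OF W uz] Wdef_tms[OF h uv]
    note env' = wfs_scomp_shift[OF env, of ?r]
    have "der (WS \<sigma>s us \<union> WS (hat p \<rho>s) zs \<union> {K e (iconj \<Gamma>) xs (c (us @ zs))})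
       (bq p \<rho>s zs (K (scomp (shift ?r) e) (iconj \<Gamma>) (sh ?r xs) (h (sh ?r us @ vars ?r))))"
      using c env xs us zs C unfolding distributes_def by simp
    then have 1: "der (WS \<sigma>s us \<union> WS (hat p \<rho>s) zs \<union> {iconj (KK e \<Gamma> xs (c (us @ zs)))}) (bq p \<rho>s zs (iconj ?L))"
      unfolding K_iconj[OF False xs t(1)] K_iconj[OF False x t(2)] .
    have L: "der ?H (bq p \<rho>s zs (iconj ?L))"
    proof (rule der_cut[OF 1])
      fix G assume "G \<in> WS \<sigma>s us \<union> WS (hat p \<rho>s) zs \<union> {iconj (KK e \<Gamma> xs (c (us @ zs)))}" "wff G"
      then show "der ?H G" using der_iconj_KK[OF swf env xs t(1), of ?H] der_prem[of G ?H] by blast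
    qed
    have ok: "hyp_ok (iconj ?L)" unfolding K_iconj[OF False x t(2), symmetric]
      by (rule hyp_ok_K) (use C swf env' x t(2) in auto)
    have "der (WS \<sigma>s us \<union> bq p \<rho>s zs ` {iconj ?L}) (bq p \<rho>s zs F)"
    proof (rule bq_mono[OF zs us])
      show "der (WS \<sigma>s (sh ?r us) \<union> WS \<rho>s (vars ?r) \<union> {iconj ?L}) F"
        by (rule der_iconj[OF F der_prem]) (use ok hyp_ok_wff in auto)
    qed (use ok KK_ok[OF swf env' x t(2) F] in auto)
    then show ?thesis
    proof (rule der_cut)
      fix G assume "G \<in> WS \<sigma>s us \<union> bq p \<rho>s zs ` {iconj ?L}" "wff G"
      then show "der ?H G" using L der_prem[of G ?H] by blast
    qed
  qed
  then show ?thesis using W unfolding distributes_ctx_def by blast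
qed

subsection \<open>The logical rules\<close>

lemma ent1E:
  assumes "ent \<Gamma> [A]"
  obtains \<gamma> a where "Wdef (P \<Gamma> @ neg A) (N \<Gamma>) \<gamma>" and "Wdef (P \<Gamma>) (pos A) a"
    and "\<And>e xs ws. wfs e \<Longrightarrow> xs \<in> tup (P \<Gamma>) \<Longrightarrow> ws \<in> tup (neg A) \<Longrightarrow>
      der (WS (P \<Gamma>) xs \<union> WS (neg A) ws \<union> set (KK e \<Gamma> xs (\<gamma> (xs @ ws)))) (K e A (a xs) ws)"
proof -
  obtain \<gamma> a where w: "witnesses \<Gamma> [A] \<gamma> a" using assms by (auto simp: ent_def)
  note 1 = witnessesD(1)[OF w] and 2 = witnessesD(2)[OF w] and 3 = witnessesD(3)[OF w]
  show thesis
  proof (rule that[of \<gamma> a])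
    fix e xs ws
    assume t: "wfs e" "xs \<in> tup (P \<Gamma>)" "ws \<in> tup (neg A)"
    have "KK e [A] (a xs) ws = [K e A (a xs) ws]"
      by (rule KK_single) (use Wdef_tms[OF 2 t(2)] t(3) in \<open>auto simp: tms_length\<close>)
    then show "der (WS (P \<Gamma>) xs \<union> WS (neg A) ws \<union> set (KK e \<Gamma> xs (\<gamma> (xs @ ws)))) (K e A (a xs) ws)"
      using 3[OF t(1,2)] t(3) by simp
  qed (use 1 2 in auto)
qed

lemma ent1I:
  assumes "\<forall>B \<in> set \<Gamma>. swf B" and "swf A"
    and 1: "Wdef (P \<Gamma> @ neg A) (N \<Gamma>) \<gamma>" and 2: "Wdef (P \<Gamma>) (pos A) a"
    and 3: "\<And>e xs ws. wfs e \<Longrightarrow> xs \<in> tup (P \<Gamma>) \<Longrightarrow> ws \<in> tup (neg A) \<Longrightarrow>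
      der (WS (P \<Gamma>) xs \<union> WS (neg A) ws \<union> set (KK e \<Gamma> xs (\<gamma> (xs @ ws)))) (K e A (a xs) ws)"
  shows "ent \<Gamma> [A]"
proof (rule entI)
  fix e xs ws F
  assume t: "wfs e" "xs \<in> tup (P \<Gamma>)" "ws \<in> tup (N [A])" and F: "F \<in> set (KK e [A] (a xs) ws)"
  have "KK e [A] (a xs) ws = [K e A (a xs) ws]"
    by (rule KK_single) (use Wdef_tms[OF 2 t(2)] t(3) in \<open>auto simp: tms_length\<close>)
  then show "der (WS (P \<Gamma>) xs \<union> WS (N [A]) ws \<union> set (KK e \<Gamma> xs (\<gamma> (xs @ ws)))) F"
    using 3[OF t(1,2)] t(3) F by simp
qed (use assms in auto)

lemma ent_andI:
  assumes "swf A" "swf B"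
  shows "ent [A, B] [And A B]"
proof (rule ent1I)
  show "Wdef (P [A, B] @ neg (And A B)) (N [A, B]) (drop (length (P [A, B])))"
    using Wdef_drop[of "P [A, B]" "N [A, B]"] by simp
  show "Wdef (P [A, B]) (pos (And A B)) (\<lambda>x. x)" using Wdef_id by simp
  fix e xs ws
  assume t: "wfs e" "xs \<in> tup (P [A, B])" "ws \<in> tup (neg (And A B))"
  obtain u v where u: "xs = u @ v" "u \<in> tup (pos A)" "v \<in> tup (pos B)"
    using t(2) by (auto elim: tms_splitE)
  obtain y z where y: "ws = y @ z" "y \<in> tup (neg A)" "z \<in> tup (neg B)"
    using t(3) by (auto elim: tms_splitE)
  have "KK e [A, B] xs ws = [K e A u y, K e B v z]" "K e (And A B) xs ws = And (K e A u y) (K e B v z)"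
    unfolding u y using u y by (simp_all add: KK_Cons KK_single K_And tms_length)
  moreover have "drop (length (P [A, B])) (xs @ ws) = ws" using t(2) by (simp add: tms_length)
  moreover have "wff (K e A u y)" "wff (K e B v z)" using assms t(1) u y by (auto intro: wff_K)
  ultimately show "der (WS (P [A, B]) xs \<union> WS (neg (And A B)) ws \<union> set (KK e [A, B] xs (drop (length (P [A, B])) (xs @ ws)))) (K e (And A B) xs ws)"
    by (simp add: der_andI der_prem)
qed (use assms in auto)

lemma ent_andE:
  assumes "swf A" "swf B"
  shows "ent [And A B] [A, B]"
proof (rule entI)
  show "Wdef (P [And A B] @ N [A, B]) (N [And A B]) (drop (length (P [And A B])))"
    using Wdef_drop[of "P [And A B]" "N [A, B]"] by simp
  show "Wdef (P [And A B]) (P [A, B]) (\<lambda>x. x)" using Wdef_id[of "P [A, B]"] by simp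
  fix e xs ws F
  assume t: "wfs e" "xs \<in> tup (P [And A B])" "ws \<in> tup (N [A, B])"
    and F: "F \<in> set (KK e [A, B] xs ws)"
  obtain u v where u: "xs = u @ v" "u \<in> tup (pos A)" "v \<in> tup (pos B)"
    using t(2) by (auto elim: tms_splitE)
  obtain y z where y: "ws = y @ z" "y \<in> tup (neg A)" "z \<in> tup (neg B)"
    using t(3) by (auto elim: tms_splitE)
  have 1: "KK e [A, B] xs ws = [K e A u y, K e B v z]" "KK e [And A B] xs ws = [And (K e A u y) (K e B v z)]"
    unfolding u y using u y by (simp_all add: KK_Cons KK_single K_And tms_length)
  have 2: "drop (length (P [And A B])) (xs @ ws) = ws" using t(2) by (simp add: tms_length)
  have w: "wff (And (K e A u y) (K e B v z))" using assms t(1) u y by (auto intro: wff_K)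
  let ?H = "WS (P [And A B]) xs \<union> WS (N [A, B]) ws \<union> set (KK e [And A B] xs (drop (length (P [And A B])) (xs @ ws)))"
  have "And (K e A u y) (K e B v z) \<in> ?H" unfolding 2 1 by simp
  then have "der ?H (And (K e A u y) (K e B v z))" using w by (rule der_prem)
  from der_andE[OF this] show "der ?H F" using F unfolding 1 by auto
qed (use assms in auto)

text \<open>\<open>IBot\<close> becomes \<open>Bang ABot\<close>, whose counterwitness is a bound
  for the empty tuple and need not itself be empty; \<open>eta\<close> supplies it. The witness of
  \<open>A\<close> is an arbitrary inhabitant.\<close>

lemma ent_bot:
  assumes "swf A"
  shows "ent [IBot] [A]"
proof -
  have n: "neg IBot = hat p []" "pos IBot = []" by (simp_all add: ineg_def ipos_def del: fold_pos_neg)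
  obtain E where E0: "Wdef (tneg gp ABot) (hat p (tneg gp ABot)) E"
    and E1: "\<And>e xs zs. (\<forall>i. wft (e i)) \<Longrightarrow> xs \<in> tup (tpos gp ABot) \<Longrightarrow> zs \<in> tup (tneg gp ABot) \<Longrightarrow>
      der (WS (tneg gp ABot) zs \<union> {J (Bang (asubst e ABot)) xs (E zs)}) (J (asubst e ABot) xs zs)"
    using eta[of ABot] unfolding awf.simps by blast
  have E: "Wdef [] (hat p []) E" using E0 by simp
  have E': "der {K e IBot [] (E [])} IBot" if "wfs e" for e
    using E1[of e "[]" "[]"] that wfs_wft by (simp add: K_def tms_def del: J_simps(6))
  obtain c where c: "Wdef (P [IBot]) (pos A) (\<lambda>_. c)" using Wdef_inhabitant by blast
  show ?thesis
  proof (rule ent1I[OF _ _ _ c])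
    show "Wdef (P [IBot] @ neg A) (N [IBot]) (\<lambda>_. E [])"
      using Wdef_comp[OF Wdef_Nil E] by (simp add: n)
    fix e xs ws
    assume t: "wfs e" "xs \<in> tup (P [IBot])" "ws \<in> tup (neg A)"
    have xs: "xs = []" using t(2) by (simp add: n tms_def)
    have "KK e [IBot] xs (E []) = [K e IBot [] (E [])]"
      unfolding xs by (rule KK_single) (use Wdef_length[OF E] n in auto)
    moreover have "wff (K e A c ws)" using assms t Wdef_tms[OF c t(2)] by (intro wff_K) auto
    ultimately show "der (WS (P [IBot]) xs \<union> WS (neg A) ws \<union> set (KK e [IBot] xs (E []))) (K e A c ws)"
      by (intro der_botE[OF der_mono[OF E'[OF t(1)]]]) simp_all
  qed (use assms in auto)
qed

lemma isubst_inst_K: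
  assumes "swf A" "wfs e" "twf (ilang Is) t" "xs \<in> tup (pos A)" "ys \<in> tup (neg A)"
  shows "isubst (inst [tsubst e t]) (K (up 1 e) A (sh 1 xs) (sh 1 ys)) = K e (isubst (inst [t]) A) xs ys"
proof -
  have t: "wft (tsubst e t)" using assms(2,3) wfs_wft sub_st sublang_twf by (auto simp: twf_tsubst_iff)
  have "isubst (inst [tsubst e t]) (K (up 1 e) A (sh 1 xs) (sh 1 ys)) =
    K (scomp (inst [tsubst e t]) (up 1 e)) A (map (tsubst (inst [tsubst e t])) (sh 1 xs)) (map (tsubst (inst [tsubst e t])) (sh 1 ys))"
    by (rule isubst_K) (use assms t in \<open>auto intro!: tms_shift wfs_up twf_up simp del: map_map\<close>)
  moreover have "scomp (inst [tsubst e t]) (up 1 e) = scomp e (inst [t])"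
    by (rule ext) (auto simp: scomp_def up_def inst_def)
  moreover have "map (tsubst (inst [tsubst e t])) (sh 1 zs) = zs" for zs by (simp add: map_idI)
  ultimately show ?thesis by (simp only: K_isubst)
qed

text \<open>\<open>eta\<close> is applied to the \<open>AAll\<close> below the exponential, and the
  quantifier is instantiated afterwards. Witnesses are uniform in quantified variables, so they do
  not depend on \<open>t\<close>.\<close>

lemma ent_allL:
  assumes "swf A" and t: "twf (ilang Is) t"
  shows "ent [IAll A] [isubst (inst [t]) A]"
proof -
  have A: "awf (ilang Is) (AAll (girard A))" using assms by simp
  obtain E where E: "Wdef (neg A) (hat p (neg A)) E"
    and E': "\<And>e xs zs. wfs e \<Longrightarrow> xs \<in> tup (pos A) \<Longrightarrow> zs \<in> tup (neg A) \<Longrightarrow>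
      der (WS (neg A) zs \<union> {K e (IAll A) xs (E zs)}) (IAll (K (up 1 e) A (sh 1 xs) (sh 1 zs)))"
    using eta[OF A] wfs_wft by (auto simp: K_def simp del: J_simps(6))
  show ?thesis
  proof (rule ent1I)
    show "Wdef (P [IAll A] @ neg (isubst (inst [t]) A)) (N [IAll A]) (\<lambda>v. E (drop (length (P [IAll A])) v))"
      using Wdef_comp[OF Wdef_drop E] by simp
    show "Wdef (P [IAll A]) (pos (isubst (inst [t]) A)) (\<lambda>x. x)" using Wdef_id by simp
    fix e xs ws
    assume h: "wfs e" "xs \<in> tup (P [IAll A])" "ws \<in> tup (neg (isubst (inst [t]) A))"
    then have xs: "xs \<in> tup (pos A)" and ws: "ws \<in> tup (neg A)" by auto
    have e: "KK e [IAll A] xs (E (drop (length (P [IAll A])) (xs @ ws))) = [K e (IAll A) xs (E ws)]"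
      using xs Wdef_tms[OF E ws] by (simp add: KK_single tms_length)
    have tt: "wft (tsubst e t)" using h(1) t wfs_wft sub_st sublang_twf by (auto simp: twf_tsubst_iff)
    show "der (WS (P [IAll A]) xs \<union> WS (neg (isubst (inst [t]) A)) ws \<union> set (KK e [IAll A] xs (E (drop (length (P [IAll A])) (xs @ ws)))))
        (K e (isubst (inst [t]) A) xs ws)"
      unfolding e isubst_inst_K[OF assms(1) h(1) t xs ws, symmetric]
      by (rule der_allE[OF der_mono[OF E'[OF h(1) xs ws]] tt]) auto
  qed (use assms in \<open>auto simp: iwf_isubst_iff\<close>)
qed

lemma ent_exR:
  assumes "swf A" and t: "twf (ilang Is) t"
  shows "ent [isubst (inst [t]) A] [IEx A]"
proof (rule ent1I)
  let ?A = "isubst (inst [t]) A"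
  show "Wdef (P [?A] @ neg (IEx A)) (N [?A]) (drop (length (P [?A])))"
    using Wdef_drop[of "P [?A]" "neg A"] by simp
  show "Wdef (P [?A]) (pos (IEx A)) (\<lambda>x. x)" using Wdef_id by simp
  fix e xs ws
  assume h: "wfs e" "xs \<in> tup (P [?A])" "ws \<in> tup (neg (IEx A))"
  then have xs: "xs \<in> tup (pos A)" and ws: "ws \<in> tup (neg A)" by auto
  have e: "KK e [?A] xs (drop (length (P [?A])) (xs @ ws)) = [K e ?A xs ws]"
    using xs ws by (simp add: KK_single[of _ ?A] tms_length del: K_isubst)
  have tt: "wft (tsubst e t)" using h(1) t wfs_wft sub_st sublang_twf by (auto simp: twf_tsubst_iff)
  have "wff (K e ?A xs ws)" by (rule wff_K) (use assms h(1) xs ws in \<open>auto simp: iwf_isubst_iff\<close>)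
  then have "der (WS (P [?A]) xs \<union> WS (neg (IEx A)) ws \<union> set (KK e [?A] xs (drop (length (P [?A])) (xs @ ws))))
     (isubst (inst [tsubst e t]) (K (up 1 e) A (sh 1 xs) (sh 1 ws)))"
    unfolding e isubst_inst_K[OF assms(1) h(1) t xs ws] by (auto intro!: der_prem simp del: K_isubst)
  then show "der (WS (P [?A]) xs \<union> WS (neg (IEx A)) ws \<union> set (KK e [?A] xs (drop (length (P [?A])) (xs @ ws)))) (K e (IEx A) xs ws)"
    unfolding K_IEx using tt by (rule der_exI)
qed (use assms in \<open>auto simp: iwf_isubst_iff\<close>)

text \<open>The premise is used at the environment \<open>up 1 e\<close>, which keeps the
  eigenvariable fresh, and \<open>g\<close> and \<open>a\<close> commute with the shift.\<close>

lemma ent_exL: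
  assumes "ent (map (isubst (shift 1)) \<Gamma> @ [A]) [isubst (shift 1) B]"
  shows "ent (\<Gamma> @ [IEx A]) [B]"
proof -
  let ?G = "map (isubst (shift 1)) \<Gamma> @ [A]"
  obtain g a where g: "Wdef (P \<Gamma> @ pos A @ neg B) (N \<Gamma> @ neg A) g" and a: "Wdef (P \<Gamma> @ pos A) (pos B) a"
    and 1: "\<And>e xs ws. wfs e \<Longrightarrow> xs \<in> TM (length (P \<Gamma>) + length (pos A)) \<Longrightarrow> ws \<in> tup (neg B) \<Longrightarrow>
      der (WS (P \<Gamma> @ pos A) xs \<union> WS (neg B) ws \<union> set (KK e ?G xs (g (xs @ ws)))) (K (scomp e (shift 1)) B (a xs) ws)"
    using assms by (rule ent1E) simp
  have "\<forall>C \<in> set ?G \<union> {isubst (shift 1) B}. swf C" using ent_swf[OF assms] by auto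
  then have swf: "\<forall>A \<in> set \<Gamma>. swf A" "swf A" "swf B" by (auto simp: iwf_isubst_iff)
  show ?thesis
  proof (rule ent1I[where \<gamma> = g and a = a])
    fix e xs ws
    assume env: "wfs e" and xs': "xs \<in> tup (P (\<Gamma> @ [IEx A]))" and ws: "ws \<in> tup (neg B)"
    obtain u v where u: "xs = u @ v" "u \<in> tup (P \<Gamma>)" "v \<in> tup (pos A)"
      using xs' by (auto elim: tms_splitE)
    have xs: "xs \<in> tup (P \<Gamma> @ pos A)" using xs' by simp
    have xw: "xs @ ws \<in> tup (P \<Gamma> @ pos A @ neg B)" using tms_appendI[OF xs ws] by (simp add: add.assoc)
    have "g (xs @ ws) \<in> TM (length (N \<Gamma>) + length (neg A))" using Wdef_tms[OF g xw] by simp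
    then obtain y z where y: "g (xs @ ws) = y @ z" "y \<in> tup (N \<Gamma>)" "z \<in> tup (neg A)"
      by (rule tms_splitE)
    have sg: "g (sh 1 xs @ sh 1 ws) = sh 1 y @ sh 1 z"
      using Wdef_subst[OF g tms_length[OF xw], of "shift 1"] y(1) by simp
    have sa: "a (sh 1 xs) = sh 1 (a xs)" using Wdef_subst[OF a, of xs "shift 1"] xs by (simp add: tms_length)
    let ?F = "K (up 1 e) A (sh 1 v) (sh 1 z)"
    let ?H = "WS (P \<Gamma> @ pos A) xs \<union> WS (neg B) ws \<union> set (KK e \<Gamma> u y)"
    have "set (KK (up 1 e) ?G (sh 1 xs) (g (sh 1 xs @ sh 1 ws))) =
        insert ?F (set (KK (scomp (shift 1) e) \<Gamma> (sh 1 u) (sh 1 y)))"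
      unfolding sg unfolding u(1) using u y tms_shift[OF u(2), of 1] tms_shift[OF y(2), of 1] scomp_up_shift[of 1 e]
      by (simp add: KK_append KK_single tms_length)
    also have "\<dots> = insert ?F (isubst (shift 1) ` set (KK e \<Gamma> u y))"
      using isubst_KK[OF swf(1) env _ u(2) y(2), of "shift 1"] by simp
    finally have k: "set (KK (up 1 e) ?G (sh 1 xs) (g (sh 1 xs @ sh 1 ws))) = insert ?F (isubst (shift 1) ` set (KK e \<Gamma> u y))" .
    have H: "insert ?F (isubst (shift 1) ` ?H) =
        WS (P \<Gamma> @ pos A) (sh 1 xs) \<union> WS (neg B) (sh 1 ws) \<union> set (KK (up 1 e) ?G (sh 1 xs) (g (sh 1 xs @ sh 1 ws)))"
      unfolding k image_Un isubst_WS by blast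
    have "der (insert ?F (isubst (shift 1) ` ?H)) (K (scomp (up 1 e) (shift 1)) B (a (sh 1 xs)) (sh 1 ws))"
      unfolding H by (rule 1) (use wfs_up[OF env] tms_shift[OF xs, of 1] tms_shift[OF ws] in auto)
    also have "K (scomp (up 1 e) (shift 1)) B (a (sh 1 xs)) (sh 1 ws) = isubst (shift 1) (K e B (a xs) ws)"
      using isubst_shift_K[OF swf(3) env Wdef_tms[OF a xs] ws, of 1] scomp_up_shift[of 1 e] by (simp add: sa[simplified])
    finally have "der (insert (IEx ?F) ?H) (K e B (a xs) ws)"
      by (rule der_exE) (use swf env u y in \<open>auto intro!: wff_K tms_shift twf_up\<close>)
    moreover have "set (KK e (\<Gamma> @ [IEx A]) xs (g (xs @ ws))) = insert (IEx ?F) (set (KK e \<Gamma> u y))"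
      unfolding y u using u y by (simp add: KK_append KK_single tms_length K_IEx)
    ultimately show "der (WS (P (\<Gamma> @ [IEx A])) xs \<union> WS (neg B) ws \<union> set (KK e (\<Gamma> @ [IEx A]) xs (g (xs @ ws)))) (K e B (a xs) ws)"
      by simp
  qed (use swf g a in auto)
qed

text \<open>Let \<open>f\<close>, \<open>g\<close> witness the implication and \<open>x\<close>
  witness \<open>A\<close>. Then \<open>f\<close> applied to \<open>x\<close> witnesses
  \<open>B\<close>, and a challenge \<open>w\<close> to \<open>B\<close> is answered by challenging
  \<open>A\<close> with \<open>g\<close> applied to \<open>x\<close>, \<open>w\<close>, and the
  implication with the bound \<open>E (x @ w)\<close>.\<close>

lemma ent_mp:
  assumes "swf A" "swf B"
  shows "ent [Imp A B, A] [B]"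
proof -
  let ?pa = "pos A" and ?na = "neg A" and ?pb = "pos B" and ?nb = "neg B"
  let ?F = "tarrs ?pa ?pb" and ?G = "tarrs (?pa @ ?nb) ?na"
  have AB: "awf (ilang Is) (Lolli (girard A) (girard B))" using assms by simp
  obtain E where E: "Wdef (?pa @ ?nb) (hat p (?pa @ ?nb)) E"
    and E0: "\<And>e xs zs. (\<forall>i. wft (e i)) \<Longrightarrow> xs \<in> tup (?F @ ?G) \<Longrightarrow> zs \<in> tup (?pa @ ?nb) \<Longrightarrow>
      der (WS (?pa @ ?nb) zs \<union> {J (Bang (asubst e (Lolli (girard A) (girard B)))) xs (E zs)}) (J (asubst e (Lolli (girard A) (girard B))) xs zs)"
    using eta[OF AB] unfolding tpos.simps tneg.simps fold_pos_neg tarrs_tarrs by blast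
  have E1: "der (WS (?pa @ ?nb) (x @ w) \<union> {K e (Imp A B) (f @ g) (E (x @ w))}) (Imp (K e A x (tapp g (x @ w))) (K e B (tapp f x) w))"
    if "wfs e" "f \<in> tup ?F" "g \<in> tup ?G" "x \<in> tup ?pa" "w \<in> tup ?nb" for e f g x w
  proof -
    have "der (WS (?pa @ ?nb) (x @ w) \<union> {J (Bang (asubst e (Lolli (girard A) (girard B)))) (f @ g) (E (x @ w))}) (J (asubst e (Lolli (girard A) (girard B))) (f @ g) (x @ w))"
      by (rule E0) (use that wfs_wft in auto)
    then show ?thesis using that by (simp add: K_def J_Lolli tms_length del: J_simps(6))
  qed
  let ?m = "length (?F @ ?G)" and ?n = "length ((?F @ ?G) @ ?pa)"
  let ?f = "\<lambda>v. take (length ?F) (take ?m v)" and ?g = "\<lambda>v. drop (length ?F) (take ?m v)" and ?x = "\<lambda>v. drop ?m v"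
  have f: "Wdef ((?F @ ?G) @ ?pa) ?F ?f" by (rule Wdef_comp[OF Wdef_take Wdef_take])
  have g: "Wdef ((?F @ ?G) @ ?pa) ?G ?g" by (rule Wdef_comp[OF Wdef_take Wdef_drop])
  have x: "Wdef ((?F @ ?G) @ ?pa) ?pa ?x" by (rule Wdef_drop)
  have xw: "Wdef (((?F @ ?G) @ ?pa) @ ?nb) (?pa @ ?nb) (\<lambda>v. ?x (take ?n v) @ drop ?n v)"
    by (rule Wdef_append[OF Wdef_comp[OF Wdef_take x] Wdef_drop])
  have \<gamma>: "Wdef (((?F @ ?G) @ ?pa) @ ?nb) (hat p (?pa @ ?nb) @ ?na)
      (\<lambda>v. E (?x (take ?n v) @ drop ?n v) @ tapp (?g (take ?n v)) (?x (take ?n v) @ drop ?n v))"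
    by (rule Wdef_append[OF Wdef_comp[OF xw E] Wdef_tapp[OF Wdef_comp[OF Wdef_take g] xw]])
  have a: "Wdef ((?F @ ?G) @ ?pa) ?pb (\<lambda>v. tapp (?f v) (?x v))" by (rule Wdef_tapp[OF f x])
  have PN: "P [Imp A B, A] = (?F @ ?G) @ ?pa" "N [Imp A B, A] = hat p (?pa @ ?nb) @ ?na" by simp_all
  show ?thesis
  proof (rule ent1I[where \<gamma> = "\<lambda>v. E (?x (take ?n v) @ drop ?n v) @ tapp (?g (take ?n v)) (?x (take ?n v) @ drop ?n v)"
        and a = "\<lambda>v. tapp (?f v) (?x v)"], unfold PN)
    fix e xs ws
    assume env: "wfs e" and xs: "xs \<in> tup ((?F @ ?G) @ ?pa)" and ws: "ws \<in> tup ?nb"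
    obtain fg x where 1: "xs = fg @ x" "fg \<in> TM (length ?F + length ?G)" "x \<in> tup ?pa"
      using xs unfolding length_append by (rule tms_splitE)
    obtain f g where 2: "fg = f @ g" "f \<in> tup ?F" "g \<in> tup ?G"
      using 1(2) by (rule tms_splitE)
    have l: "length f = length ?F" "length g = length ?G" "length x = length ?pa" using 1 2 tms_length by blast+
    have s: "take ?n (xs @ ws) = xs" "drop ?n (xs @ ws) = ws" "?x xs = x" "?f xs = f" "?g xs = g"
      unfolding 1(1) 2(1) using l by auto
    have tE: "E (x @ ws) \<in> tup (hat p (?pa @ ?nb))" by (rule Wdef_tms[OF E]) (use 1 ws in auto)
    have tg: "tapp g (x @ ws) \<in> tup ?na" using tapp_tms[OF 2(3) tms_appendI[OF 1(3) ws]] by simp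
    have k: "KK e [Imp A B, A] xs (E (x @ ws) @ tapp g (x @ ws)) = [K e (Imp A B) (f @ g) (E (x @ ws)), K e A x (tapp g (x @ ws))]"
      unfolding 1(1) 2(1) using l tE tg by (subst KK_Cons) (auto simp: KK_single tms_length)
    let ?H = "WS ((?F @ ?G) @ ?pa) xs \<union> WS ?nb ws \<union> set (KK e [Imp A B, A] xs (E (x @ ws) @ tapp g (x @ ws)))"
    have w: "wff (K e A x (tapp g (x @ ws)))" using assms env 1 tg by (intro wff_K) auto
    have sub: "WS (?pa @ ?nb) (x @ ws) \<union> {K e (Imp A B) (f @ g) (E (x @ ws))} \<subseteq> ?H"
      unfolding k unfolding 1(1) using 1(3) 2 by (auto simp: WS_append tms_length)
    have "der ?H (K e B (tapp f x) ws)"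
      by (rule der_impE[OF der_mono[OF E1[OF env 2(2,3) 1(3) ws] sub]]) (rule der_prem, use k w in auto)
    then show "der (WS ((?F @ ?G) @ ?pa) xs \<union> WS ?nb ws \<union> set (KK e [Imp A B, A] xs (E (?x (take ?n (xs @ ws)) @ drop ?n (xs @ ws)) @
          tapp (?g (take ?n (xs @ ws))) (?x (take ?n (xs @ ws)) @ drop ?n (xs @ ws))))) (K e B (tapp (?f xs) (?x xs)) ws)"
      unfolding s .
  qed (use assms \<gamma> a in auto)
qed

text \<open>The conclusion quantifies over bounded challenges to \<open>A\<close>. The premise is
  derived for variables as challenge and a fresh eigenvariable, then quantified by
  \<open>bq_mono\<close>; the quantified hypotheses come from \<Gamma> by
  \<open>distributes_ctx_ex\<close>.\<close>

lemma ent_allR: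
  assumes "ent (map (isubst (shift 1)) \<Gamma>) [A]"
  shows "ent \<Gamma> [IAll A]"
proof -
  let ?n = "length (neg A)"
  obtain g a where g: "Wdef (P \<Gamma> @ neg A) (N \<Gamma>) g" and a: "Wdef (P \<Gamma>) (pos A) a"
    and 1: "\<And>e xs ws. wfs e \<Longrightarrow> xs \<in> tup (P \<Gamma>) \<Longrightarrow> ws \<in> TM ?n \<Longrightarrow>
      der (WS (P \<Gamma>) xs \<union> WS (neg A) ws \<union> set (KK (scomp e (shift 1)) \<Gamma> xs (g (xs @ ws)))) (K e A (a xs) ws)"
    using assms by (rule ent1E) simp
  have "\<forall>C \<in> set (map (isubst (shift 1)) \<Gamma>) \<union> {A}. swf C" using ent_swf[OF assms] by auto
  then have swf: "\<forall>A \<in> set \<Gamma>. swf A" "swf A" by (auto simp: iwf_isubst_iff)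
  obtain c where dc: "distributes_ctx (P \<Gamma>) (neg A) \<Gamma> g c" using distributes_ctx_ex[OF swf(1) g] by blast
  note c = distributes_ctxD(1)[OF dc] and d = distributes_ctxD(2)[OF dc]
  show ?thesis
  proof (rule ent1I[where \<gamma> = c and a = a])
    fix e xs zs
    assume env: "wfs e" and xs: "xs \<in> tup (P \<Gamma>)" and "zs \<in> tup (neg (IAll A))"
    then have zs: "zs \<in> tup (hat p (neg A))" by simp
    let ?d = "scomp (shift ?n) e"
    let ?x = "sh ?n xs"
    let ?D = "set (KK ?d \<Gamma> ?x (g (?x @ vars ?n)))"
    let ?F = "K (up 1 ?d) A (sh 1 (sh ?n (a xs))) (sh 1 (vars ?n))"
    note env' = wfs_scomp_shift[OF env, of ?n]
    note x = tms_shift[OF xs, of ?n]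
    have xv: "?x @ vars ?n \<in> tup (P \<Gamma> @ neg A)" using x by auto
    note tg = Wdef_tms[OF g xv]
    have sa: "sh 1 (sh ?n (a xs)) = a (sh 1 ?x)"
      using Wdef_subst[OF a, of xs "shift ?n"] Wdef_subst[OF a, of ?x "shift 1"] xs by (simp add: tms_length)
    have sg: "sh 1 (g (?x @ vars ?n)) = g (sh 1 ?x @ sh 1 (vars ?n))"
      using Wdef_subst[OF g, of "?x @ vars ?n" "shift 1"] xs by (simp add: tms_length)
    have "der (WS (P \<Gamma>) (sh 1 ?x) \<union> WS (neg A) (sh 1 (vars ?n)) \<union> set (KK (scomp (up 1 ?d) (shift 1)) \<Gamma> (sh 1 ?x) (g (sh 1 ?x @ sh 1 (vars ?n))))) (K (up 1 ?d) A (a (sh 1 ?x)) (sh 1 (vars ?n)))"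
      by (rule 1) (use wfs_up[OF env'] tms_shift[OF x, of 1] in auto)
    then have "der (WS (P \<Gamma>) (sh 1 ?x) \<union> WS (neg A) (sh 1 (vars ?n)) \<union> set (KK (scomp (shift 1) ?d) \<Gamma> (sh 1 ?x) (sh 1 (g (?x @ vars ?n))))) ?F"
      unfolding scomp_up_shift sg sa .
    moreover have "isubst (shift 1) ` ?D = set (KK (scomp (shift 1) ?d) \<Gamma> (sh 1 ?x) (sh 1 (g (?x @ vars ?n))))"
      by (rule isubst_KK[OF swf(1) env' _ x tg]) simp
    ultimately have "der (isubst (shift 1) ` (WS (P \<Gamma>) ?x \<union> WS (neg A) (vars ?n) \<union> ?D)) ?F"
      unfolding image_Un isubst_WS by simp
    then have "der (WS (P \<Gamma>) ?x \<union> WS (neg A) (vars ?n) \<union> ?D) (IAll ?F)" by (rule der_allI)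
    moreover have "goal_ok (IAll ?F)"
      by (rule goal_ok_All) (use swf env' Wdef_tms[OF a xs] in \<open>auto intro: tms_shift\<close>)
    moreover have "hyp_ok G" if "G \<in> ?D" for G by (rule KK_hyp_ok[OF swf(1) env' x tg that])
    ultimately have "der (WS (P \<Gamma>) xs \<union> bq p (neg A) zs ` ?D) (bq p (neg A) zs (IAll ?F))"
      by (intro bq_mono[OF zs xs])
    then show "der (WS (P \<Gamma>) xs \<union> WS (neg (IAll A)) zs \<union> set (KK e \<Gamma> xs (c (xs @ zs)))) (K e (IAll A) (a xs) zs)"
      unfolding K_IAll by (rule der_cut) (use d[OF env xs xs zs] in \<open>auto intro: der_prem\<close>)
  qed (use swf c a in auto)
qed

text \<open>The pattern is that of \<open>ent_allR\<close>, with the pairs of a witness of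
  \<open>A\<close> and a challenge to \<open>B\<close> as bound variables. In addition, the
  functions of the premise are curried to witness the implication, and its interpretation is
  transported along the resulting provable equations.\<close>

lemma ent_impR:
  assumes "ent (\<Gamma> @ [A]) [B]"
  shows "ent \<Gamma> [Imp A B]"
proof -
  let ?pa = "pos A" and ?na = "neg A" and ?pb = "pos B" and ?nb = "neg B"
  let ?\<rho> = "?pa @ ?nb"
  let ?r = "length ?pa + length ?nb"
  obtain h a where h: "Wdef (P \<Gamma> @ ?\<rho>) (N \<Gamma> @ ?na) h" and a: "Wdef (P \<Gamma> @ ?pa) ?pb a"
    and 1: "\<And>e xs ws. wfs e \<Longrightarrow> xs \<in> tup (P \<Gamma> @ ?pa) \<Longrightarrow> ws \<in> tup ?nb \<Longrightarrow>
      der (WS (P \<Gamma> @ ?pa) xs \<union> WS ?nb ws \<union> set (KK e (\<Gamma> @ [A]) xs (h (xs @ ws)))) (K e B (a xs) ws)"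
    using assms by (rule ent1E) simp
  have swf: "\<forall>A \<in> set \<Gamma>. swf A" "swf A" "swf B" using ent_swf[OF assms] by auto
  \<comment> \<open>The premise challenges \<Gamma> and \<open>A\<close> together. The part for
    \<Gamma> is absorbed into a bound by distribution, the part for \<open>A\<close> becomes a
    component of the witness.\<close>
  let ?f = "\<lambda>v. take (length (N \<Gamma>)) (h v)" and ?g = "\<lambda>v. drop (length (N \<Gamma>)) (h v)"
  have f: "Wdef (P \<Gamma> @ ?\<rho>) (N \<Gamma>) ?f" and g: "Wdef (P \<Gamma> @ ?\<rho>) ?na ?g"
    using Wdef_comp[OF h Wdef_take] Wdef_comp[OF h Wdef_drop] .
  obtain Fa where Fa: "Wdef (P \<Gamma>) (tarrs ?pa ?pb) Fa"
    and Fa_eq: "\<And>xs ys. xs \<in> tup (P \<Gamma>) \<Longrightarrow> ys \<in> tup ?pa \<Longrightarrow> list_all2 peq (tapp (Fa xs) ys) (a (xs @ ys))"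
    using Wdef_abs[OF a] by blast
  obtain Ga where Ga: "Wdef (P \<Gamma>) (tarrs ?\<rho> ?na) Ga"
    and Ga_eq: "\<And>xs ys. xs \<in> tup (P \<Gamma>) \<Longrightarrow> ys \<in> tup ?\<rho> \<Longrightarrow> list_all2 peq (tapp (Ga xs) ys) (?g (xs @ ys))"
    using Wdef_abs[OF g] by blast
  obtain c where dc: "distributes_ctx (P \<Gamma>) ?\<rho> \<Gamma> ?f c" using distributes_ctx_ex[OF swf(1) f] by blast
  note c = distributes_ctxD(1)[OF dc] and d = distributes_ctxD(2)[OF dc, unfolded length_append]
  show ?thesis
  proof (rule ent1I[where \<gamma> = c and a = "\<lambda>x. Fa x @ Ga x"])
    show "Wdef (P \<Gamma>) (pos (Imp A B)) (\<lambda>x. Fa x @ Ga x)" using Wdef_append[OF Fa Ga] by simp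
    show "Wdef (P \<Gamma> @ neg (Imp A B)) (N \<Gamma>) c" using c by simp
    fix e xs zs
    assume env: "wfs e" and xs: "xs \<in> tup (P \<Gamma>)" and "zs \<in> tup (neg (Imp A B))"
    then have zs: "zs \<in> tup (hat p ?\<rho>)" by simp
    let ?d = "scomp (shift ?r) e"
    let ?x = "sh ?r xs" let ?u = "vars (length ?pa)" and ?w = "map Var [length ?pa..<?r]"
    have v: "vars ?r = ?u @ ?w" by (rule vars_add)
    have u: "?u \<in> tup ?pa" and w: "?w \<in> tup ?nb" and uw: "?u @ ?w \<in> tup ?\<rho>"
      by (auto simp: tms_def)
    note env' = wfs_scomp_shift[OF env, of ?r] note x = tms_shift[OF xs, of ?r]
    have xu: "?x @ ?u \<in> tup (P \<Gamma> @ ?pa)" using x u by auto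
    have xv: "?x @ ?u @ ?w \<in> tup (P \<Gamma> @ ?\<rho>)" using x uw by auto
    note tf = Wdef_tms[OF f xv] note tg = Wdef_tms[OF g xv] note ta = Wdef_tms[OF a xu]
    have tF: "Fa ?x \<in> tup ?pb" "Ga ?x \<in> tup ?na"
      using Wdef_tms[OF Fa x] Wdef_tms[OF Ga x] by auto
    have tFu: "tapp (Fa ?x) ?u \<in> tup ?pb" "tapp (Ga ?x) (?u @ ?w) \<in> tup ?na"
      using tapp_tms[OF tF(1) u] tapp_tms[OF tF(2) uw] .
    let ?D = "set (KK ?d \<Gamma> ?x (?f (?x @ ?u @ ?w)))"
    let ?X = "K ?d A ?u (tapp (Ga ?x) (?u @ ?w))" and ?Y = "K ?d B (tapp (Fa ?x) ?u) ?w"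
    let ?H = "insert ?X (WS (P \<Gamma>) ?x \<union> WS ?\<rho> (?u @ ?w) \<union> ?D)"
    have hyp: "hyp_ok G" if "G \<in> ?D" for G by (rule KK_hyp_ok[OF swf(1) env' x tf that])
    have wX: "wff ?X" by (rule wff_K[OF swf(2) env' u tFu(2)])
    have X: "der {?X} (K ?d A ?u (?g (?x @ ?u @ ?w)))"
      by (rule K_peq[OF swf(2) env' peq_refl_list[OF u] tms_length[OF u] Ga_eq[OF x uw] tms_length[OF tFu(2)]])
    have "KK ?d (\<Gamma> @ [A]) (?x @ ?u) (?f (?x @ ?u @ ?w) @ ?g (?x @ ?u @ ?w)) = KK ?d \<Gamma> ?x (?f (?x @ ?u @ ?w)) @ [K ?d A ?u (?g (?x @ ?u @ ?w))]"
      by (simp only: KK_append[OF x tf] KK_single[OF tms_length[OF u] tms_length[OF tg]])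
    then have k: "set (KK ?d (\<Gamma> @ [A]) (?x @ ?u) (h ((?x @ ?u) @ ?w))) = insert (K ?d A ?u (?g (?x @ ?u @ ?w))) ?D"
      by simp
    have "der (WS (P \<Gamma> @ ?pa) (?x @ ?u) \<union> WS ?nb ?w \<union> set (KK ?d (\<Gamma> @ [A]) (?x @ ?u) (h ((?x @ ?u) @ ?w)))) (K ?d B (a (?x @ ?u)) ?w)"
      by (rule 1[OF env' xu w])
    then have "der ?H (K ?d B (a (?x @ ?u)) ?w)"
    proof (rule der_cut)
      fix G assume G: "G \<in> WS (P \<Gamma> @ ?pa) (?x @ ?u) \<union> WS ?nb ?w \<union> set (KK ?d (\<Gamma> @ [A]) (?x @ ?u) (h ((?x @ ?u) @ ?w)))" "wff G"
      have "WS (P \<Gamma> @ ?pa) (?x @ ?u) \<union> WS ?nb ?w = WS (P \<Gamma>) ?x \<union> WS ?\<rho> (?u @ ?w)"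
        using tms_length[OF x] tms_length[OF u] by (simp only: WS_append Un_assoc)
      then have "G = K ?d A ?u (?g (?x @ ?u @ ?w)) \<or> G \<in> WS (P \<Gamma>) ?x \<union> WS ?\<rho> (?u @ ?w) \<union> ?D"
        using G(1) unfolding k by blast
      then show "der ?H G" using der_mono[OF X, of ?H] der_prem[of G ?H] G(2) by blast
    qed
    moreover have "der {K ?d B (a (?x @ ?u)) ?w} ?Y"
      by (rule K_peq[OF swf(3) env' peq_sym_list[OF Fa_eq[OF x u]] tms_length[OF ta] peq_refl_list[OF w] tms_length[OF w]])
    ultimately have "der ?H ?Y" by (auto intro: der_cut)
    then have "der (WS (P \<Gamma>) ?x \<union> WS ?\<rho> (?u @ ?w) \<union> ?D) (Imp ?X ?Y)" using wX by (rule der_impI)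
    then have "der (WS (P \<Gamma>) (sh (length ?\<rho>) xs) \<union> WS ?\<rho> (vars (length ?\<rho>)) \<union> ?D) (Imp ?X ?Y)"
      unfolding length_append v .
    moreover have "goal_ok (Imp ?X ?Y)" by (rule goal_ok_Imp[OF swf(2,3) env' u w tF])
    ultimately have B: "der (WS (P \<Gamma>) xs \<union> bq p ?\<rho> zs ` ?D) (bq p ?\<rho> zs (Imp ?X ?Y))"
      using hyp by (intro bq_mono[OF zs xs])
    let ?K = "WS (P \<Gamma>) xs \<union> WS (hat p ?\<rho>) zs \<union> set (KK e \<Gamma> xs (c (xs @ zs)))"
    have "der ?K (bq p ?\<rho> zs (Imp ?X ?Y))"
    proof (rule der_cut[OF B])
      fix G assume "G \<in> WS (P \<Gamma>) xs \<union> bq p ?\<rho> zs ` ?D" "wff G"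
      then show "der ?K G" using d[OF env xs xs zs, unfolded v] der_prem[of G ?K] by blast
    qed
    moreover have "K e (Imp A B) (Fa xs @ Ga xs) zs = bq p ?\<rho> zs (Imp ?X ?Y)"
      using Wdef_subst[OF Fa tms_length[OF xs], of "shift ?r"] Wdef_subst[OF Ga tms_length[OF xs], of "shift ?r"]
        Wdef_length[OF Fa tms_length[OF xs]]
      by (simp add: K_Imp Let_def)
    ultimately show "der (WS (P \<Gamma>) xs \<union> WS (neg (Imp A B)) zs \<union> set (KK e \<Gamma> xs (c (xs @ zs)))) (K e (Imp A B) (Fa xs @ Ga xs) zs)"
      by simp
  qed (use swf in auto)
qed

subsection \<open>Soundness\<close>

lemma ent_weaken: "ent \<Gamma> \<Theta> \<Longrightarrow> set \<Gamma> \<subseteq> set \<Delta> \<Longrightarrow> \<forall>A \<in> set \<Delta>. swf A \<Longrightarrow> ent \<Delta> \<Theta>"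
  using ent_comp ent_subset by blast

text \<open>The left rules of conjunction, implication and universal quantification are cuts with
  \<open>ent_andE\<close>, \<open>ent_mp\<close> and \<open>ent_allL\<close>; weakening, contraction
  and exchange are instances of \<open>ent_weaken\<close>.\<close>

lemma ent_of_iprov:
  assumes "\<And>\<Gamma> A. (\<Gamma>, A) \<in> iaxs Is \<Longrightarrow> ent \<Gamma> [A]" and "iprov Is \<Gamma> A"
  shows "ent \<Gamma> [A]"
  using assms(2)
proof (induction rule: iprov.induct)
  case (iax \<Gamma> A)
  then show ?case by (rule assms(1))
next
  case (iid A)
  then show ?case by (intro ent_subset) auto
next
  case (icut \<Gamma> A \<Delta> B)
  have "ent (\<Gamma> @ \<Delta>) [A]"
    by (rule ent_weaken[OF icut.IH(1)]) (use ent_swf[OF icut.IH(1)] ent_swf[OF icut.IH(2)] in auto)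
  then show ?case using icut.IH(2) by (rule ent_cut) auto
next
  case (iperm \<Gamma> A \<Delta>)
  have "set \<Gamma> = set \<Delta>" using iperm.hyps(2) by (metis set_mset_mset)
  then show ?case using ent_weaken[OF iperm.IH] ent_swf[OF iperm.IH] by auto
next
  case (iwk \<Gamma> B A)
  show ?case by (rule ent_weaken[OF iwk.IH]) (use iwk.hyps ent_swf[OF iwk.IH] in auto)
next
  case (icon A \<Gamma> B)
  show ?case by (rule ent_weaken[OF icon.IH]) (use ent_swf[OF icon.IH] in auto)
next
  case (ibotL A)
  then show ?case by (rule ent_bot)
next
  case (iandL A B \<Gamma> C)
  have w: "\<forall>D \<in> set (A # B # \<Gamma>). swf D" using ent_swf[OF iandL.IH] by auto
  have "ent (And A B # \<Gamma>) [A, B]" by (rule ent_weaken[OF ent_andE]) (use w in auto)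
  then show ?case using iandL.IH by (rule ent_cut) auto
next
  case (iandR \<Gamma> A \<Delta> B)
  have w: "\<forall>D \<in> set (\<Gamma> @ \<Delta> @ [A, B]). swf D" using ent_swf[OF iandR.IH(1)] ent_swf[OF iandR.IH(2)] by auto
  have "ent (\<Gamma> @ \<Delta>) ([A] @ [B])"
    by (rule ent_pair; rule ent_weaken, rule iandR.IH) (use w in auto)
  then have "ent (\<Gamma> @ \<Delta>) [A, B]" by simp
  moreover have "ent [A, B] [And A B]" by (rule ent_andI) (use w in auto)
  ultimately show ?case by (rule ent_comp)
next
  case (iimpL \<Gamma> A B \<Delta> C)
  have w: "\<forall>D \<in> set (\<Gamma> @ \<Delta> @ [A, B]). swf D" using ent_swf[OF iimpL.IH(1)] ent_swf[OF iimpL.IH(2)] by auto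
  have "ent (Imp A B # \<Gamma> @ \<Delta>) [A]" by (rule ent_weaken[OF iimpL.IH(1)]) (use w in auto)
  moreover have "ent [Imp A B, A] [B]" by (rule ent_mp) (use w in auto)
  ultimately have "ent (Imp A B # \<Gamma> @ \<Delta>) [B]" by (rule ent_cut) auto
  then show ?case using iimpL.IH(2) by (rule ent_cut) auto
next
  case (iimpR A \<Gamma> B)
  have "ent (\<Gamma> @ [A]) [B]" by (rule ent_weaken[OF iimpR.IH]) (use ent_swf[OF iimpR.IH] in auto)
  then show ?case by (rule ent_impR)
next
  case (iallL t A \<Gamma> B)
  have w: "\<forall>D \<in> set (isubst (inst [t]) A # \<Gamma>). swf D" using ent_swf[OF iallL.IH] by auto
  then have A: "swf A" by (auto dest: iwf_of_subst)
  have "ent (IAll A # \<Gamma>) [isubst (inst [t]) A]"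
    by (rule ent_weaken[OF ent_allL[OF A iallL.hyps(2)]]) (use w A in auto)
  then show ?case using iallL.IH by (rule ent_cut) auto
next
  case (iallR \<Gamma> A)
  then show ?case by (intro ent_allR)
next
  case (iexL A \<Gamma> B)
  have w: "\<forall>D \<in> set (A # map (isubst (shift 1)) \<Gamma>). swf D" using ent_swf[OF iexL.IH] by auto
  have "ent (map (isubst (shift 1)) \<Gamma> @ [A]) [isubst (shift 1) B]"
    by (rule ent_weaken[OF iexL.IH]) (use w in auto)
  then have "ent (\<Gamma> @ [IEx A]) [B]" by (rule ent_exL)
  then show ?case by (rule ent_weaken) (use w in \<open>auto simp: iwf_isubst_iff\<close>)
next
  case (iexR \<Gamma> t A)
  have "swf A" using ent_swf[OF iexR.IH] by (auto dest: iwf_of_subst)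
  then show ?case using ent_comp[OF iexR.IH ent_exR] iexR.hyps(2) by blast
qed

section \<open>Passage between entailments and closed witnessing terms\<close>

lemma der_iWc: "iprov It [] (iWc p \<tau>s ts) \<Longrightarrow> F \<in> WS \<tau>s ts \<Longrightarrow> der {} F"
  using der_iconj[of F "iWs p \<tau>s ts" "{}"] iprov_der[of "[]"] by (simp add: iWc_def)

lemma Wdef_ctms:
  assumes "ts \<in> ctms (ilang It) (length \<tau>s)" and "iprov It [] (iWc p (tarrs \<sigma>s \<tau>s) ts)"
  shows "Wdef \<sigma>s \<tau>s (tapp ts)"
proof -
  have "Wdef \<sigma>s (tarrs \<sigma>s \<tau>s) (\<lambda>_. ts)"
    by (rule Wdef_const) (use assms der_iWc in \<open>auto simp: ctms_def tms_def\<close>)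
  from Wdef_tapp[OF this Wdef_id] show ?thesis .
qed

lemma Wdef_closed:
  assumes "Wdef [] \<tau>s F"
  shows "F [] \<in> ctms (ilang It) (length \<tau>s)" and "iprov It [] (iWc p \<tau>s (F []))"
proof -
  obtain ts where ts: "list_all2 (wtyped []) ts \<tau>s" "F [] = map (tsubst (inst [])) ts"
    using assms by (auto simp: Wdef_def)
  have cl: "tfv t = {}" if "t \<in> set ts" for t
    using that ts(1) wtyped_tfv[of "[]"] by (fastforce simp: list_all2_conv_all_nth in_set_conv_nth)
  then have "F [] = ts" by (simp add: ts(2) tsubst_closed map_idI)
  then show "F [] \<in> ctms (ilang It) (length \<tau>s)" using cl list_all2_wtyped_tms[OF ts(1)] by (simp add: ctms_def)
  have "der {} G" if "G \<in> WS \<tau>s (F [])" for G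
    using Wdef_W[OF assms _ that] by (simp add: tms_def)
  then have "der {} (iWc p \<tau>s (F []))" unfolding iWc_def by (rule der_iconjI)
  then show "iprov It [] (iWc p \<tau>s (F []))" using der_iprov[of "[]"] by simp
qed

text \<open>\<open>witnessable\<close> speaks about one sequent in fresh variables; the substitution
  \<open>ext (xs @ ws) e\<close> turns it into each instance that an entailment requires.\<close>

lemma ent_of_witnessable:
  assumes w: "witnessable p It \<Gamma> A" and swf: "\<forall>B \<in> set \<Gamma>. swf B" "swf A"
  shows "ent \<Gamma> [A]"
proof -
  let ?m = "length (P \<Gamma>)" and ?n = "length (neg A)"
  let ?vx = "vars ?m" and ?vw = "map Var [?m..<?m + ?n] :: 'c tm list"
  obtain g a where g: "g \<in> ctms (ilang It) (length (N \<Gamma>))" "iprov It [] (iWc p (tarrs (P \<Gamma>) (tarrs (neg A) (N \<Gamma>))) g)"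
    and a: "a \<in> ctms (ilang It) (length (pos A))" "iprov It [] (iWc p (tarrs (P \<Gamma>) (pos A)) a)"
    and pr: "iprov It (iWs p (P \<Gamma>) ?vx @ iWs p (neg A) ?vw @ KK (shift (?m + ?n)) \<Gamma> ?vx (tapp g (?vx @ ?vw)))
       (K (shift (?m + ?n)) A (tapp a ?vx) ?vw)"
    using w unfolding witnessable_def Let_def interp_circ_K KK_def[symmetric] by blast
  have Wg: "Wdef (P \<Gamma> @ neg A) (N \<Gamma>) (tapp g)" by (rule Wdef_ctms) (use g in auto)
  have Wa: "Wdef (P \<Gamma>) (pos A) (tapp a)" by (rule Wdef_ctms[OF a])
  show ?thesis
  proof (rule ent1I[OF swf Wg Wa])
    fix e xs ws
    assume env: "wfs e" and xs: "xs \<in> TM ?m" and ws: "ws \<in> TM ?n"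
    let ?e = "ext (xs @ ws) e"
    note l = tms_length[OF xs] tms_length[OF ws]
    have e: "wft (?e i)" for i using xs ws wfs_wft[OF env] by (intro twf_ext) (auto simp: tms_def)
    have s: "map (tsubst ?e) ?vx = xs" "map (tsubst ?e) ?vw = ws" using l by simp_all
    have c: "scomp ?e (shift (?m + ?n)) = e" using l by simp
    have sg: "map (tsubst ?e) (tapp g (?vx @ ?vw)) = tapp g (xs @ ws)"
      using Wdef_subst[OF Wg, of "?vx @ ?vw" ?e] unfolding map_append s by simp
    have sa: "map (tsubst ?e) (tapp a ?vx) = tapp a xs"
      using Wdef_subst[OF Wa, of "?vx" ?e] unfolding s by simp
    have vw: "?vx @ ?vw \<in> tup (P \<Gamma> @ neg A)" by (auto simp: tms_def)
    have wsh: "wfs (shift (?m + ?n))" by simp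
    have k: "isubst ?e ` set (KK (shift (?m + ?n)) \<Gamma> ?vx (tapp g (?vx @ ?vw))) = set (KK e \<Gamma> xs (tapp g (xs @ ws)))"
      using isubst_KK[OF swf(1) wsh, of ?e, OF e tms_vars_simps(2) Wdef_tms[OF Wg vw]] unfolding s sg c .
    have k': "isubst ?e (K (shift (?m + ?n)) A (tapp a ?vx) ?vw) = K e A (tapp a xs) ws"
      using isubst_K[OF swf(2) wsh, of ?e, OF e Wdef_tms[OF Wa tms_vars_simps(2)] tms_vars_simps(1)[of ?m]] unfolding s sa c .
    have "der (isubst ?e ` set (iWs p (P \<Gamma>) ?vx @ iWs p (neg A) ?vw @ KK (shift (?m + ?n)) \<Gamma> ?vx (tapp g (?vx @ ?vw))))
       (isubst ?e (K (shift (?m + ?n)) A (tapp a ?vx) ?vw))"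
      by (rule der_subst[OF iprov_der[OF pr], of ?e, OF e])
    then show "der (WS (P \<Gamma>) xs \<union> WS (neg A) ws \<union> set (KK e \<Gamma> xs (tapp g (xs @ ws)))) (K e A (tapp a xs) ws)"
      unfolding set_append image_Un isubst_WS s k k' by (simp add: Un_assoc)
  qed
qed

text \<open>The entailment is taken at fresh variables, with the environment that shifts past them.
  Abstraction over the empty context turns its two functions into closed terms, and
  \<open>KK_peq\<close> and \<open>K_peq\<close> repair the difference made by beta.\<close>

lemma witnessable_of_ent:
  assumes "ent \<Gamma> [A]"
  shows "witnessable p It \<Gamma> A"
proof -
  let ?m = "length (P \<Gamma>)" and ?n = "length (neg A)"
  let ?vx = "vars ?m" and ?vw = "map Var [?m..<?m + ?n] :: 'c tm list"
  have swf: "\<forall>B \<in> set \<Gamma>. swf B" "swf A" using ent_swf[OF assms] by auto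
  obtain g a where g: "Wdef (P \<Gamma> @ neg A) (N \<Gamma>) g" and a: "Wdef (P \<Gamma>) (pos A) a"
    and 1: "\<And>e xs ws. wfs e \<Longrightarrow> xs \<in> TM ?m \<Longrightarrow> ws \<in> TM ?n \<Longrightarrow>
      der (WS (P \<Gamma>) xs \<union> WS (neg A) ws \<union> set (KK e \<Gamma> xs (g (xs @ ws)))) (K e A (a xs) ws)"
    using assms by (rule ent1E) blast
  obtain G where G: "Wdef [] (tarrs (P \<Gamma> @ neg A) (N \<Gamma>)) G"
    and G_eq: "\<And>ys. ys \<in> tup (P \<Gamma> @ neg A) \<Longrightarrow> list_all2 peq (tapp (G []) ys) (g ys)"
    using Wdef_abs[of "[]"] g by (fastforce simp: tms_def)
  obtain F where F: "Wdef [] (tarrs (P \<Gamma>) (pos A)) F"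
    and F_eq: "\<And>ys. ys \<in> TM ?m \<Longrightarrow> list_all2 peq (tapp (F []) ys) (a ys)"
    using Wdef_abs[of "[]"] a by (fastforce simp: tms_def)
  have xw: "?vx @ ?vw \<in> tup (P \<Gamma> @ neg A)" by (auto simp: tms_def)
  have wsh: "wfs (shift (?m + ?n))" by simp
  have vx: "?vx \<in> TM ?m" and vw: "?vw \<in> TM ?n" by simp_all
  have tG: "tapp (G []) (?vx @ ?vw) \<in> tup (N \<Gamma>)" and tF: "tapp (F []) ?vx \<in> tup (pos A)"
    using Wdef_closed(1)[OF G] Wdef_closed(1)[OF F] tapp_tms[OF _ xw] tapp_tms[OF _ vx] by (auto simp: ctms_def)
  let ?L = "iWs p (P \<Gamma>) ?vx @ iWs p (neg A) ?vw @ KK (shift (?m + ?n)) \<Gamma> ?vx (tapp (G []) (?vx @ ?vw))"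
  have "der (set ?L) (K (shift (?m + ?n)) A (a ?vx) ?vw)"
  proof (rule der_cut[OF 1[OF wsh vx vw]])
    fix H assume H: "H \<in> WS (P \<Gamma>) ?vx \<union> WS (neg A) ?vw \<union> set (KK (shift (?m + ?n)) \<Gamma> ?vx (g (?vx @ ?vw)))" "wff H"
    then consider "H \<in> WS (P \<Gamma>) ?vx \<union> WS (neg A) ?vw" | "H \<in> set (KK (shift (?m + ?n)) \<Gamma> ?vx (g (?vx @ ?vw)))"
      by blast
    then show "der (set ?L) H"
    proof cases
      case 1
      then show ?thesis using H(2) by (auto intro: der_prem)
    next
      case 2
      show ?thesis by (rule der_mono[OF KK_peq[OF swf(1) wsh vx tG G_eq[OF xw] 2]]) auto
    qed
  qed
  moreover have "der {K (shift (?m + ?n)) A (a ?vx) ?vw} (K (shift (?m + ?n)) A (tapp (F []) ?vx) ?vw)"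
    by (rule K_peq[OF swf(2) wsh peq_sym_list[OF F_eq[OF vx]] _ peq_refl_list[OF vw] tms_length[OF vw]])
      (use Wdef_length[OF a] in simp)
  ultimately have "der (set ?L) (K (shift (?m + ?n)) A (tapp (F []) ?vx) ?vw)" using der_cut by blast
  then have "iprov It ?L (K (shift (?m + ?n)) A (tapp (F []) ?vx) ?vw)"
    by (rule der_iprov) (use wff_WS[OF vx] wff_WS[OF vw] KK_wff[OF swf(1) wsh vx tG] in auto)
  then show ?thesis
    using Wdef_closed[OF G] Wdef_closed[OF F] unfolding witnessable_def Let_def interp_circ_K KK_def[symmetric] tarrs_tarrs length_tarrs
    by blast
qed

lemma soundness:
  assumes "\<forall>(\<Gamma>, A) \<in> iaxs Is. witnessable p It \<Gamma> A" and "iprov Is \<Gamma> A"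
  shows "witnessable p It \<Gamma> A"
proof (rule witnessable_of_ent[OF ent_of_iprov[OF _ assms(2)]])
  fix \<Gamma> A assume "(\<Gamma>, A) \<in> iaxs Is"
  then show "ent \<Gamma> [A]" using assms(1) il_Is by (intro ent_of_witnessable) (auto simp: il_theory_def)
qed

end

theorem theorem3p13:
  fixes Is It :: "('c, 'p) ithy"
    and p :: "('c, 'p, ('c, 'p) ifm) params"
  assumes "il_theory Is" and "il_theory It"
    and "il_params (ilang Is) (ilang It) p"
    and "A1 (girard_thy It)"
    and "A2 (girard_thy Is) (girard_thy It) (girard_params p)"
    and "A3 (girard_thy It) (girard_params p)"
    and "A4 (girard_thy It) (girard_params p)"
    and "A5 (girard_thy It) (girard_params p)
           (interp_fms (girard_thy Is) (girard_thy It) (girard_params p))"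
    and "W_inhabited It p"
    and "\<forall>(\<Gamma>, A) \<in> iaxs Is. witnessable p It \<Gamma> A"
  shows "\<forall>\<Gamma> A. iprov Is \<Gamma> A \<longrightarrow> witnessable p It \<Gamma> A"
proof -
  interpret circ_interp It Is p
    by unfold_locales (fact assms)+
  show ?thesis using soundness[OF assms(10)] by blast
qed

end
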